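(* Let $(\boldsymbol{z}^{(n)})_{n\in\mathbb{N}}$ be a sequence of vectors in $l^2_\searrow$, put $\kappa_n=\kappa(\boldsymbol{z}^{(n)})$ and $\sigma_n^{(k)}=\sigma^{(k)}(\boldsymbol{z}^{(n)})$ for $k=1,2$, and let $K^{(n)}(t)$ be the number of connected components at time $t\ge 0$ of the multiplicative random graph process $G^{(n)}=G^{\boldsymbol{z}^{(n)}}$ with initial masses $\boldsymbol{z}^{(n)}$. Assume that $\kappa_n<\infty$ for every $n\in\mathbb{N}$, that $\kappa_n\to\infty$, and that there exist two real sequences $(\varkappa_n)_n$ and $(\varsigma_n)_n$ such that \[ \frac{\kappa_n}{\varkappa_n}\xrightarrow[n\to\infty]{}1 \quad\text{and}\quad \frac{\sigma_n^{(2)}}{\varsigma_n}\xrightarrow[n\to\infty]{}1 . \] In addition, suppose there exists a non-negative constant $\alpha$ such that \[ \frac{(\sigma_n^{(1)})^2}{\varkappa_n\,\varsigma_n}\xrightarrow[n\to\infty]{}\alpha . \] Then, for every $[0,c]\subset[0,1)$, \[ \left(\frac{1}{\varkappa_n}K^{(n)}\left(\frac{t}{\varsigma_n}\right)\right)_{t\in[0,c]} \Rightarrow \Big(1-t\,\frac{\alpha}{2}\Big)_{t\in[0,c]} \quad\text{in } D([0,c],\mathbb{R}) \text{ as } n\to\infty . \] If, in addition, there exist two non-negative real constants $\beta_1$ and $\beta_2$ such that \[ \sqrt{\varkappa_n}\left(\frac{\kappa_n}{\varkappa_n}-1\right)\xrightarrow[n\to\infty]{}\beta_1 \quad\text{and}\quad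 \sqrt{\varkappa_n}\left(\frac{(\sigma_n^{(1)})^2}{\varkappa_n\varsigma_n}-\alpha\right)\xrightarrow[n\to\infty]{}\beta_2 , \] then, for every $[0,c]\subset[0,1)$, \[ \left(\sqrt{\varkappa_n}\left(\frac{1}{\varkappa_n}K^{(n)}\Big(\frac{t}{\varsigma_n}\Big)-\Big(1-t\,\frac{\alpha}{2}\Big)\right)\right)_{t\in[0,c]} \Rightarrow \left(\beta_1-\beta_2\frac{t}{2}+B\Big(\alpha\frac{t}{2}\Big)\right)_{t\in[0,c]} \] in $D([0,c],\mathbb{R})$ as $n\to\infty$, where $(B(t))_{t\ge0}$ is a (standard one-dimensional) Brownian motion.
   Context: $l^2_\searrow$ is the set of square-summable sequences $\boldsymbol{x}=(x_1,x_2,\dots)$ of non-negative reals arranged in decreasing (non-increasing) order. For $\boldsymbol{x}\in l^2_\searrow$, $\kappa(\boldsymbol{x})=\sum_{i\ge1}\mathbf{1}_{(0,\infty)}(x_i)$ is the number of non-zero components, and $\sigma^{(k)}(\boldsymbol{x})=\sum_{i\ge1}x_i^k$ for $k=1,2$. For $\boldsymbol{z}\in l^2_\searrow$ with $\kappa(\boldsymbol{z})<\infty$, the multiplicative random graph process $G^{\boldsymbol{z}}=(G^{\boldsymbol{z}}(t))_{t\ge0}$ is the graph-valued continuous-time Markov process whose vertices are the indices $i$ with $z_i>0$, vertex $i$ having mass $z_i$, which starts with no edges at time $0$, and in which the edge between each pair $i\ne j$ appears (and then stays forever) after an exponential time with rate $z_i z_j$, independently of the other edges. The weighted size of a connected component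 is the sum of the masses of its vertices; $X^{\boldsymbol{z}}(t)\in l^2_\searrow$ is the vector of weighted sizes of the connected components of $G^{\boldsymbol{z}}(t)$ in decreasing order (completed by zeros), and the number of connected components is $K^{\boldsymbol{z}}(t)=\kappa(X^{\boldsymbol{z}}(t))$. In the claim $K^{(n)}=K^{\boldsymbol{z}^{(n)}}$. $D([0,c],\mathbb{R})$ is the space of càdlàg real-valued functions on $[0,c]$ with the Skorokhod $J_1$ topology, and $\Rightarrow$ denotes convergence in distribution. Since $\kappa_n\to\infty$, the hypotheses force $\varkappa_n>0$ and $\varsigma_n>0$ for all large $n$; all expressions are considered for such $n$. *)

theory Defs
  imports "HOL-Probability.Probability"
begin

text \<open>Sequences are indexed from \<open>0\<close>.  The quantities \<open>kappa\<close> and \<open>sigma_pow\<close> may be infinite.\<close>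

definition l2_dec :: "(nat \<Rightarrow> real) set" where
  "l2_dec = {x. (\<forall>i. 0 \<le> x i) \<and> decseq x \<and> summable (\<lambda>i. (x i)\<^sup>2)}"

definition kappa :: "(nat \<Rightarrow> real) \<Rightarrow> ennreal" where
  "kappa x = (\<Sum>i. indicator {0<..} (x i))"

definition sigma_pow :: "nat \<Rightarrow> (nat \<Rightarrow> real) \<Rightarrow> ennreal" where
  "sigma_pow k x = (\<Sum>i. ennreal (x i ^ k))"

text \<open>A simple graph has a vertex set \<open>V\<close> and a set \<open>E\<close> of two-element edges \<open>{i, j}\<close>.\<close>

definition components :: "'v set \<Rightarrow> 'v set set \<Rightarrow> 'v set set" where
  "components V E = V // {(i, j) \<in> V \<times> V. (i, j) \<in> {(a, b). {a, b} \<in> E}\<^sup>*}"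

definition num_components :: "'v set \<Rightarrow> 'v set set \<Rightarrow> nat" where
  "num_components V E = card (components V E)"

definition vertices :: "(nat \<Rightarrow> real) \<Rightarrow> nat set" where
  "vertices z = {i. 0 < z i}"

definition all_edges :: "(nat \<Rightarrow> real) \<Rightarrow> nat set set" where
  "all_edges z = {{i, j} |i j. i \<in> vertices z \<and> j \<in> vertices z \<and> i \<noteq> j}"

text \<open>The process is represented by its edge set \<open>G t \<omega>\<close> at time \<open>t\<close>; the vertex set
  \<open>vertices z\<close> is constant.  The random variable \<open>T e\<close> is the time at which the edge \<open>e\<close>
  appears.\<close>

locale mult_graph_process = prob_space M
  for M :: "'w measure" and z :: "nat \<Rightarrow> real" and G :: "real \<Rightarrow> 'w \<Rightarrow> nat set set" +
  assumes starts_empty: "\<omega> \<in> space M \<Longrightarrow> G 0 \<omega> = {}"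
    and edge_times: "\<exists>T :: nat set \<Rightarrow> 'w \<Rightarrow> real.
      indep_vars (\<lambda>_. borel) T (all_edges z) \<and>
      (\<forall>i\<in>vertices z. \<forall>j\<in>vertices z. i \<noteq> j \<longrightarrow>
        distributed M lborel (T {i, j}) (exponential_density (z i * z j))) \<and>
      (\<forall>\<omega>\<in>space M. \<forall>t\<ge>0. G t \<omega> = {e \<in> all_edges z. T e \<omega> \<le> t})"

definition K_proc ::
    "(nat \<Rightarrow> real) \<Rightarrow> (real \<Rightarrow> 'w \<Rightarrow> nat set set) \<Rightarrow> real \<Rightarrow> 'w \<Rightarrow> nat" where
  "K_proc z G t \<omega> = num_components (vertices z) (G t \<omega>)"

text \<open>The vector of weighted component sizes in decreasing order, completed by zeros.  The lemma
  \<open>kappa_weight_vector\<close> below says that the number of its non-zero entries is the number of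
  components.\<close>

definition weight_vector :: "(nat \<Rightarrow> real) \<Rightarrow> nat set set \<Rightarrow> nat \<Rightarrow> real" where
  "weight_vector z E k =
     (let ws = rev (sorted_list_of_multiset
                 (image_mset (\<lambda>C. \<Sum>i\<in>C. z i) (mset_set (components (vertices z) E))))
      in if k < length ws then ws ! k else 0)"

lemma kappa_weight_vector:
  assumes fin: "finite (vertices z)"
  shows "kappa (weight_vector z E) = of_nat (num_components (vertices z) E)"
proof -
  let ?C = "components (vertices z) E"
  let ?R = "{(i, j) \<in> vertices z \<times> vertices z. (i, j) \<in> {(a, b). {a, b} \<in> E}\<^sup>*}"
  define ws where "ws = rev (sorted_list_of_multiset
                 (image_mset (\<lambda>C. \<Sum>i\<in>C. z i) (mset_set ?C)))"
  have finC: "finite ?C"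
    unfolding components_def by (rule finite_quotient) (use fin in auto)
  have len: "length ws = card ?C"
  proof -
    have "length ws = size (mset ws)" by simp
    also have "\<dots> = size (mset_set ?C)" unfolding ws_def mset_rev by simp
    finally show ?thesis using finC by simp
  qed
  have pos: "0 < w" if "w \<in> set ws" for w
  proof -
    have "w \<in> (\<lambda>C. \<Sum>i\<in>C. z i) ` ?C" using that finC by (simp add: ws_def)
    then obtain C where C: "C \<in> ?C" and w: "w = (\<Sum>i\<in>C. z i)" by auto
    from C obtain v where v: "v \<in> vertices z" and Cv: "C = ?R `` {v}"
      unfolding components_def by (auto simp: quotient_def)
    have "v \<in> C" "C \<subseteq> vertices z" using v Cv by auto
    moreover from this have "finite C" using finite_subset[OF _ fin] by blast
    ultimately show ?thesis unfolding w
      by (intro sum_pos) (auto simp: vertices_def)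
  qed
  have "kappa (weight_vector z E) = (\<Sum>k. indicator {..<length ws} k)"
    unfolding kappa_def
  proof (rule arg_cong[where f = suminf], rule ext)
    fix k
    show "indicator {0<..} (weight_vector z E k) = (indicator {..<length ws} k :: ennreal)"
      using pos[of "ws ! k"] by (auto simp: weight_vector_def Let_def ws_def[symmetric] indicator_def)
  qed
  also have "\<dots> = (\<Sum>k\<in>{..<length ws}. indicator {..<length ws} k)"
    by (rule suminf_finite) auto
  also have "\<dots> = of_nat (length ws)" by simp
  finally show ?thesis by (simp add: len num_components_def)
qed

locale brownian_motion = prob_space N
  for N :: "'v measure" and B :: "real \<Rightarrow> 'v \<Rightarrow> real" +
  assumes start: "\<omega> \<in> space N \<Longrightarrow> B 0 \<omega> = 0"
    and continuous_paths: "\<omega> \<in> space N \<Longrightarrow> continuous_on {0..} (\<lambda>t. B t \<omega>)"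
    and measurable_B: "0 \<le> t \<Longrightarrow> B t \<in> borel_measurable N"
    and normal_increments: "0 \<le> s \<Longrightarrow> s < t \<Longrightarrow>
      distributed N lborel (\<lambda>\<omega>. B t \<omega> - B s \<omega>) (normal_density 0 (sqrt (t - s)))"
    and indep_increments: "0 \<le> u (0::nat) \<Longrightarrow> mono u \<Longrightarrow>
      indep_vars (\<lambda>_. borel) (\<lambda>i \<omega>. B (u (Suc i)) \<omega> - B (u i) \<omega>) {..<n}"

text \<open>Paths on \<open>{0..c}\<close> are extensional functions, so that equality of paths is equality
  on \<open>{0..c}\<close>.\<close>

definition cadlag_space :: "real \<Rightarrow> (real \<Rightarrow> real) set" where
  "cadlag_space c = {x \<in> extensional {0..c}.
     (\<forall>t\<in>{0..<c}. (x \<longlongrightarrow> x t) (at_right t)) \<and>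
     (\<forall>t\<in>{0<..c}. \<exists>l. (x \<longlongrightarrow> l) (at_left t))}"

definition time_changes :: "real \<Rightarrow> (real \<Rightarrow> real) set" where
  "time_changes c = {l. strict_mono_on {0..c} l \<and> continuous_on {0..c} l \<and> l ` {0..c} = {0..c}}"

text \<open>The \<open>J\<^sub>1\<close> distance of \<open>x\<close> and \<open>y\<close> is the infimum of the \<open>r\<close> for which some time change
  \<open>l\<close> satisfies \<open>\<parallel>l - id\<parallel> \<le> r\<close> and \<open>\<parallel>x - y \<circ> l\<parallel> \<le> r\<close> in supremum norm.\<close>

definition J1_bounds :: "real \<Rightarrow> (real \<Rightarrow> real) \<Rightarrow> (real \<Rightarrow> real) \<Rightarrow> real set" where
  "J1_bounds c x y = {r. 0 \<le> r \<and> (\<exists>l\<in>time_changes c.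
     (\<forall>t\<in>{0..c}. \<bar>l t - t\<bar> \<le> r) \<and> (\<forall>t\<in>{0..c}. \<bar>x t - y (l t)\<bar> \<le> r))}"

text \<open>Outside the space the distance is set to \<open>0\<close>, because \<open>Metric_space\<close> asks for
  non-negativity and symmetry of the distance on the whole type.\<close>

definition J1_dist :: "real \<Rightarrow> (real \<Rightarrow> real) \<Rightarrow> (real \<Rightarrow> real) \<Rightarrow> real" where
  "J1_dist c x y =
     (if x \<in> cadlag_space c \<and> y \<in> cadlag_space c then Inf (J1_bounds c x y) else 0)"

definition J1_topology :: "real \<Rightarrow> (real \<Rightarrow> real) topology" where
  "J1_topology c = Metric_space.mtopology (cadlag_space c) (J1_dist c)"

lemma time_changes_id: "(\<lambda>t. t) \<in> time_changes c"
  by (auto simp: time_changes_def strict_mono_on_def)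

lemma time_changes_comp:
  assumes "l \<in> time_changes c" "m \<in> time_changes c"
  shows "(\<lambda>t. m (l t)) \<in> time_changes c"
proof -
  have im: "l ` {0..c} = {0..c}" "m ` {0..c} = {0..c}" using assms by (auto simp: time_changes_def)
  have mem: "l t \<in> {0..c}" if "t \<in> {0..c}" for t using im that by blast
  have "strict_mono_on {0..c} (\<lambda>t. m (l t))"
  proof (rule strict_mono_onI)
    fix s t assume st: "s \<in> {0..c}" "t \<in> {0..c}" "s < t"
    have "strict_mono_on {0..c} l" "strict_mono_on {0..c} m"
      using assms by (simp_all add: time_changes_def)
    then show "m (l s) < m (l t)"
      using mem[OF st(1)] mem[OF st(2)] st by (metis strict_mono_onD)
  qed
  moreover have "continuous_on {0..c} (\<lambda>t. m (l t))"
  proof (rule continuous_on_compose2[of "{0..c}" m "{0..c}" l])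
    show "continuous_on {0..c} m" "continuous_on {0..c} l"
      using assms by (simp_all add: time_changes_def)
    show "l ` {0..c} \<subseteq> {0..c}" using im by blast
  qed
  moreover have "(\<lambda>t. m (l t)) ` {0..c} = {0..c}"
    using im by (metis image_image)
  ultimately show ?thesis by (simp add: time_changes_def)
qed

lemma time_changes_inv:
  assumes l: "l \<in> time_changes c"
  shows "inv_into {0..c} l \<in> time_changes c"
proof -
  have im: "l ` {0..c} = {0..c}" and sm: "strict_mono_on {0..c} l" and co: "continuous_on {0..c} l"
    using l by (auto simp: time_changes_def)
  have inj: "inj_on l {0..c}" using sm by (rule strict_mono_on_imp_inj_on)
  have "continuous_on (l ` {0..c}) (inv_into {0..c} l)"
    by (rule continuous_on_inv[OF co]) (use inj in auto)
  moreover have "inv_into {0..c} l ` {0..c} = {0..c}"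
    using inv_into_image_cancel[OF inj, of "{0..c}"] im by simp
  moreover have "strict_mono_on {0..c} (inv_into {0..c} l)"
  proof (rule strict_mono_onI)
    fix s t assume st: "s \<in> {0..c}" "t \<in> {0..c}" "s < t"
    have s: "inv_into {0..c} l s \<in> {0..c}" "l (inv_into {0..c} l s) = s"
      using st im by (metis inv_into_into, metis f_inv_into_f)
    have t: "inv_into {0..c} l t \<in> {0..c}" "l (inv_into {0..c} l t) = t"
      using st im by (metis inv_into_into, metis f_inv_into_f)
    show "inv_into {0..c} l s < inv_into {0..c} l t"
    proof (rule ccontr)
      assume "\<not> ?thesis"
      then have "l (inv_into {0..c} l t) \<le> l (inv_into {0..c} l s)"
        using s t sm by (intro strict_mono_on_leD[OF sm]) auto
      with s t st show False by simp
    qed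
  qed
  ultimately show ?thesis using im by (simp add: time_changes_def)
qed

lemma J1_boundsI:
  assumes "0 \<le> r" "l \<in> time_changes c" "\<And>t. t \<in> {0..c} \<Longrightarrow> \<bar>l t - t\<bar> \<le> r"
    "\<And>t. t \<in> {0..c} \<Longrightarrow> \<bar>x t - y (l t)\<bar> \<le> r"
  shows "r \<in> J1_bounds c x y"
  using assms unfolding J1_bounds_def by blast

lemma J1_bounds_sym: "J1_bounds c x y \<subseteq> J1_bounds c y x"
proof
  fix r assume "r \<in> J1_bounds c x y"
  then obtain l where l: "l \<in> time_changes c" and r: "0 \<le> r"
    and b: "\<And>t. t \<in> {0..c} \<Longrightarrow> \<bar>l t - t\<bar> \<le> r" "\<And>t. t \<in> {0..c} \<Longrightarrow> \<bar>x t - y (l t)\<bar> \<le> r"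
    by (auto simp: J1_bounds_def)
  let ?m = "inv_into {0..c} l"
  have im: "l ` {0..c} = {0..c}" using l by (auto simp: time_changes_def)
  have m: "?m t \<in> {0..c}" "l (?m t) = t" if "t \<in> {0..c}" for t
    using that im by (metis inv_into_into, metis f_inv_into_f)
  have "\<bar>?m t - t\<bar> \<le> r \<and> \<bar>y t - x (?m t)\<bar> \<le> r" if "t \<in> {0..c}" for t
    using b[of "?m t"] m[OF that] by (simp add: abs_minus_commute)
  then show "r \<in> J1_bounds c y x"
    by (intro J1_boundsI[OF r time_changes_inv[OF l]]) auto
qed

lemma J1_bounds_triangle:
  assumes "r \<in> J1_bounds c x y" "s \<in> J1_bounds c y z"
  shows "r + s \<in> J1_bounds c x z"
proof -
  obtain l where l: "l \<in> time_changes c" "0 \<le> r"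
    and lb: "\<And>t. t \<in> {0..c} \<Longrightarrow> \<bar>l t - t\<bar> \<le> r" "\<And>t. t \<in> {0..c} \<Longrightarrow> \<bar>x t - y (l t)\<bar> \<le> r"
    using assms by (auto simp: J1_bounds_def)
  obtain m where m: "m \<in> time_changes c" "0 \<le> s"
    and mb: "\<And>t. t \<in> {0..c} \<Longrightarrow> \<bar>m t - t\<bar> \<le> s" "\<And>t. t \<in> {0..c} \<Longrightarrow> \<bar>y t - z (m t)\<bar> \<le> s"
    using assms by (auto simp: J1_bounds_def)
  have "l ` {0..c} = {0..c}" using l by (auto simp: time_changes_def)
  then have mem: "l t \<in> {0..c}" if "t \<in> {0..c}" for t using that by blast
  have "\<bar>m (l t) - t\<bar> \<le> r + s" "\<bar>x t - z (m (l t))\<bar> \<le> r + s" if "t \<in> {0..c}" for t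
    using lb[OF that] mb[OF mem[OF that]] by linarith+
  then show ?thesis
    by (intro J1_boundsI[OF _ time_changes_comp[OF l(1) m(1)]]) (use l m in auto)
qed

lemma cadlag_bounded:
  assumes x: "x \<in> cadlag_space c"
  obtains b where "0 \<le> b" "\<And>t. t \<in> {0..c} \<Longrightarrow> \<bar>x t\<bar> \<le> b"
proof -
  have lim_bd: "\<exists>b. \<forall>\<^sub>F s in F. \<bar>x s\<bar> \<le> b" if "(x \<longlongrightarrow> k) F" for k F
  proof -
    have "\<forall>\<^sub>F s in F. dist (x s) k < 1" using that by (rule tendstoD) simp
    then have "\<forall>\<^sub>F s in F. \<bar>x s\<bar> \<le> \<bar>k\<bar> + 1"
      by (rule eventually_mono) (auto simp: dist_real_def)
    then show ?thesis by blast
  qed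
  have loc: "\<exists>U b. open U \<and> t \<in> U \<and> (\<forall>s\<in>U \<inter> {0..c}. \<bar>x s\<bar> \<le> b)" if t: "t \<in> {0..c}" for t
  proof -
    have "\<exists>b. \<forall>\<^sub>F s in at_right t. s \<in> {0..c} \<longrightarrow> \<bar>x s\<bar> \<le> b"
    proof (cases "t < c")
      case True
      then have "(x \<longlongrightarrow> x t) (at_right t)" using x t by (auto simp: cadlag_space_def)
      from lim_bd[OF this] show ?thesis by (auto elim: eventually_mono)
    next
      case False
      then have "\<forall>\<^sub>F s in at_right t. s \<notin> {0..c}"
        by (auto simp: eventually_at_filter)
      then show ?thesis by (auto elim: eventually_mono)
    qed
    then obtain b1 where b1: "\<forall>\<^sub>F s in at_right t. s \<in> {0..c} \<longrightarrow> \<bar>x s\<bar> \<le> b1" by blast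
    have "\<exists>b. \<forall>\<^sub>F s in at_left t. s \<in> {0..c} \<longrightarrow> \<bar>x s\<bar> \<le> b"
    proof (cases "0 < t")
      case True
      then obtain k where "(x \<longlongrightarrow> k) (at_left t)"
        using x t by (auto simp: cadlag_space_def Ball_def)
      from lim_bd[OF this] show ?thesis by (auto elim: eventually_mono)
    next
      case False
      then have "\<forall>\<^sub>F s in at_left t. s \<notin> {0..c}"
        by (auto simp: eventually_at_filter)
      then show ?thesis by (auto elim: eventually_mono)
    qed
    then obtain b2 where b2: "\<forall>\<^sub>F s in at_left t. s \<in> {0..c} \<longrightarrow> \<bar>x s\<bar> \<le> b2" by blast
    let ?b = "max \<bar>x t\<bar> (max b1 b2)"
    have "\<forall>\<^sub>F s in at t. s \<in> {0..c} \<longrightarrow> \<bar>x s\<bar> \<le> ?b"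
      unfolding eventually_at_split using b1 b2 by (auto elim!: eventually_mono)
    then have "\<forall>\<^sub>F s in nhds t. s \<in> {0..c} \<longrightarrow> \<bar>x s\<bar> \<le> ?b"
      by (auto simp: eventually_at_filter elim!: eventually_mono)
    then obtain U where "open U" "t \<in> U" "\<forall>s\<in>U. s \<in> {0..c} \<longrightarrow> \<bar>x s\<bar> \<le> ?b"
      unfolding eventually_nhds by blast
    then show ?thesis by blast
  qed
  then obtain U b where U: "\<And>t. t \<in> {0..c} \<Longrightarrow> open (U t) \<and> t \<in> U t"
      and b: "\<And>t s. t \<in> {0..c} \<Longrightarrow> s \<in> U t \<Longrightarrow> s \<in> {0..c} \<Longrightarrow> \<bar>x s\<bar> \<le> b t"
    by (metis IntI)
  obtain S where S: "S \<subseteq> {0..c}" "finite S" "{0..c} \<subseteq> (\<Union>t\<in>S. U t)"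
    by (rule compactE_image[of "{0..c}" "{0..c}" U]) (use U in auto)
  show ?thesis
  proof
    show "0 \<le> (\<Sum>t\<in>S. \<bar>b t\<bar>)" by (simp add: sum_nonneg)
    fix s assume s: "s \<in> {0..c}"
    then obtain t where t: "t \<in> S" "s \<in> U t" using S by auto
    have "\<bar>x s\<bar> \<le> \<bar>b t\<bar>" using b[of t s] t s S by force
    also have "\<dots> \<le> (\<Sum>t\<in>S. \<bar>b t\<bar>)" using S t by (intro member_le_sum) auto
    finally show "\<bar>x s\<bar> \<le> (\<Sum>t\<in>S. \<bar>b t\<bar>)" .
  qed
qed

lemma J1_bounds_nonempty:
  assumes "x \<in> cadlag_space c" "y \<in> cadlag_space c"
  shows "J1_bounds c x y \<noteq> {}"
proof -
  obtain a where a: "0 \<le> a" "\<And>t. t \<in> {0..c} \<Longrightarrow> \<bar>x t\<bar> \<le> a"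
    using cadlag_bounded[OF assms(1)] by blast
  obtain b where b: "0 \<le> b" "\<And>t. t \<in> {0..c} \<Longrightarrow> \<bar>y t\<bar> \<le> b"
    using cadlag_bounded[OF assms(2)] by blast
  have "\<bar>x t - y t\<bar> \<le> a + b" if "t \<in> {0..c}" for t
    using a(2)[OF that] b(2)[OF that] by linarith
  then have "a + b \<in> J1_bounds c x y"
    by (intro J1_boundsI[OF _ time_changes_id]) (use a(1) b(1) in auto)
  then show ?thesis by blast
qed

lemma bdd_below_J1_bounds: "bdd_below (J1_bounds c x y)"
  by (rule bdd_belowI[of _ 0]) (auto simp: J1_bounds_def)

lemma J1_dist_less:
  assumes "x \<in> cadlag_space c" "y \<in> cadlag_space c" "J1_dist c x y < e"
  obtains r where "r \<in> J1_bounds c x y" "r < e"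
  using assms cInf_lessD[OF J1_bounds_nonempty[OF assms(1,2)], of e] unfolding J1_dist_def by auto

lemma J1_dist_zero_imp_eq:
  assumes x: "x \<in> cadlag_space c" and y: "y \<in> cadlag_space c" and d: "J1_dist c x y = 0"
  shows "x = y"
proof (rule extensionalityI[of _ "{0..c}"])
  show "x \<in> extensional {0..c}" "y \<in> extensional {0..c}"
    using x y by (auto simp: cadlag_space_def)
  have ex: "\<exists>l\<in>time_changes c. \<forall>t\<in>{0..c}. \<bar>l t - t\<bar> < e \<and> \<bar>x t - y (l t)\<bar> < e" if e: "e > 0" for e
  proof -
    obtain r where "r \<in> J1_bounds c x y" "r < e"
      by (rule J1_dist_less[OF x y, of e]) (use d e in auto)
    then obtain l where "l \<in> time_changes c" "\<forall>t\<in>{0..c}. \<bar>l t - t\<bar> \<le> r \<and> \<bar>x t - y (l t)\<bar> \<le> r"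
      unfolding J1_bounds_def by blast
    with \<open>r < e\<close> show ?thesis by (intro bexI[of _ l]) fastforce+
  qed
  fix t assume t: "t \<in> {0..c}"
  have "\<bar>x t - y t\<bar> < e" if e: "e > 0" for e
  proof (cases "t < c")
    case False
    with t have tc: "t = c" by auto
    obtain l where l: "l \<in> time_changes c" and lb: "\<bar>x t - y (l t)\<bar> < e"
      using ex[OF e] t by blast
    have "l c = c"
    proof -
      have im: "l ` {0..c} = {0..c}" and sm: "strict_mono_on {0..c} l"
        using l by (auto simp: time_changes_def)
      have "c \<in> l ` {0..c}" using im t tc by auto
      then obtain s where s: "s \<in> {0..c}" "l s = c" by auto
      have "l s \<le> l c" using s t tc by (intro strict_mono_on_leD[OF sm]) auto
      moreover have "l c \<in> {0..c}" using im t tc by blast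
      ultimately show ?thesis using s by auto
    qed
    with lb tc show ?thesis by simp
  next
    case True
    have "(x \<longlongrightarrow> x t) (at_right t)" "(y \<longlongrightarrow> y t) (at_right t)"
      using x y t True by (auto simp: cadlag_space_def)
    then have "\<forall>\<^sub>F s in at_right t. dist (x s) (x t) < e/3 \<and> dist (y s) (y t) < e/3"
      using e by (intro eventually_conj tendstoD) auto
    then obtain u where u: "t < u"
        "\<And>s. t < s \<Longrightarrow> s < u \<Longrightarrow> dist (x s) (x t) < e/3 \<and> dist (y s) (y t) < e/3"
      using eventually_at_right_field[of _ t] by auto
    define v where "v = min u c"
    define s where "s = (t + v) / 2"
    have s: "t < s" "s < v" using u True by (auto simp: s_def v_def)
    define d where "d = min (e/3) (min (s - t) (v - s))"
    have "0 < d" "s \<in> {0..c}" using e s t by (auto simp: d_def v_def)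
    then obtain l where lb: "\<bar>l s - s\<bar> < d" "\<bar>x s - y (l s)\<bar> < d" using ex by blast
    have d: "d \<le> e/3" "d \<le> s - t" "d \<le> v - s" unfolding d_def by linarith+
    have "t < l s" "l s < u" using lb d by (auto simp: v_def)
    then have "\<bar>y (l s) - y t\<bar> < e/3" using u by (auto simp: dist_real_def)
    moreover have "\<bar>x s - x t\<bar> < e/3" using u s by (auto simp: dist_real_def v_def)
    ultimately show ?thesis using lb d by linarith
  qed
  from this[of "\<bar>x t - y t\<bar>"] show "x t = y t" by fastforce
qed

lemma Metric_space_J1: "Metric_space (cadlag_space c) (J1_dist c)"
proof
  show nonneg: "0 \<le> J1_dist c x y" for x y
    unfolding J1_dist_def
    using J1_bounds_nonempty[of x c y] by (auto intro!: cInf_greatest) (auto simp: J1_bounds_def)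
  show "J1_dist c x y = J1_dist c y x" for x y
    using J1_bounds_sym[of c x y] J1_bounds_sym[of c y x] by (auto simp: J1_dist_def)
  show "J1_dist c x y = 0 \<longleftrightarrow> x = y" if xy: "x \<in> cadlag_space c" "y \<in> cadlag_space c" for x y
  proof
    assume "x = y"
    then have "0 \<in> J1_bounds c x y"
      by (intro J1_boundsI[OF _ time_changes_id]) auto
    then have "J1_dist c x y \<le> 0"
      using xy cInf_lower[OF _ bdd_below_J1_bounds] by (auto simp: J1_dist_def)
    with nonneg show "J1_dist c x y = 0" by (metis order_antisym)
  qed (rule J1_dist_zero_imp_eq[OF xy])
  show "J1_dist c x z \<le> J1_dist c x y + J1_dist c y z"
    if m: "x \<in> cadlag_space c" "y \<in> cadlag_space c" "z \<in> cadlag_space c" for x y z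
  proof (rule field_le_epsilon)
    fix e :: real assume e: "0 < e"
    obtain r where r: "r \<in> J1_bounds c x y" "r < J1_dist c x y + e / 2"
      using J1_dist_less[OF m(1,2), of "J1_dist c x y + e / 2"] e by (metis half_gt_zero less_add_same_cancel1)
    obtain s where s: "s \<in> J1_bounds c y z" "s < J1_dist c y z + e / 2"
      using J1_dist_less[OF m(2,3), of "J1_dist c y z + e / 2"] e by (metis half_gt_zero less_add_same_cancel1)
    have "J1_dist c x z \<le> r + s"
      using m cInf_lower[OF J1_bounds_triangle[OF r(1) s(1)] bdd_below_J1_bounds]
      by (simp add: J1_dist_def)
    then show "J1_dist c x z \<le> J1_dist c x y + J1_dist c y z + e" using r s by simp
  qed
qed

definition borel_of :: "'x topology \<Rightarrow> 'x measure" where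
  "borel_of T = sigma (topspace T) {U. openin T U}"

text \<open>The random elements may live on different probability spaces.  Measurability is only
  required for large \<open>n\<close>, like the convergence itself.\<close>

definition converges_in_distribution ::
    "'x topology \<Rightarrow> (nat \<Rightarrow> 'w measure) \<Rightarrow> (nat \<Rightarrow> 'w \<Rightarrow> 'x) \<Rightarrow> 'v measure \<Rightarrow> ('v \<Rightarrow> 'x) \<Rightarrow> bool"
  where
  "converges_in_distribution T M X N Y \<longleftrightarrow>
     (\<forall>\<^sub>F n in sequentially. X n \<in> measurable (M n) (borel_of T)) \<and>
     Y \<in> measurable N (borel_of T) \<and>
     (\<forall>f. continuous_map T euclideanreal f \<and> bounded (f ` topspace T) \<longrightarrow>
        (\<lambda>n. \<integral>\<omega>. f (X n \<omega>) \<partial>M n) \<longlonglongrightarrow> (\<integral>\<omega>. f (Y \<omega>) \<partial>N))"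

text \<open>A deterministic limit \<open>y\<close> is a random element on the one-point probability space.\<close>

definition converges_in_distribution_const ::
    "'x topology \<Rightarrow> (nat \<Rightarrow> 'w measure) \<Rightarrow> (nat \<Rightarrow> 'w \<Rightarrow> 'x) \<Rightarrow> 'x \<Rightarrow> bool" where
  "converges_in_distribution_const T M X y \<longleftrightarrow>
     converges_in_distribution T M X (return (count_space UNIV) ()) (\<lambda>_. y)"

end

theory Submission
  imports Defs
begin

text \<open>The number of components is the number of vertices, minus the number of edges, plus the cycle
  rank.  The cycle rank is at most the number of edges that lie on a cycle, which increases in time;
  its mean at a time \<open>t\<close> with \<open>s = \<sigma>\<^sup>2 t < 1\<close> is at most \<open>s\<^sup>2 / (1 - s)\<close>, because two vertices are connected
  with probability at most \<open>z i * z j * t / (1 - s)\<close>.  Hence cycles are negligible and only the number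
  of edges matters, a sum of independent indicator processes.  Its finite-dimensional limits follow
  from characteristic functions, and its oscillations are controlled by fourth moments and dyadic
  chaining.  As the limit is continuous and the Skorokhod distance is at most the uniform distance, it
  suffices to compare the paths in supremum norm and to test weak convergence on bounded Lipschitz
  functions.\<close>

section \<open>Weak convergence tested on Lipschitz functions\<close>

text \<open>For \<open>c < 1\<close> the expected cycle count stays below a constant independent of
  n. Divided by \<open>sqrt (\<kappa>' n)\<close> it disappears, so one comparison with the edge
  count serves both claims. The same holds for the mean edge count: it differs from
  \<open>t * (\<sigma>1 n)\<^sup>2 / (2 * \<sigma>' n)\<close> by a bounded number of edges. Two
  obstacles shape the rest. On short intervals the edge count is Poissonian and its fourth moment is
  only of first order in the length, so chaining cannot descend to arbitrarily small cells. It stops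
  at cells with boundedly many edges on average, where monotonicity of the count takes over.
  Moreover, the random paths must be Borel for the Skorokhod topology. Values at finitely many grid
  times are easily measurable, but the discretised path jumps later than the original and stays away
  from it in supremum norm. Only there are non-trivial time changes needed, to align the
  jumps.\<close>

lemma space_borel_of [simp]: "space (borel_of T) = topspace T"
  by (simp add: borel_of_def space_measure_of_conv)

lemma sets_borel_of_openin: "openin T U \<Longrightarrow> U \<in> sets (borel_of T)"
  unfolding borel_of_def by (subst sets_measure_of) (auto dest: openin_subset)

lemma measurable_borel_ofI:
  assumes "\<And>\<omega>. \<omega> \<in> space N \<Longrightarrow> X \<omega> \<in> topspace T"
    and "\<And>U. openin T U \<Longrightarrow> X -` U \<inter> space N \<in> sets N"
  shows "X \<in> measurable N (borel_of T)"
  unfolding borel_of_def by (rule measurable_measure_of) (use assms in \<open>auto dest: openin_subset\<close>)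

lemma continuous_map_borel_measurable:
  assumes "continuous_map T euclideanreal f"
  shows "f \<in> borel_measurable (borel_of T)"
proof (rule borel_measurableI)
  fix S :: "real set" assume "open S"
  then have "openin T {x \<in> topspace T. f x \<in> S}"
    using assms by (simp add: continuous_map_def)
  moreover have "f -` S \<inter> space (borel_of T) = {x \<in> topspace T. f x \<in> S}" by auto
  ultimately show "f -` S \<inter> space (borel_of T) \<in> sets (borel_of T)"
    by (simp add: sets_borel_of_openin)
qed

section \<open>Borel maps and test functions on a general metric space\<close>

context Metric_space
begin

text \<open>Y lies in an open U exactly if, for some k, the values X m eventually avoid the
  neighbourhood \<open>D k\<close> of radius 1 / Suc k around the complement of U. This writes the
  preimage of U through countably many preimages of open sets.\<close>

lemma measurable_borel_of_limit:
  assumes meas: "\<And>m. X m \<in> measurable N (borel_of mtopology)"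
    and lim: "\<And>\<omega>. \<omega> \<in> space N \<Longrightarrow> (\<lambda>m. d (X m \<omega>) (Y \<omega>)) \<longlonglongrightarrow> 0"
    and Y: "\<And>\<omega>. \<omega> \<in> space N \<Longrightarrow> Y \<omega> \<in> M"
  shows "Y \<in> measurable N (borel_of mtopology)"
proof (rule measurable_borel_ofI)
  fix U assume U: "openin mtopology U"
  define D where "D k = (\<Union>y\<in>M - U. mball y (1 / real (Suc k)))" for k
  have D: "openin mtopology (D k)" for k unfolding D_def by (auto intro: openin_Union)
  have XM: "X m \<omega> \<in> M" if "\<omega> \<in> space N" for m \<omega>
    using measurable_space[OF meas that] by simp
  have "Y -` U \<inter> space N =
      (\<Union>k. \<Union>m0. \<Inter>m\<in>{m0..}. (space N - (X m -` D k \<inter> space N)))"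
  proof (intro equalityI subsetI)
    fix \<omega> assume \<omega>: "\<omega> \<in> Y -` U \<inter> space N"
    then obtain r where r: "r > 0" "mball (Y \<omega>) r \<subseteq> U" using U by (auto simp: openin_mtopology)
    obtain k where k: "1 / real (Suc k) < r / 2" using nat_approx_posE[of "r/2"] r by auto
    have "\<forall>\<^sub>F m in sequentially. d (X m \<omega>) (Y \<omega>) < r / 2"
      using order_tendstoD(2)[OF lim, of \<omega> "r / 2"] \<omega> r by simp
    then obtain m0 where m0: "\<And>m. m \<ge> m0 \<Longrightarrow> d (X m \<omega>) (Y \<omega>) < r / 2"
      by (auto simp: eventually_sequentially)
    have "X m \<omega> \<notin> D k" if m: "m \<ge> m0" for m
    proof
      assume "X m \<omega> \<in> D k"
      then obtain y where y: "y \<in> M" "y \<notin> U" "d y (X m \<omega>) < 1 / real (Suc k)"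
        by (auto simp: D_def)
      have "d (Y \<omega>) y \<le> d (Y \<omega>) (X m \<omega>) + d (X m \<omega>) y"
        using triangle[of "Y \<omega>" "X m \<omega>" y] Y XM y \<omega> by auto
      also have "\<dots> < r" using m0[OF m] y k by (simp add: commute)
      finally have "y \<in> U" using r y Y \<omega> by auto
      then show False using y by simp
    qed
    then show "\<omega> \<in> (\<Union>k. \<Union>m0. \<Inter>m\<in>{m0..}. (space N - (X m -` D k \<inter> space N)))"
      using \<omega> by auto
  next
    fix \<omega> assume "\<omega> \<in> (\<Union>k. \<Union>m0. \<Inter>m\<in>{m0..}. (space N - (X m -` D k \<inter> space N)))"
    then obtain k m0 where *: "\<And>m. m \<ge> m0 \<Longrightarrow> \<omega> \<in> space N \<and> X m \<omega> \<notin> D k" by auto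
    then have \<omega>: "\<omega> \<in> space N" by blast
    have "\<forall>\<^sub>F m in sequentially. d (X m \<omega>) (Y \<omega>) < 1 / real (Suc k)"
      using order_tendstoD(2)[OF lim[OF \<omega>]] by simp
    then obtain m1 where m1: "\<And>m. m \<ge> m1 \<Longrightarrow> d (X m \<omega>) (Y \<omega>) < 1 / real (Suc k)"
      by (auto simp: eventually_sequentially)
    have "Y \<omega> \<in> U"
    proof (rule ccontr)
      assume "Y \<omega> \<notin> U"
      then have "X (max m0 m1) \<omega> \<in> D k"
        using m1[of "max m0 m1"] Y[OF \<omega>] XM[OF \<omega>] by (auto simp: D_def commute)
      then show False using *[of "max m0 m1"] by simp
    qed
    then show "\<omega> \<in> Y -` U \<inter> space N" using \<omega> by simp
  qed
  also have "\<dots> \<in> sets N"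
  proof -
    have "space N - (X m -` D k \<inter> space N) \<in> sets N" for m k
      using measurable_sets[OF meas sets_borel_of_openin[OF D]] by simp
    then have "(\<Inter>m\<in>{m0..}. space N - (X m -` D k \<inter> space N)) \<in> sets N" for m0 k
      by (intro sets.countable_INT) (blast, blast)
    then show ?thesis by blast
  qed
  finally show "Y -` U \<inter> space N \<in> sets N" .
qed (use Y in auto)

lemma lipschitz_continuous_map:
  assumes f: "\<And>x y. x \<in> M \<Longrightarrow> y \<in> M \<Longrightarrow> \<bar>f x - f y\<bar> \<le> L * d x y"
  shows "continuous_map mtopology euclideanreal f"
  unfolding continuous_map_def
proof (intro conjI allI impI)
  fix S :: "real set" assume "openin euclideanreal S"
  then have S: "open S" by simp
  show "openin mtopology {x \<in> topspace mtopology. f x \<in> S}"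
    unfolding openin_mtopology
  proof (intro conjI allI impI)
    fix x assume x: "x \<in> {x \<in> topspace mtopology. f x \<in> S}"
    then obtain e where e: "e > 0" "ball (f x) e \<subseteq> S" using S by (auto simp: open_contains_ball)
    \<comment> \<open>The summand 1 keeps the radius finite and positive when L = 0; the absolute
      value covers negative L.\<close>
    let ?r = "e / (\<bar>L\<bar> + 1)"
    have "f y \<in> S" if y: "y \<in> mball x ?r" for y
    proof -
      have "\<bar>f x - f y\<bar> \<le> L * d x y" using f y by auto
      also have "\<dots> \<le> (\<bar>L\<bar> + 1) * d x y" by (intro mult_right_mono) auto
      also have "\<dots> < e" using y by (auto simp: field_simps)
      finally show ?thesis using e by (auto simp: dist_real_def)
    qed
    then show "\<exists>r>0. mball x r \<subseteq> {x \<in> topspace mtopology. f x \<in> S}"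
      using e by (intro exI[of _ ?r]) auto
  qed auto
qed auto

text \<open>The infima \<open>g k\<close> are \<open>k\<close>-Lipschitz, lie below \<open>f\<close> and converge to \<open>f\<close> pointwise.\<close>

lemma weak_limit_lower_bound:
  assumes P: "\<And>n. prob_space (P n)" and Q: "prob_space Q"
    and X: "\<forall>\<^sub>F n in sequentially. X n \<in> measurable (P n) (borel_of mtopology)"
    and Y: "Y \<in> measurable Q (borel_of mtopology)"
    and lip: "\<And>f L C. \<forall>x\<in>M. \<bar>f x\<bar> \<le> C \<Longrightarrow>
       \<forall>x\<in>M. \<forall>y\<in>M. \<bar>f x - f y\<bar> \<le> L * d x y \<Longrightarrow> 0 \<le> L \<Longrightarrow>
       (\<lambda>n. \<integral>\<omega>. f (X n \<omega>) \<partial>P n) \<longlonglongrightarrow> (\<integral>\<omega>. f (Y \<omega>) \<partial>Q)"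
    and f: "continuous_map mtopology euclideanreal f"
    and C: "\<And>x. x \<in> M \<Longrightarrow> \<bar>f x\<bar> \<le> C"
    and e: "0 < e"
  shows "\<forall>\<^sub>F n in sequentially. (\<integral>\<omega>. f (Y \<omega>) \<partial>Q) - e < (\<integral>\<omega>. f (X n \<omega>) \<partial>P n)"
proof -
  interpret Q: prob_space Q by (rule Q)
  define g where "g k x = (INF y\<in>M. f y + real k * d x y)" for k x
  have bdd: "bdd_below ((\<lambda>y. f y + real k * d x y) ` M)" for k x
  proof (rule bdd_belowI2)
    fix y assume "y \<in> M" then show "- C \<le> f y + real k * d x y"
      using C[of y] nonneg[of x y] mult_nonneg_nonneg[of "real k" "d x y"] by linarith
  qed
  have g_le: "g k x \<le> f y + real k * d x y" if "y \<in> M" for k x y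
    unfolding g_def by (rule cINF_lower[OF bdd that])
  have g_le_f: "g k x \<le> f x" if "x \<in> M" for k x using g_le[OF that, of k x] that by simp
  have g_ge: "- C \<le> g k x" if "x \<in> M" for k x
    unfolding g_def
  proof (rule cINF_greatest)
    fix y assume "y \<in> M" then show "- C \<le> f y + real k * d x y"
      using C[of y] nonneg[of x y] mult_nonneg_nonneg[of "real k" "d x y"] by linarith
  qed (use that in auto)
  have g_bd: "\<bar>g k x\<bar> \<le> C" if "x \<in> M" for k x
    using g_le_f[OF that] g_ge[OF that] C[OF that] by (smt (verit))
  have g_lip1: "g k x - g k y \<le> real k * d x y" if "x \<in> M" "y \<in> M" for k x y
  proof -
    have "g k x - real k * d x y \<le> g k y"
      unfolding g_def[of k y]
    proof (rule cINF_greatest)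
      fix w assume w: "w \<in> M"
      have "g k x \<le> f w + real k * d x w" by (rule g_le[OF w])
      also have "\<dots> \<le> f w + real k * (d x y + d y w)"
        using triangle[OF that w] by (intro add_left_mono mult_left_mono) auto
      finally show "g k x - real k * d x y \<le> f w + real k * d y w" by (simp add: algebra_simps)
    qed (use that in auto)
    then show ?thesis by simp
  qed
  have g_lip: "\<bar>g k x - g k y\<bar> \<le> real k * d x y" if "x \<in> M" "y \<in> M" for k x y
    using g_lip1[OF that] g_lip1[OF that(2,1)] by (simp add: commute abs_le_iff)
  have g_lim: "(\<lambda>k. g k x) \<longlonglongrightarrow> f x" if x: "x \<in> M" for x
  proof (rule LIMSEQ_I)
    fix r :: real assume r: "0 < r"
    have "openin mtopology {y \<in> topspace mtopology. f y \<in> {f x - r / 2 <..}}"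
      by (rule openin_continuous_map_preimage[OF f]) simp
    moreover have "x \<in> {y \<in> topspace mtopology. f y \<in> {f x - r / 2 <..}}" using x r by simp
    ultimately obtain s where s: "s > 0" "mball x s \<subseteq> {y \<in> topspace mtopology. f y \<in> {f x - r / 2 <..}}"
      unfolding openin_mtopology by blast
    \<comment> \<open>Beyond distance s the penalty exceeds 2 * C, the largest possible difference
      of two values of f, so only points near x matter for the infimum.\<close>
    obtain k0 :: nat where k0: "2 * C / s < real k0" using reals_Archimedean2 by blast
    have "f x - r / 2 \<le> g k x" if k: "k \<ge> k0" for k
      unfolding g_def
    proof (rule cINF_greatest)
      fix y assume y: "y \<in> M"
      show "f x - r / 2 \<le> f y + real k * d x y"
      proof (cases "d x y < s")
        case True
        then have "f y > f x - r / 2" using s x y by auto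
        then show ?thesis using nonneg[of x y] mult_nonneg_nonneg[of "real k" "d x y"] by linarith
      next
        case False
        have "2 * C / s \<le> real k" using k k0 by linarith
        then have "2 * C \<le> real k * s" using s by (simp add: field_simps)
        also have "\<dots> \<le> real k * d x y" using False by (intro mult_left_mono) auto
        finally show ?thesis using C[OF x] C[OF y] r by linarith
      qed
    qed (use x in auto)
    then have "norm (g k x - f x) < r" if "k \<ge> k0" for k
      using that[THEN \<open>\<And>k. k0 \<le> k \<Longrightarrow> f x - r / 2 \<le> g k x\<close>] g_le_f[OF x, of k] r
      unfolding real_norm_def by linarith
    then show "\<exists>no. \<forall>n\<ge>no. norm (g n x - f x) < r" by blast
  qed
  have fm [measurable]: "f \<in> borel_measurable (borel_of mtopology)"
    by (rule continuous_map_borel_measurable[OF f])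
  have gm [measurable]: "g k \<in> borel_measurable (borel_of mtopology)" for k
    by (rule continuous_map_borel_measurable[OF lipschitz_continuous_map[OF g_lip]])
  note Y [measurable]
  have YM: "Y \<omega> \<in> M" if "\<omega> \<in> space Q" for \<omega> using measurable_space[OF Y that] by simp
  have "(\<lambda>k. \<integral>\<omega>. g k (Y \<omega>) \<partial>Q) \<longlonglongrightarrow> (\<integral>\<omega>. f (Y \<omega>) \<partial>Q)"
    by (rule integral_dominated_convergence[where w = "\<lambda>_. C"])
       (use YM g_lim g_bd in \<open>auto intro!: AE_I2\<close>)
  then have "\<forall>\<^sub>F k in sequentially. (\<integral>\<omega>. f (Y \<omega>) \<partial>Q) - e < (\<integral>\<omega>. g k (Y \<omega>) \<partial>Q)"
    using e by (intro order_tendstoD(1)) auto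
  then obtain k where k: "(\<integral>\<omega>. f (Y \<omega>) \<partial>Q) - e < (\<integral>\<omega>. g k (Y \<omega>) \<partial>Q)"
    by (auto simp: eventually_sequentially)
  have "(\<lambda>n. \<integral>\<omega>. g k (X n \<omega>) \<partial>P n) \<longlonglongrightarrow> (\<integral>\<omega>. g k (Y \<omega>) \<partial>Q)"
    by (rule lip[of _ C "real k"]) (auto simp: g_bd g_lip)
  then have "\<forall>\<^sub>F n in sequentially. (\<integral>\<omega>. f (Y \<omega>) \<partial>Q) - e < (\<integral>\<omega>. g k (X n \<omega>) \<partial>P n)"
    using k by (rule order_tendstoD(1))
  with X show ?thesis
  proof eventually_elim
    case (elim n)
    interpret P: prob_space "P n" by (rule P)
    note elim(1) [measurable]
    have XM: "X n \<omega> \<in> M" if "\<omega> \<in> space (P n)" for \<omega> using measurable_space[OF elim(1) that] by simp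
    have "(\<integral>\<omega>. g k (X n \<omega>) \<partial>P n) \<le> (\<integral>\<omega>. f (X n \<omega>) \<partial>P n)"
    proof (rule integral_mono)
      show "integrable (P n) (\<lambda>\<omega>. g k (X n \<omega>))"
        by (rule P.integrable_const_bound[where B = C]) (use XM g_bd in \<open>auto intro!: AE_I2\<close>)
      show "integrable (P n) (\<lambda>\<omega>. f (X n \<omega>))"
        by (rule P.integrable_const_bound[where B = C]) (use XM C in \<open>auto intro!: AE_I2\<close>)
    qed (use XM g_le_f in auto)
    then show ?case using elim(2) by simp
  qed
qed

text \<open>The one-sided bound of \<open>weak_limit_lower_bound\<close>, applied to f and to -f,
  gives both inequalities. Lipschitz test functions are wanted because they can be fed with
  estimates of the distance between two random elements.\<close>

lemma weak_convergence_lipschitz: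
  assumes P: "\<And>n. prob_space (P n)" and Q: "prob_space Q"
    and X: "\<forall>\<^sub>F n in sequentially. X n \<in> measurable (P n) (borel_of mtopology)"
    and Y: "Y \<in> measurable Q (borel_of mtopology)"
    and lip: "\<And>f L C. \<forall>x\<in>M. \<bar>f x\<bar> \<le> C \<Longrightarrow>
       \<forall>x\<in>M. \<forall>y\<in>M. \<bar>f x - f y\<bar> \<le> L * d x y \<Longrightarrow> 0 \<le> L \<Longrightarrow>
       (\<lambda>n. \<integral>\<omega>. f (X n \<omega>) \<partial>P n) \<longlonglongrightarrow> (\<integral>\<omega>. f (Y \<omega>) \<partial>Q)"
  shows "converges_in_distribution mtopology P X Q Y"
  unfolding converges_in_distribution_def
proof (intro conjI allI impI X Y)
  fix f assume "continuous_map mtopology euclideanreal f \<and> bounded (f ` topspace mtopology)"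
  then obtain C where f: "continuous_map mtopology euclideanreal f"
    and C: "\<And>x. x \<in> M \<Longrightarrow> \<bar>f x\<bar> \<le> C"
    by (auto simp: bounded_iff)
  have mf: "continuous_map mtopology euclideanreal (\<lambda>x. - f x)"
    using f by (intro continuous_map_minus) auto
  have mC: "\<bar>- f x\<bar> \<le> C" if "x \<in> M" for x using C[OF that] by simp
  note lower = weak_limit_lower_bound[OF P Q X Y lip, where C = C]
  show "(\<lambda>n. \<integral>\<omega>. f (X n \<omega>) \<partial>P n) \<longlonglongrightarrow> (\<integral>\<omega>. f (Y \<omega>) \<partial>Q)"
  proof (rule order_tendstoI)
    fix a assume a: "a < (\<integral>\<omega>. f (Y \<omega>) \<partial>Q)"
    then have "0 < (\<integral>\<omega>. f (Y \<omega>) \<partial>Q) - a" by simp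
    from lower[OF _ _ _ f C this] show "\<forall>\<^sub>F n in sequentially. a < (\<integral>\<omega>. f (X n \<omega>) \<partial>P n)"
      by simp
  next
    fix a assume "(\<integral>\<omega>. f (Y \<omega>) \<partial>Q) < a"
    then have "0 < a - (\<integral>\<omega>. f (Y \<omega>) \<partial>Q)" by simp
    from lower[OF _ _ _ mf mC this] show "\<forall>\<^sub>F n in sequentially. (\<integral>\<omega>. f (X n \<omega>) \<partial>P n) < a"
      by simp
  qed
qed

end

section \<open>Paths with finitely many jumps in the Skorokhod topology\<close>

lemma topspace_J1 [simp]: "topspace (J1_topology c) = cadlag_space c"
  by (simp add: J1_topology_def Metric_space.topspace_mtopology[OF Metric_space_J1])

lemma J1_dist_le:
  assumes "x \<in> cadlag_space c" "y \<in> cadlag_space c" "r \<in> J1_bounds c x y"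
  shows "J1_dist c x y \<le> r"
  using assms cInf_lower[OF _ bdd_below_J1_bounds] by (simp add: J1_dist_def)

lemma J1_dist_le_sup:
  assumes "x \<in> cadlag_space c" "y \<in> cadlag_space c" "0 \<le> r"
    and "\<And>t. t \<in> {0..c} \<Longrightarrow> \<bar>x t - y t\<bar> \<le> r"
  shows "J1_dist c x y \<le> r"
  using assms by (intro J1_dist_le J1_boundsI[OF _ time_changes_id]) auto

text \<open>The value at u is a function of the set of points of F passed up to and including u.
  Counting equality as passed builds in right-continuity, and finiteness of F builds in left limits,
  without naming the values on the pieces.\<close>

definition step_on :: "real \<Rightarrow> real set \<Rightarrow> (real \<Rightarrow> real) \<Rightarrow> bool" where
  "step_on c F s \<longleftrightarrow> finite F \<and>
     (\<forall>u\<in>{0..c}. \<forall>v\<in>{0..c}. (\<forall>q\<in>F. q \<le> u \<longleftrightarrow> q \<le> v) \<longrightarrow> s u = s v)"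

lemma step_onD:
  assumes "step_on c F s" "u \<in> {0..c}" "v \<in> {0..c}" "\<And>q. q \<in> F \<Longrightarrow> q \<le> u \<longleftrightarrow> q \<le> v"
  shows "s u = s v"
  using assms unfolding step_on_def by blast

lemma tendsto_eventually_cong:
  assumes "(x \<longlongrightarrow> l) F" "\<forall>\<^sub>F u in F. x u = y u"
  shows "(y \<longlongrightarrow> l) F"
  using assms by (metis tendsto_cong)

text \<open>Just after t the passed points are those of t itself. Just before t they are the points
  strictly below t, so the left limit of the step part is its value at any v close enough to t from
  the left.\<close>

lemma cadlag_continuous_plus_step:
  assumes y: "continuous_on {0..c} y" and s: "step_on c F s"
  shows "(\<lambda>t\<in>{0..c}. y t + s t) \<in> cadlag_space c"
  unfolding cadlag_space_def
proof (intro CollectI conjI ballI)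
  have fin: "finite F" using s by (simp add: step_on_def)
  fix t assume t: "t \<in> {0..<c}"
  have "(y \<longlongrightarrow> y t) (at t within {t..c})"
    using y t by (meson atLeastAtMost_iff atLeastLessThan_iff continuous_on_def less_imp_le
        atLeastatMost_subset_iff order_refl tendsto_within_subset)
  then have yl: "(y \<longlongrightarrow> y t) (at_right t)"
    using t by (simp add: at_within_Icc_at_right)
  have "\<forall>\<^sub>F u in at_right t. \<forall>q\<in>F. q \<le> u \<longleftrightarrow> q \<le> t"
  proof (intro eventually_ball_finite fin ballI)
    fix q assume "q \<in> F"
    show "\<forall>\<^sub>F u in at_right t. q \<le> u \<longleftrightarrow> q \<le> t"
    proof (cases "q \<le> t")
      case True then show ?thesis by (auto simp: eventually_at_filter)
    next
      case False
      then have "\<forall>\<^sub>F u in at_right t. u < q"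
        unfolding eventually_at_right_field by (intro exI[of _ q]) auto
      then show ?thesis using False by (auto elim: eventually_mono)
    qed
  qed
  moreover have "\<forall>\<^sub>F u in at_right t. t < u \<and> u < c"
    unfolding eventually_at_right_field using t by (intro exI[of _ c]) auto
  ultimately have "\<forall>\<^sub>F u in at_right t. y u + s t = (\<lambda>t\<in>{0..c}. y t + s t) u"
  proof eventually_elim
    case (elim u)
    then have "s u = s t" using t by (intro step_onD[OF s]) auto
    then show ?case using elim t by auto
  qed
  moreover have "((\<lambda>u. y u + s t) \<longlongrightarrow> y t + s t) (at_right t)"
    by (intro tendsto_intros yl)
  ultimately have "((\<lambda>t\<in>{0..c}. y t + s t) \<longlongrightarrow> y t + s t) (at_right t)"
    using tendsto_eventually_cong by blast
  then show "((\<lambda>t\<in>{0..c}. y t + s t) \<longlongrightarrow> (\<lambda>t\<in>{0..c}. y t + s t) t) (at_right t)"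
    using t by simp
next
  have fin: "finite F" using s by (simp add: step_on_def)
  fix t assume t: "t \<in> {0<..c}"
  have "(y \<longlongrightarrow> y t) (at t within {0..t})"
    using y t by (meson atLeastAtMost_iff greaterThanAtMost_iff continuous_on_def less_imp_le
        atLeastatMost_subset_iff order_refl tendsto_within_subset)
  then have yl: "(y \<longlongrightarrow> y t) (at_left t)"
    using t by (simp add: at_within_Icc_at_left)
  have "\<forall>\<^sub>F u in at_left t. \<forall>q\<in>F. q \<le> u \<longleftrightarrow> q < t"
  proof (intro eventually_ball_finite fin ballI)
    fix q assume "q \<in> F"
    show "\<forall>\<^sub>F u in at_left t. q \<le> u \<longleftrightarrow> q < t"
    proof (cases "q < t")
      case False then show ?thesis by (auto simp: eventually_at_filter)
    next
      case True
      then have "\<forall>\<^sub>F u in at_left t. q < u"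
        unfolding eventually_at_left_field by (intro exI[of _ q]) auto
      then show ?thesis using True by (auto elim: eventually_mono)
    qed
  qed
  moreover have "\<forall>\<^sub>F u in at_left t. 0 < u \<and> u < t"
    unfolding eventually_at_left_field using t by (intro exI[of _ 0]) auto
  ultimately have ev: "\<forall>\<^sub>F u in at_left t. (\<forall>q\<in>F. q \<le> u \<longleftrightarrow> q < t) \<and> 0 < u \<and> u < t"
    by eventually_elim auto
  moreover have "at_left t \<noteq> bot" by (simp add: trivial_limit_at_left_real)
  ultimately obtain v where v: "\<forall>q\<in>F. q \<le> v \<longleftrightarrow> q < t" "0 < v" "v < t"
    using eventually_happens' by blast
  have "\<forall>\<^sub>F u in at_left t. y u + s v = (\<lambda>t\<in>{0..c}. y t + s t) u"
    using ev
  proof eventually_elim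
    case (elim u)
    then have "s u = s v" using t v by (intro step_onD[OF s]) auto
    then show ?case using elim t by auto
  qed
  moreover have "((\<lambda>u. y u + s v) \<longlongrightarrow> y t + s v) (at_left t)"
    by (intro tendsto_intros yl)
  ultimately show "\<exists>l. ((\<lambda>t\<in>{0..c}. y t + s t) \<longlongrightarrow> l) (at_left t)"
    using tendsto_eventually_cong by blast
qed auto

section \<open>Discretisation on a grid and alignment of jumps\<close>

definition grid_floor :: "real \<Rightarrow> nat \<Rightarrow> real \<Rightarrow> real" where
  "grid_floor c m t = c * of_int \<lfloor>t * real m / c\<rfloor> / real m"

lemma grid_floor_bounds:
  assumes "0 \<le> c" "0 < m" "t \<in> {0..c}"
  shows "0 \<le> grid_floor c m t" "grid_floor c m t \<le> t" "t \<le> grid_floor c m t + c / m"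
proof -
  consider "c = 0" | "0 < c" using assms by linarith
  then have "0 \<le> grid_floor c m t \<and> grid_floor c m t \<le> t \<and> t \<le> grid_floor c m t + c / m"
  proof cases
    case 1 then show ?thesis using assms by (simp add: grid_floor_def)
  next
    case 2
    let ?f = "of_int \<lfloor>t * real m / c\<rfloor> :: real"
    have 1: "?f \<le> t * real m / c" "t * real m / c \<le> ?f + 1" by linarith+
    have 0: "0 \<le> ?f" using assms 2 by simp
    have "?f * c \<le> t * real m" "t * real m \<le> (?f + 1) * c"
      using 1 2 by (simp_all only: pos_le_divide_eq pos_divide_le_eq)
    then show ?thesis using 0 2 assms unfolding grid_floor_def
      by (simp add: field_simps)
  qed
  then show "0 \<le> grid_floor c m t" "grid_floor c m t \<le> t" "t \<le> grid_floor c m t + c / m" by auto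
qed

lemma grid_floor_mem:
  assumes "0 \<le> c" "0 < m" "t \<in> {0..c}"
  shows "grid_floor c m t \<in> {0..c}"
  using grid_floor_bounds[OF assms] assms by auto

text \<open>Floor and ceiling are adjoint. A path read at grid points notices a jump at q only from
  the first grid point not before q onwards, and this is the point to which a time change has to
  move q.\<close>

lemma le_grid_floor_iff:
  assumes "0 < c" "0 < m"
  shows "q \<le> grid_floor c m v \<longleftrightarrow> c * of_int \<lceil>q * real m / c\<rceil> / real m \<le> v"
proof -
  have "q \<le> grid_floor c m v \<longleftrightarrow> q * real m / c \<le> of_int \<lfloor>v * real m / c\<rfloor>"
    using assms by (simp add: grid_floor_def field_simps)
  also have "\<dots> \<longleftrightarrow> of_int \<lceil>q * real m / c\<rceil> \<le> v * real m / c"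
    by (simp add: ceiling_le_iff[symmetric] le_floor_iff[symmetric])
  also have "\<dots> \<longleftrightarrow> c * of_int \<lceil>q * real m / c\<rceil> / real m \<le> v"
    using assms by (simp add: field_simps)
  finally show ?thesis .
qed

text \<open>The time change moves every jump time \<open>q\<close> to the next grid point, by adding to the identity
  a hat function of height \<open>h q\<close> centred at \<open>q\<close>.\<close>

lemma hat_time_change:
  fixes F :: "real set"
  assumes F: "finite F" "F \<subseteq> {0<..<c}" and c: "0 < c"
    and g: "0 < g" "\<And>q. q \<in> F \<Longrightarrow> g \<le> q \<and> g \<le> c - q"
      "\<And>q r. q \<in> F \<Longrightarrow> r \<in> F \<Longrightarrow> q \<noteq> r \<Longrightarrow> g \<le> \<bar>q - r\<bar>"
    and h: "\<And>q. q \<in> F \<Longrightarrow> 0 \<le> h q" and hg: "(\<Sum>q\<in>F. h q) < g"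
  defines "l \<equiv> \<lambda>u. u + (\<Sum>q\<in>F. h q * max 0 (1 - \<bar>u - q\<bar> / g))"
  shows "l \<in> time_changes c" "\<And>q. q \<in> F \<Longrightarrow> l q = q + h q" "l c = c" "strict_mono l"
    "\<And>u. \<bar>l u - u\<bar> \<le> (\<Sum>q\<in>F. h q)"
proof -
  have lip: "\<bar>max 0 (1 - \<bar>u - q\<bar> / g) - max 0 (1 - \<bar>v - q\<bar> / g)\<bar> \<le> \<bar>u - v\<bar> / g" for u v q
  proof -
    have "\<bar>(1 - \<bar>u - q\<bar> / g) - (1 - \<bar>v - q\<bar> / g)\<bar> = \<bar>(\<bar>u - q\<bar> - \<bar>v - q\<bar>) / g\<bar>"
      by (simp add: diff_divide_distrib abs_minus_commute)
    also have "\<dots> \<le> \<bar>u - v\<bar> / g" using g by (simp add: divide_right_mono)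
    finally show ?thesis by (auto simp: max_def abs_if split: if_splits)
  qed
  \<comment> \<open>Each hat is Lipschitz with constant 1 / g, and the heights sum to less than g.
    The perturbation of the identity thus has Lipschitz constant below 1 and cannot destroy strict
    monotonicity.\<close>
  show sm: "strict_mono l"
  proof (rule strict_monoI)
    fix u v :: real assume uv: "u < v"
    have "(\<Sum>q\<in>F. h q * max 0 (1 - \<bar>u - q\<bar> / g)) - (\<Sum>q\<in>F. h q * max 0 (1 - \<bar>v - q\<bar> / g))
        = (\<Sum>q\<in>F. h q * (max 0 (1 - \<bar>u - q\<bar> / g) - max 0 (1 - \<bar>v - q\<bar> / g)))"
      by (simp add: sum_subtractf right_diff_distrib)
    also have "\<dots> \<le> (\<Sum>q\<in>F. h q * (\<bar>u - v\<bar> / g))"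
      using lip h by (intro sum_mono mult_left_mono) (auto intro: order_trans[OF abs_ge_self])
    also have "\<dots> = (\<Sum>q\<in>F. h q) / g * (v - u)" using uv by (simp add: sum_distrib_right sum_divide_distrib)
    also have "\<dots> < 1 * (v - u)" using hg g uv by (intro mult_strict_right_mono) auto
    finally show "l u < l v" by (simp add: l_def)
  qed
  show lq: "l q = q + h q" if q: "q \<in> F" for q
  proof -
    have "(\<Sum>r\<in>F. h r * max 0 (1 - \<bar>q - r\<bar> / g)) = (\<Sum>r\<in>F. if r = q then h q else 0)"
    proof (rule sum.cong)
      fix r assume r: "r \<in> F"
      show "h r * max 0 (1 - \<bar>q - r\<bar> / g) = (if r = q then h q else 0)"
      proof (cases "r = q")
        case False
        then have "1 \<le> \<bar>q - r\<bar> / g" using g(3)[OF q r] g(1) by simp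
        then show ?thesis using False by simp
      qed simp
    qed simp
    then show ?thesis using q F by (simp add: l_def)
  qed
  have l0: "l 0 = 0"
  proof -
    have "(\<Sum>q\<in>F. h q * max 0 (1 - \<bar>0 - q\<bar> / g)) = 0"
    proof (rule sum.neutral, intro ballI)
      fix q assume q: "q \<in> F"
      then have "1 - \<bar>0 - q\<bar> / g \<le> 0" using g(2)[OF q] g(1) F by (auto simp: field_simps)
      then show "h q * max 0 (1 - \<bar>0 - q\<bar> / g) = 0" by simp
    qed
    then show ?thesis by (simp add: l_def)
  qed
  show lc: "l c = c"
  proof -
    have "(\<Sum>q\<in>F. h q * max 0 (1 - \<bar>c - q\<bar> / g)) = 0"
    proof (rule sum.neutral, intro ballI)
      fix q assume q: "q \<in> F"
      then have "1 - \<bar>c - q\<bar> / g \<le> 0" using g(2)[OF q] g(1) F by (auto simp: field_simps)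
      then show "h q * max 0 (1 - \<bar>c - q\<bar> / g) = 0" by simp
    qed
    then show ?thesis by (simp add: l_def)
  qed
  have co: "continuous_on {0..c} l" unfolding l_def by (intro continuous_intros) (use g in auto)
  have "l ` {0..c} = {0..c}"
  proof (intro equalityI subsetI)
    fix v assume "v \<in> l ` {0..c}"
    then obtain u where u: "u \<in> {0..c}" "v = l u" by auto
    have "l 0 \<le> l u" "l u \<le> l c" using u strict_mono_leD[OF sm] by auto
    then show "v \<in> {0..c}" using u l0 lc by simp
  next
    fix v assume "v \<in> {0..c}"
    then obtain u where "0 \<le> u" "u \<le> c" "l u = v"
      using IVT'[of l 0 v c] l0 lc c co by auto
    then show "v \<in> l ` {0..c}" by auto
  qed
  then show "l \<in> time_changes c"
    using co sm by (auto simp: time_changes_def intro!: strict_mono_onI dest: strict_monoD)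
  show "\<bar>l u - u\<bar> \<le> (\<Sum>q\<in>F. h q)" for u
  proof -
    have "0 \<le> (\<Sum>q\<in>F. h q * max 0 (1 - \<bar>u - q\<bar> / g))" using h by (intro sum_nonneg) auto
    moreover have "h q * max 0 (1 - \<bar>u - q\<bar> / g) \<le> h q * 1" if "q \<in> F" for q
      using h[OF that] g by (intro mult_left_mono) auto
    then have "(\<Sum>q\<in>F. h q * max 0 (1 - \<bar>u - q\<bar> / g)) \<le> (\<Sum>q\<in>F. h q)"
      by (intro sum_mono) auto
    ultimately show ?thesis by (simp add: l_def)
  qed
qed

lemma finite_set_gap:
  fixes F :: "real set"
  assumes F: "finite F" "F \<subseteq> {0<..<c}"
  obtains g where "0 < g" "\<And>q. q \<in> F \<Longrightarrow> g \<le> q \<and> g \<le> c - q"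
      "\<And>q r. q \<in> F \<Longrightarrow> r \<in> F \<Longrightarrow> q \<noteq> r \<Longrightarrow> g \<le> \<bar>q - r\<bar>"
proof -
  \<comment> \<open>The element 1 keeps the set non-empty when F is empty, so that its minimum is
    defined.\<close>
  define A where "A = insert 1 (F \<union> (\<lambda>q. c - q) ` F \<union> {a \<in> (\<lambda>(q, r). \<bar>q - r\<bar>) ` (F \<times> F). a \<noteq> 0})"
  have A: "finite A" "A \<noteq> {}" "\<forall>a\<in>A. 0 < a" using F by (auto simp: A_def)
  show ?thesis
  proof (rule that[of "Min A"])
    show "0 < Min A" using A by simp
    show "Min A \<le> q \<and> Min A \<le> c - q" if "q \<in> F" for q
      using that A(1) by (auto simp: A_def intro!: Min_le)
    show "Min A \<le> \<bar>q - r\<bar>" if "q \<in> F" "r \<in> F" "q \<noteq> r" for q r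
      using that A(1) by (auto simp: A_def intro!: Min_le)
  qed
qed

lemma step_on_grid_floor:
  assumes c: "0 \<le> c" and m: "0 < m"
  shows "step_on c ((\<lambda>j. c * real j / real m) ` {..m}) (\<lambda>t. x (grid_floor c m t))"
  unfolding step_on_def
proof (intro conjI ballI impI)
  fix u v assume uv: "u \<in> {0..c}" "v \<in> {0..c}"
    and cls: "\<forall>q\<in>(\<lambda>j. c * real j / real m) ` {..m}. q \<le> u \<longleftrightarrow> q \<le> v"
  \<comment> \<open>The grid point below u is one of the jump points and is at most u. Hence it is
    at most v, and so at most the grid point below v. The converse is symmetric.\<close>
  have le: "grid_floor c m u \<le> grid_floor c m v"
    if uv: "u \<in> {0..c}" "v \<in> {0..c}"
     and cls: "\<forall>q\<in>(\<lambda>j. c * real j / real m) ` {..m}. q \<le> u \<longleftrightarrow> q \<le> v" for u v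
  proof (cases "c = 0")
    case False
    with c have c: "0 < c" by simp
    define j where "j = nat \<lfloor>u * real m / c\<rfloor>"
    have "0 \<le> u * real m / c" using uv c by simp
    then have j: "real j = of_int \<lfloor>u * real m / c\<rfloor>" by (simp add: j_def)
    have "u * real m / c \<le> real m"
      using uv c mult_right_mono[of u c "real m"] by (simp add: pos_divide_le_eq mult.commute)
    then have "j \<le> m" using j by linarith
    moreover have gf: "grid_floor c m u = c * real j / real m" by (simp add: grid_floor_def j)
    moreover have "grid_floor c m u \<le> u" using grid_floor_bounds[OF less_imp_le[OF c] m] uv by auto
    ultimately have "c * real j / real m \<le> v" using cls by auto
    then have "real j \<le> v * real m / c" using c m by (simp add: field_simps)
    then have "int j \<le> \<lfloor>v * real m / c\<rfloor>" by (simp add: le_floor_iff)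
    then have "real j \<le> of_int \<lfloor>v * real m / c\<rfloor>" by linarith
    then have "c * real j / real m \<le> c * of_int \<lfloor>v * real m / c\<rfloor> / real m"
      using c by (intro divide_right_mono mult_left_mono) auto
    then show ?thesis unfolding gf by (simp only: grid_floor_def)
  qed (simp add: grid_floor_def)
  have "grid_floor c m u = grid_floor c m v"
    using le[OF uv cls] le[OF uv(2,1)] cls by (intro order_antisym) auto
  then show "x (grid_floor c m u) = x (grid_floor c m v)" by simp
qed auto

lemma cadlag_grid:
  assumes "0 \<le> c" "0 < m"
  shows "(\<lambda>t\<in>{0..c}. x (grid_floor c m t)) \<in> cadlag_space c"
  using cadlag_continuous_plus_step[OF continuous_on_const[of _ 0] step_on_grid_floor[OF assms, of x]]
  by simp

text \<open>Discretisation delays every jump to the next grid point, so the supremum distance need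
  not tend to 0. After the time change of \<open>hat_time_change\<close> the step parts coincide
  exactly, and the remaining error is the oscillation of y over a short interval.\<close>

lemma J1_dist_grid_tendsto:
  assumes c: "0 \<le> c" and y: "continuous_on {0..c} y" and s: "step_on c F s" and F: "F \<subseteq> {0<..c}"
    and x: "\<And>t. t \<in> {0..c} \<Longrightarrow> x t = y t + s t"
  shows "(\<lambda>m. J1_dist c (\<lambda>t\<in>{0..c}. x (grid_floor c (Suc m) t)) (\<lambda>t\<in>{0..c}. x t)) \<longlonglongrightarrow> 0"
proof -
  interpret J: Metric_space "cadlag_space c" "J1_dist c" by (rule Metric_space_J1)
  have xeq: "(\<lambda>t\<in>{0..c}. x t) = (\<lambda>t\<in>{0..c}. y t + s t)" using x by (auto intro!: restrict_ext)
  have xc: "(\<lambda>t\<in>{0..c}. x t) \<in> cadlag_space c"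
    unfolding xeq by (rule cadlag_continuous_plus_step[OF y s])
  have gc: "(\<lambda>t\<in>{0..c}. x (grid_floor c (Suc m) t)) \<in> cadlag_space c" for m
    by (rule cadlag_grid[OF c]) simp
  show ?thesis
  proof (cases "c = 0")
    case True
    have "J1_dist c (\<lambda>t\<in>{0..c}. x (grid_floor c (Suc m) t)) (\<lambda>t\<in>{0..c}. x t) \<le> 0" for m
      by (rule J1_dist_le_sup[OF gc xc]) (auto simp: True grid_floor_def)
    then have "J1_dist c (\<lambda>t\<in>{0..c}. x (grid_floor c (Suc m) t)) (\<lambda>t\<in>{0..c}. x t) = 0" for m
      using J.nonneg by (intro order_antisym)
    then show ?thesis by simp
  next
    case False
    with c have c0: "0 < c" by simp
    \<comment> \<open>A jump at c is left out: c is a grid point and is fixed by every time change,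
      so it needs no hat.\<close>
    define F' where "F' = F \<inter> {0<..<c}"
    have F': "finite F'" "F' \<subseteq> {0<..<c}" using s by (auto simp: F'_def step_on_def)
    obtain g where g: "0 < g" "\<And>q. q \<in> F' \<Longrightarrow> g \<le> q \<and> g \<le> c - q"
      "\<And>q r. q \<in> F' \<Longrightarrow> r \<in> F' \<Longrightarrow> q \<noteq> r \<Longrightarrow> g \<le> \<bar>q - r\<bar>"
      using finite_set_gap[OF F'] by blast
    have uc: "uniformly_continuous_on {0..c} y" using y by (simp add: compact_uniformly_continuous)
    show ?thesis
    proof (rule LIMSEQ_I)
      fix e :: real assume e: "0 < e"
      obtain d where d: "0 < d" "\<And>u v. u \<in> {0..c} \<Longrightarrow> v \<in> {0..c} \<Longrightarrow> \<bar>u - v\<bar> < d \<Longrightarrow> \<bar>y u - y v\<bar> < e / 2"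
        using uc e unfolding uniformly_continuous_on_def dist_real_def
        by (metis abs_minus_commute half_gt_zero)
      \<comment> \<open>The total displacement is at most n cell widths: one for each hat and one
        for the rounding. It has to stay below g, for the time change to be strictly increasing,
        below d, to control y, and below e / 2, the error allowed in time.\<close>
      define n where "n = real (card F') + 1"
      have n: "n \<ge> 1" by (simp add: n_def)
      define b where "b = min g (min d (e / 2))"
      have b: "0 < b" "b \<le> g" "b \<le> d" "b \<le> e / 2" using g d e by (auto simp: b_def)
      obtain m0 :: nat where m0: "n * c / b < real m0" using reals_Archimedean2 by blast
      have "J1_dist c (\<lambda>t\<in>{0..c}. x (grid_floor c (Suc m) t)) (\<lambda>t\<in>{0..c}. x t) < e" if m: "m \<ge> m0" for m
      proof -
        let ?M = "Suc m"
        have "n * c / b < real ?M" using m m0 by linarith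
        then have nc: "n * (c / ?M) < b" using b by (simp add: field_simps)
        define h where "h q = c * of_int \<lceil>q * real ?M / c\<rceil> / real ?M - q" for q
        have h: "0 \<le> h q \<and> h q \<le> c / ?M" for q
        proof -
          have "q * real ?M / c \<le> of_int \<lceil>q * real ?M / c\<rceil>"
            "of_int \<lceil>q * real ?M / c\<rceil> \<le> q * real ?M / c + 1" by linarith+
          then have "q * real ?M \<le> of_int \<lceil>q * real ?M / c\<rceil> * c"
            "of_int \<lceil>q * real ?M / c\<rceil> * c \<le> q * real ?M + c"
            using c0 by (simp_all only: pos_divide_le_eq) (simp add: field_simps)
          then have "q \<le> c * of_int \<lceil>q * real ?M / c\<rceil> / real ?M"
            "c * of_int \<lceil>q * real ?M / c\<rceil> / real ?M \<le> (q * real ?M + c) / real ?M"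
            by (simp_all add: pos_le_divide_eq divide_right_mono mult.commute del: of_nat_Suc)
          then show ?thesis by (simp add: h_def add_divide_distrib del: of_nat_Suc)
        qed
        have "(\<Sum>q\<in>F'. h q) \<le> (\<Sum>q\<in>F'. c / ?M)" using h by (intro sum_mono) auto
        then have hs: "(\<Sum>q\<in>F'. h q) + c / ?M \<le> n * (c / ?M)"
          by (simp add: n_def distrib_right add_divide_distrib del: of_nat_Suc)
        have hg: "(\<Sum>q\<in>F'. h q) < g" using hs nc b c0 
          by (smt (verit) divide_nonneg_nonneg of_nat_0_le_iff)
        define l where "l = (\<lambda>u. u + (\<Sum>q\<in>F'. h q * max 0 (1 - \<bar>u - q\<bar> / g)))"
        have h0: "0 \<le> h q" for q using h by simp
        have L1: "l \<in> time_changes c" unfolding l_def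
          by (rule hat_time_change(1)[OF F' c0 g(1) _ _ _ hg]) (use g(2,3) h0 in auto)
        have L2: "l q = q + h q" if "q \<in> F'" for q unfolding l_def
          by (rule hat_time_change(2)[OF F' c0 g(1) _ _ _ hg that]) (use g(2,3) h0 in auto)
        have L3: "l c = c" unfolding l_def
          by (rule hat_time_change(3)[OF F' c0 g(1) _ _ _ hg]) (use g(2,3) h0 in auto)
        have L4: "strict_mono l" unfolding l_def
          by (rule hat_time_change(4)[OF F' c0 g(1) _ _ _ hg]) (use g(2,3) h0 in auto)
        have L5: "\<bar>l u - u\<bar> \<le> (\<Sum>q\<in>F'. h q)" for u unfolding l_def
          by (rule hat_time_change(5)[OF F' c0 g(1) _ _ _ hg]) (use g(2,3) h0 in auto)
        have lm: "l u \<in> {0..c}" if "u \<in> {0..c}" for u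
          using L1 that by (auto simp: time_changes_def)
        \<comment> \<open>The original path comes first because \<open>J1_bounds\<close> composes
          the time change with its second argument. Symmetry of the distance restores the
          order.\<close>
        have "e / 2 \<in> J1_bounds c (\<lambda>t\<in>{0..c}. x t) (\<lambda>t\<in>{0..c}. x (grid_floor c (Suc m) t))"
        proof (rule J1_boundsI[OF _ L1])
          fix u assume u: "u \<in> {0..c}"
          have cM: "0 \<le> c / ?M" using c0 by simp
          show "\<bar>l u - u\<bar> \<le> e / 2" using L5[of u] hs nc b cM by linarith
          let ?v = "grid_floor c ?M (l u)"
          have v: "?v \<in> {0..c}" "?v \<le> l u" "l u \<le> ?v + c / ?M"
            using grid_floor_bounds[OF c _ lm[OF u], of ?M] grid_floor_mem[OF c _ lm[OF u], of ?M] by auto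
          have "s u = s ?v"
          proof (rule step_onD[OF s u v(1)])
            fix q assume q: "q \<in> F"
            have "q \<le> ?v \<longleftrightarrow> c * of_int \<lceil>q * real ?M / c\<rceil> / real ?M \<le> l u"
              by (rule le_grid_floor_iff[OF c0]) simp
            also have "\<dots> \<longleftrightarrow> l q \<le> l u"
            proof (cases "q = c")
              case True then show ?thesis using c0 by (simp add: L3)
            next
              case False
              then have "q \<in> F'" using q F by (auto simp: F'_def)
              then show ?thesis by (simp add: L2 h_def)
            qed
            also have "\<dots> \<longleftrightarrow> q \<le> u" by (rule strict_mono_less_eq[OF L4])
            finally show "q \<le> u \<longleftrightarrow> q \<le> ?v" by simp
          qed
          moreover have "\<bar>u - ?v\<bar> < d"
            using L5[of u] v hs nc b by linarith
          then have "\<bar>y u - y ?v\<bar> < e / 2" by (intro d u v(1))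
          ultimately show "\<bar>(\<lambda>t\<in>{0..c}. x t) u - (\<lambda>t\<in>{0..c}. x (grid_floor c (Suc m) t)) (l u)\<bar> \<le> e / 2"
            using u lm[OF u] v(1) by (simp add: x)
        qed (use e in auto)
        then have "J1_dist c (\<lambda>t\<in>{0..c}. x t) (\<lambda>t\<in>{0..c}. x (grid_floor c (Suc m) t)) \<le> e / 2"
          by (rule J1_dist_le[OF xc gc])
        then show ?thesis using e by (simp add: J.commute)
      qed
      then show "\<exists>m0. \<forall>m\<ge>m0. norm (J1_dist c (\<lambda>t\<in>{0..c}. x (grid_floor c (Suc m) t)) (\<lambda>t\<in>{0..c}. x t) - 0) < e"
        by (intro exI[of _ m0]) (use J.nonneg in auto)
    qed
  qed
qed

section \<open>Grid paths as functions of finitely many values\<close>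

definition grid_path :: "real \<Rightarrow> nat \<Rightarrow> (nat \<Rightarrow> real) \<Rightarrow> real \<Rightarrow> real" where
  "grid_path c m v = (\<lambda>t\<in>{0..c}. v (nat \<lfloor>t * real m / c\<rfloor>))"

lemma grid_index_le:
  assumes "0 \<le> c" "t \<in> {0..c}"
  shows "nat \<lfloor>t * real m / c\<rfloor> \<le> m"
proof (cases "c = 0")
  case False
  then have "0 < c" "t * real m \<le> c * real m" using assms by (auto intro: mult_right_mono)
  then have "t * real m / c \<le> real m" by (simp add: pos_divide_le_eq mult.commute)
  then show ?thesis by linarith
qed simp

lemma grid_floor_index:
  assumes "0 \<le> c" "t \<in> {0..c}"
  shows "grid_floor c m t = c * real (nat \<lfloor>t * real m / c\<rfloor>) / real m"
proof -
  have "0 \<le> t * real m / c" using assms by simp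
  then show ?thesis by (simp add: grid_floor_def)
qed

lemma grid_path_cadlag:
  assumes c: "0 \<le> c" and m: "0 < m"
  shows "grid_path c m v \<in> cadlag_space c"
proof (cases "c = 0")
  case True
  then show ?thesis by (auto simp: grid_path_def cadlag_space_def)
next
  case False
  with c have c0: "0 < c" by simp
  have "grid_path c m v = (\<lambda>t\<in>{0..c}. (\<lambda>u. v (nat \<lfloor>u * real m / c\<rfloor>)) (grid_floor c m t))"
    unfolding grid_path_def
    by (rule restrict_ext) (use c0 m in \<open>simp add: grid_floor_def\<close>)
  then show ?thesis using cadlag_grid[OF c m, of "\<lambda>u. v (nat \<lfloor>u * real m / c\<rfloor>)"] by metis
qed

lemma J1_dist_grid_path:
  assumes c: "0 \<le> c" and m: "0 < m" and r: "0 \<le> r" and "\<And>j. j \<le> m \<Longrightarrow> \<bar>v j - w j\<bar> \<le> r"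
  shows "J1_dist c (grid_path c m v) (grid_path c m w) \<le> r"
  using assms grid_index_le[OF c]
  by (intro J1_dist_le_sup grid_path_cadlag) (auto simp: grid_path_def)

text \<open>The map is continuous for the product topology: only the coordinates up to m enter, and
  the Skorokhod distance is at most the largest change among them.\<close>

lemma measurable_grid_path:
  assumes c: "0 \<le> c" and m: "0 < m"
  shows "grid_path c m \<in> measurable borel (borel_of (J1_topology c))"
proof (rule measurable_borel_ofI)
  interpret J: Metric_space "cadlag_space c" "J1_dist c" by (rule Metric_space_J1)
  fix U assume U: "openin (J1_topology c) U"
  have "open (grid_path c m -` U)"
    unfolding open_subopen[of "grid_path c m -` U"]
  proof
    fix v assume "v \<in> grid_path c m -` U"
    then obtain r where r: "r > 0" "J.mball (grid_path c m v) r \<subseteq> U"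
      using U by (auto simp: J1_topology_def J.openin_mtopology)
    define W where "W = (\<Inter>j\<in>{..m}. {w. \<bar>w j - v j\<bar> < r / 2})"
    have "continuous_on UNIV (\<lambda>w. \<bar>w j - v j\<bar>)" for j
      by (intro continuous_on_rabs continuous_on_diff continuous_on_const
          continuous_on_product_coordinates)
    then have "open {w. \<bar>w j - v j\<bar> < r / 2}" for j
      by (intro open_Collect_less continuous_on_const)
    then have "open W" unfolding W_def
      by blast
    moreover have "v \<in> W" using r by (simp add: W_def)
    moreover have "W \<subseteq> grid_path c m -` U"
    proof
      fix w assume w: "w \<in> W"
      have "J1_dist c (grid_path c m v) (grid_path c m w) \<le> r / 2"
        by (rule J1_dist_grid_path[OF c m])
          (use w r in \<open>auto simp: W_def abs_minus_commute intro: less_imp_le\<close>)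
      then have "grid_path c m w \<in> J.mball (grid_path c m v) r"
        using r grid_path_cadlag[OF c m] by auto
      then show "w \<in> grid_path c m -` U" using r by auto
    qed
    ultimately show "\<exists>T. open T \<and> v \<in> T \<and> T \<subseteq> grid_path c m -` U" by blast
  qed
  then show "grid_path c m -` U \<inter> space borel \<in> sets borel" by simp
qed (simp add: grid_path_cadlag[OF c m])

text \<open>A discretised path is a Borel function of its finitely many grid values, and the path is
  the pointwise Skorokhod limit of its discretisations. Measurability of the coordinates carries
  over without any description of the Borel sets of the topology.\<close>

lemma measurable_J1:
  assumes c: "0 \<le> c"
    and X: "\<And>t. t \<in> {0..c} \<Longrightarrow> X t \<in> borel_measurable N"
    and path: "\<And>\<omega>. \<omega> \<in> space N \<Longrightarrow> \<exists>y s F. continuous_on {0..c} y \<and> step_on c F s \<and> F \<subseteq> {0<..c} \<and>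
      (\<forall>t\<in>{0..c}. X t \<omega> = y t + s t)"
  shows "(\<lambda>\<omega>. \<lambda>t\<in>{0..c}. X t \<omega>) \<in> measurable N (borel_of (J1_topology c))"
  unfolding J1_topology_def
proof (rule Metric_space.measurable_borel_of_limit[OF Metric_space_J1,
      of "\<lambda>m \<omega>. \<lambda>t\<in>{0..c}. X (grid_floor c (Suc m) t) \<omega>"])
  fix m
  let ?M = "Suc m"
  \<comment> \<open>Capping the index at \<open>?M\<close> keeps every evaluation time in
    \<open>{0..c}\<close>, so that all coordinates of the infinite sequence are measurable.\<close>
  define V where "V \<omega> j = X (c * real (min j ?M) / real ?M) \<omega>" for \<omega> j
  have V: "V \<in> measurable N borel"
  proof (rule measurable_coordinatewise_then_product)
    fix j show "(\<lambda>\<omega>. V \<omega> j) \<in> borel_measurable N"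
    proof -
      have "c * (real (min j ?M) / real ?M) \<le> c * 1"
        using c by (intro mult_left_mono) (auto simp del: of_nat_Suc)
      then show ?thesis unfolding V_def using c by (intro X) auto
    qed
  qed
  have "(\<lambda>\<omega>. \<lambda>t\<in>{0..c}. X (grid_floor c ?M t) \<omega>) = grid_path c ?M \<circ> V"
    using grid_index_le[OF c, of _ ?M] grid_floor_index[OF c, of _ ?M]
    by (auto simp: fun_eq_iff grid_path_def V_def min_absorb1)
  also have "\<dots> \<in> measurable N (borel_of (J1_topology c))"
    by (rule measurable_comp[OF V measurable_grid_path[OF c]]) simp
  finally show "(\<lambda>\<omega>. \<lambda>t\<in>{0..c}. X (grid_floor c ?M t) \<omega>) \<in>
    measurable N (borel_of (Metric_space.mtopology (cadlag_space c) (J1_dist c)))"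
    by (simp add: J1_topology_def)
next
  fix \<omega> assume \<omega>: "\<omega> \<in> space N"
  obtain y s F where p: "continuous_on {0..c} y" "step_on c F s" "F \<subseteq> {0<..c}"
      "\<forall>t\<in>{0..c}. X t \<omega> = y t + s t"
    using path[OF \<omega>] by blast
  show "(\<lambda>m. J1_dist c (\<lambda>t\<in>{0..c}. X (grid_floor c (Suc m) t) \<omega>) (\<lambda>t\<in>{0..c}. X t \<omega>)) \<longlonglongrightarrow> 0"
    by (rule J1_dist_grid_tendsto[OF c p(1-3)]) (use p(4) in auto)
  have "(\<lambda>t\<in>{0..c}. X t \<omega>) = (\<lambda>t\<in>{0..c}. y t + s t)" using p(4) by (auto intro!: restrict_ext)
  then show "(\<lambda>t\<in>{0..c}. X t \<omega>) \<in> cadlag_space c"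
    using cadlag_continuous_plus_step[OF p(1,2)] by simp
qed

text \<open>Taking the ancestor of the finest cell by integer division agrees with rounding directly
  to the coarser grid. This is the index form that \<open>dyadic_chaining\<close> uses.\<close>

lemma grid_floor_coarsen:
  assumes c: "0 \<le> c" and t: "t \<in> {0..c}" and q: "q \<le> J"
  shows "grid_floor c (2 ^ q) t = c * real (nat \<lfloor>t * 2 ^ J / c\<rfloor> div 2 ^ (J - q)) / 2 ^ q"
proof -
  have "(2 :: real) ^ J = 2 ^ q * 2 ^ (J - q)" using q by (simp add: power_add[symmetric])
  then have "t * 2 ^ q / c = (t * 2 ^ J / c) / real_of_int (2 ^ (J - q))" by simp
  then have "\<lfloor>t * 2 ^ q / c\<rfloor> = \<lfloor>t * 2 ^ J / c\<rfloor> div 2 ^ (J - q)"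
    by (simp only: floor_divide_real_eq_div zero_le_power zero_le_numeral)
  then have "nat \<lfloor>t * 2 ^ q / c\<rfloor> = nat \<lfloor>t * 2 ^ J / c\<rfloor> div 2 ^ (J - q)"
    by (simp add: nat_div_distrib' nat_power_eq)
  then show ?thesis using grid_floor_index[OF c t, of "2 ^ q"] by simp
qed

section \<open>Components and cycles of random graphs\<close>

definition edge_pairs :: "'v set \<Rightarrow> 'v set set" where
  "edge_pairs V = {{i, j} |i j. i \<in> V \<and> j \<in> V \<and> i \<noteq> j}"

definition adj :: "'v set set \<Rightarrow> ('v \<times> 'v) set" where
  "adj E = {(a, b). {a, b} \<in> E}"

lemma in_adj [simp]: "(a, b) \<in> adj E \<longleftrightarrow> {a, b} \<in> E"
  by (simp add: adj_def)

definition joined :: "'v set \<Rightarrow> 'v set set \<Rightarrow> ('v \<times> 'v) set" where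
  "joined V E = {(i, j) \<in> V \<times> V. (i, j) \<in> (adj E)\<^sup>*}"

text \<open>These are the edges that are not bridges. Their number dominates the cycle rank,
  increases with the edge set, and has an expectation that is a sum over single edges.\<close>

definition cycle_edges :: "'v set set \<Rightarrow> 'v set set" where
  "cycle_edges E = {e \<in> E. \<exists>i j. e = {i, j} \<and> i \<noteq> j \<and> (i, j) \<in> (adj (E - {e}))\<^sup>*}"

lemma edge_pairs_mono: "V \<subseteq> W \<Longrightarrow> edge_pairs V \<subseteq> edge_pairs W"
  by (auto simp: edge_pairs_def)

lemma edge_pairs_image: "edge_pairs V = (\<lambda>(i, j). {i, j}) ` {(i, j) \<in> V \<times> V. i \<noteq> j}"
  by (auto simp: edge_pairs_def image_def)

lemma finite_edge_pairs: "finite V \<Longrightarrow> finite (edge_pairs V)"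
  unfolding edge_pairs_image by (rule finite_imageI, rule finite_subset[of _ "V \<times> V"]) auto

lemma sym_adj_rtrancl: "(a, b) \<in> (adj E)\<^sup>* \<Longrightarrow> (b, a) \<in> (adj E)\<^sup>*"
proof -
  have "sym ((adj E)\<^sup>*)" by (rule sym_rtrancl) (auto simp: sym_def insert_commute)
  then show "(a, b) \<in> (adj E)\<^sup>* \<Longrightarrow> (b, a) \<in> (adj E)\<^sup>*" by (rule symD)
qed

lemma adj_rtrancl_mono: "E \<subseteq> E' \<Longrightarrow> (adj E)\<^sup>* \<subseteq> (adj E')\<^sup>*"
  by (rule rtrancl_mono) (auto simp: adj_def)

lemma equiv_joined: "equiv V (joined V E)"
proof (rule equivI)
  show "sym (joined V E)" by (auto simp: joined_def sym_def intro: sym_adj_rtrancl)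
  show "trans (joined V E)" unfolding joined_def trans_def by (auto intro: rtrancl_trans)
qed (auto simp: joined_def refl_on_def)

lemma num_components_joined: "num_components V E = card (V // joined V E)"
  by (simp add: num_components_def components_def joined_def adj_def)

text \<open>A walk can be shortened until it uses the new edge at most once, in one of its two
  directions.\<close>

lemma adj_insert_rtrancl:
  "(x, y) \<in> (adj (insert {i, j} E))\<^sup>* \<longleftrightarrow> (x, y) \<in> (adj E)\<^sup>* \<or>
     (x, i) \<in> (adj E)\<^sup>* \<and> (j, y) \<in> (adj E)\<^sup>* \<or> (x, j) \<in> (adj E)\<^sup>* \<and> (i, y) \<in> (adj E)\<^sup>*"
proof -
  have "adj (insert {i, j} E) = insert (i, j) (insert (j, i) (adj E))"
    by (auto simp: doubleton_eq_iff adj_def)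
  then show ?thesis
    by (auto simp: rtrancl_insert intro: rtrancl_trans)
qed

lemma num_components_insert_joined:
  assumes "(i, j) \<in> (adj E)\<^sup>*"
  shows "num_components V (insert {i, j} E) = num_components V E"
proof -
  have "joined V (insert {i, j} E) = joined V E"
    using assms sym_adj_rtrancl[OF assms] unfolding joined_def adj_insert_rtrancl
    by (blast intro: rtrancl_trans)
  then show ?thesis by (simp add: num_components_joined)
qed

text \<open>The classes of i and j merge and all other classes survive. The fact \<open>quot\<close>
  says this for the whole quotient; the count follows because the merged class is not an old
  one.\<close>

lemma num_components_insert_not_joined:
  assumes V: "finite V" "i \<in> V" "j \<in> V" and n: "(i, j) \<notin> (adj E)\<^sup>*"
  shows "num_components V (insert {i, j} E) + 1 = num_components V E"
proof -
  let ?R = "joined V E" and ?R' = "joined V (insert {i, j} E)"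
  let ?I = "?R `` {i}" and ?J = "?R `` {j}"
  have R: "equiv V ?R" and R': "equiv V ?R'" by (rule equiv_joined)+
  have cls: "?R' `` {x} = (if x \<in> ?I \<union> ?J then ?I \<union> ?J else ?R `` {x})" if "x \<in> V" for x
  proof -
    have *: "(a, b) \<in> ?R' \<longleftrightarrow> (a, b) \<in> ?R \<or> (a, i) \<in> ?R \<and> (j, b) \<in> ?R \<or> (a, j) \<in> ?R \<and> (i, b) \<in> ?R" for a b
      using V by (auto simp: joined_def adj_insert_rtrancl)
    have cl: "?R' `` {x} = ?R `` {x} \<union> (if i \<in> ?R `` {x} then ?J else {}) \<union> (if j \<in> ?R `` {x} then ?I else {})"
      by (auto simp: *)
    have iI: "i \<in> ?I" "j \<in> ?J" using V by (auto simp: joined_def)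
    have mem: "i \<in> ?R `` {x} \<longleftrightarrow> x \<in> ?I" "j \<in> ?R `` {x} \<longleftrightarrow> x \<in> ?J"
      by (auto simp: joined_def intro: sym_adj_rtrancl)
    have "x \<in> ?I \<Longrightarrow> ?R `` {x} = ?I" "x \<in> ?J \<Longrightarrow> ?R `` {x} = ?J"
      using equiv_class_eq[OF R] by auto
    then have "?R' `` {x} = (if x \<in> ?I \<union> ?J then ?I \<union> ?J else ?R `` {x})"
      unfolding cl mem by auto
    then show ?thesis by blast
  qed
  have ij: "i \<in> ?I" "j \<in> ?J" using V by (auto simp: joined_def)
  have out: "?R `` {x} \<noteq> ?I \<and> ?R `` {x} \<noteq> ?J" if "x \<in> V" "x \<notin> ?I \<union> ?J" for x
    using that V eq_equiv_class[OF _ R] by (metis Image_singleton_iff UnCI equiv_class_self[OF R])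
  have quot: "V // ?R' = insert (?I \<union> ?J) (V // ?R - {?I, ?J})"
  proof (intro equalityI subsetI)
    fix C assume "C \<in> V // ?R'"
    then obtain x where x: "x \<in> V" "C = ?R' `` {x}" by (auto elim: quotientE)
    show "C \<in> insert (?I \<union> ?J) (V // ?R - {?I, ?J})"
      using x cls[of x] out[of x] by (auto intro: quotientI)
  next
    fix C assume C: "C \<in> insert (?I \<union> ?J) (V // ?R - {?I, ?J})"
    show "C \<in> V // ?R'"
    proof (cases "C = ?I \<union> ?J")
      case True
      then have "C = ?R' `` {i}" using cls[of i] ij V by simp
      then show ?thesis using V by (auto intro: quotientI)
    next
      case False
      with C have C': "C \<in> V // ?R" "C \<noteq> ?I" "C \<noteq> ?J" by simp_all
      then obtain x where x: "x \<in> V" "C = ?R `` {x}" by (blast elim: quotientE)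
      have "x \<notin> ?I \<union> ?J" using x C' equiv_class_eq[OF R] by auto
      then have "C = ?R' `` {x}" using cls[of x] x by simp
      then show ?thesis using x by (auto intro: quotientI)
    qed
  qed
  have IJ: "?I \<noteq> ?J"
    using n ij by (auto simp: joined_def)
  have mem: "?I \<in> V // ?R" "?J \<in> V // ?R" using V by (auto intro: quotientI)
  have new: "?I \<union> ?J \<notin> V // ?R"
  proof
    assume "?I \<union> ?J \<in> V // ?R"
    then obtain x where "x \<in> V" "?I \<union> ?J = ?R `` {x}" by (auto elim: quotientE)
    then have "(x, i) \<in> ?R" "(x, j) \<in> ?R" using ij by blast+
    then have "(i, j) \<in> ?R" using R by (meson equivE symE transE)
    then show False using n by (simp add: joined_def)
  qed
  have fin: "finite (V // ?R)" using V by (intro finite_quotient) (auto simp: joined_def)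
  have "card (V // ?R') = Suc (card (V // ?R - {?I, ?J}))"
    unfolding quot using fin new by (subst card_insert_disjoint) auto
  moreover have "card (V // ?R - {?I, ?J}) + 2 = card (V // ?R)"
  proof -
    have "card (V // ?R - {?I, ?J}) = card (V // ?R) - card {?I, ?J}"
      using mem by (intro card_Diff_subset) auto
    moreover have "card {?I, ?J} \<le> card (V // ?R)" using mem fin by (intro card_mono) auto
    ultimately show ?thesis using IJ by simp
  qed
  ultimately show ?thesis by (simp add: num_components_joined)
qed

lemma num_components_empty: "num_components V {} = card V"
proof -
  have "joined V {} = {(i, j). i \<in> V \<and> i = j}" by (auto simp: joined_def adj_def)
  then have "V // joined V {} = (\<lambda>x. {x}) ` V" by (auto simp: quotient_def)
  then show ?thesis by (simp add: num_components_joined card_image)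
qed

lemma cycle_edges_mono:
  assumes "E \<subseteq> E'"
  shows "cycle_edges E \<subseteq> cycle_edges E'"
proof
  fix e assume "e \<in> cycle_edges E"
  then obtain i j where "e \<in> E" "e = {i, j}" "i \<noteq> j" "(i, j) \<in> (adj (E - {e}))\<^sup>*"
    by (auto simp: cycle_edges_def)
  moreover have "(adj (E - {e}))\<^sup>* \<subseteq> (adj (E' - {e}))\<^sup>*" using assms by (intro adj_rtrancl_mono) auto
  ultimately show "e \<in> cycle_edges E'" using assms unfolding cycle_edges_def by blast
qed

text \<open>Edges are inserted one at a time. An edge between two components lowers their number by
  one and keeps the balance. An edge inside a component keeps the number and is itself a new cycle
  edge, so the excess never grows faster than the set of cycle edges.\<close>

lemma num_components_bounds:
  assumes V: "finite V" and E: "finite E" "E \<subseteq> edge_pairs V"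
  shows "card V \<le> num_components V E + card E"
    "num_components V E + card E \<le> card V + card (cycle_edges E)"
proof -
  have "card V \<le> num_components V E + card E \<and>
    num_components V E + card E \<le> card V + card (cycle_edges E)"
    using E
  proof (induction E rule: finite_induct)
    case empty
    then show ?case by (simp add: num_components_empty)
  next
    case (insert e E)
    then obtain i j where e: "e = {i, j}" "i \<in> V" "j \<in> V" "i \<noteq> j" by (auto simp: edge_pairs_def)
    have fin: "finite (cycle_edges (insert e E))"
      by (rule finite_subset[of _ "insert e E"]) (use insert in \<open>auto simp: cycle_edges_def\<close>)
    have sub: "cycle_edges E \<subseteq> cycle_edges (insert e E)" by (rule cycle_edges_mono) auto
    show ?case
    proof (cases "(i, j) \<in> (adj E)\<^sup>*")
      case True
      have "e \<in> cycle_edges (insert e E)"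
        using True e insert.hyps by (auto simp: cycle_edges_def)
      moreover have "e \<notin> cycle_edges E" using insert.hyps by (auto simp: cycle_edges_def)
      ultimately have "card (cycle_edges E) < card (cycle_edges (insert e E))"
        using fin sub by (intro psubset_card_mono) auto
      then show ?thesis
        using insert num_components_insert_joined[OF True, of V] e by simp
    next
      case False
      have "card (cycle_edges E) \<le> card (cycle_edges (insert e E))" using fin sub by (rule card_mono)
      then show ?thesis
        using insert num_components_insert_not_joined[OF V e(2,3) False] e by simp
    qed
  qed
  then show "card V \<le> num_components V E + card E"
    "num_components V E + card E \<le> card V + card (cycle_edges E)" by auto
qed

lemma joined_first_step:
  assumes E: "E \<subseteq> edge_pairs W" and "(i, j) \<in> (adj E)\<^sup>*" "i \<noteq> j"
  obtains k where "k \<in> W - {i}" "{i, k} \<in> E" "(k, j) \<in> (adj {e \<in> E. i \<notin> e})\<^sup>*"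
proof -
  let ?A = "adj {e \<in> E. i \<notin> e}"
  have iso: "j = i" if "(i, j) \<in> ?A\<^sup>*" for j
    using that by (cases rule: converse_rtranclE) auto
  \<comment> \<open>Reading the path backwards from j, either no edge at i has been used so far, or
    a departure from i with a tail free of i has been found. The second alternative does not mention
    x and hence persists.\<close>
  have "(x, j) \<in> ?A\<^sup>* \<or> (\<exists>k\<in>W - {i}. {i, k} \<in> E \<and> (k, j) \<in> ?A\<^sup>*)" if "(x, j) \<in> (adj E)\<^sup>*" for x
    using that
  proof (induction rule: converse_rtrancl_induct)
    case base
    then show ?case by simp
  next
    case (step x y)
    show ?case
    proof (cases "\<exists>k\<in>W - {i}. {i, k} \<in> E \<and> (k, j) \<in> ?A\<^sup>*")
      case False
      then have yj: "(y, j) \<in> ?A\<^sup>*" using step.IH by blast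
      have xy: "{x, y} \<in> E" "x \<noteq> y" "x \<in> W" "y \<in> W"
        using step.hyps E by (auto simp: edge_pairs_def doubleton_eq_iff)
      have "y \<noteq> i" using iso yj assms by blast
      then have "x \<noteq> i" using False xy yj by auto
      then have "(x, y) \<in> ?A" using xy \<open>y \<noteq> i\<close> by auto
      then show ?thesis using yj by (meson converse_rtrancl_into_rtrancl)
    qed simp
  qed
  then have "(i, j) \<in> ?A\<^sup>* \<or> (\<exists>k\<in>W - {i}. {i, k} \<in> E \<and> (k, j) \<in> ?A\<^sup>*)" using assms by blast
  then show ?thesis using iso assms that by blast
qed

section \<open>Connection probabilities and the expected number of cycle edges\<close>

context prob_space
begin

text \<open>A finite product of discrete spaces is discrete. Hence every predicate of the random
  set, connectivity for instance, defines an event.\<close>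

lemma measurable_random_set:
  fixes X :: "'i \<Rightarrow> 'a \<Rightarrow> bool"
  assumes D: "finite D" and X: "\<And>d. d \<in> D \<Longrightarrow> X d \<in> measurable M (count_space UNIV)"
  shows "(\<lambda>\<omega>. {d \<in> D. X d \<omega>}) \<in> measurable M (count_space UNIV)"
proof -
  have 1: "(\<lambda>\<omega>. restrict (\<lambda>d. X d \<omega>) D) \<in> measurable M (PiM D (\<lambda>_. count_space UNIV))"
    using X by (rule measurable_restrict)
  have 2: "(\<lambda>f. {d \<in> D. f d}) \<in> measurable (PiM D (\<lambda>_. count_space (UNIV :: bool set))) (count_space UNIV)"
    using D by (subst count_space_PiM_finite) auto
  have "(\<lambda>\<omega>. {d \<in> D. X d \<omega>}) = (\<lambda>f. {d \<in> D. f d}) \<circ> (\<lambda>\<omega>. restrict (\<lambda>d. X d \<omega>) D)"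
    by (auto simp: fun_eq_iff)
  then show ?thesis using measurable_comp[OF 1 2] by simp
qed

lemma sets_random_set:
  fixes X :: "'i \<Rightarrow> 'a \<Rightarrow> bool"
  assumes D: "finite D" and X: "\<And>d. d \<in> D \<Longrightarrow> X d \<in> measurable M (count_space UNIV)"
  shows "{\<omega> \<in> space M. Q {d \<in> D. X d \<omega>}} \<in> events"
proof -
  have "(\<lambda>\<omega>. {d \<in> D. X d \<omega>}) -` {S. Q S} \<inter> space M \<in> events"
    by (rule measurable_sets[OF measurable_random_set[OF assms]]) auto
  moreover have "(\<lambda>\<omega>. {d \<in> D. X d \<omega>}) -` {S. Q S} \<inter> space M = {\<omega> \<in> space M. Q {d \<in> D. X d \<omega>}}"
    by auto
  ultimately show ?thesis by simp
qed

lemma indep_event_random_set: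
  fixes X :: "'i \<Rightarrow> 'a \<Rightarrow> bool"
  assumes ind: "indep_vars (\<lambda>_. count_space UNIV) X I"
    and e: "e \<in> I" "e \<notin> D" and D: "finite D" "D \<subseteq> I"
  shows "prob {\<omega> \<in> space M. X e \<omega> \<and> Q {d \<in> D. X d \<omega>}} =
    prob {\<omega> \<in> space M. X e \<omega>} * prob {\<omega> \<in> space M. Q {d \<in> D. X d \<omega>}}"
proof -
  let ?C = "count_space (UNIV :: bool set)"
  have "indep_var (PiM {e} (\<lambda>_. ?C)) (\<lambda>\<omega>. restrict (\<lambda>i. X i \<omega>) {e})
      (PiM D (\<lambda>_. ?C)) (\<lambda>\<omega>. restrict (\<lambda>i. X i \<omega>) D)"
    using e D by (intro indep_var_restrict[OF ind]) auto
  then have "indep_var ?C ((\<lambda>f. f e) \<circ> (\<lambda>\<omega>. restrict (\<lambda>i. X i \<omega>) {e}))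
      ?C ((\<lambda>f. Q {d \<in> D. f d}) \<circ> (\<lambda>\<omega>. restrict (\<lambda>i. X i \<omega>) D))"
    by (rule indep_var_compose) (use D in \<open>simp_all add: count_space_PiM_finite\<close>)
  from indep_varD[OF this, of "{True}" "{True}"]
  have "prob ((\<lambda>x. (X e x, Q {d \<in> D. X d x})) -` ({True} \<times> {True}) \<inter> space M) =
    prob (X e -` {True} \<inter> space M) * prob ((\<lambda>\<omega>. Q {d \<in> D. X d \<omega>}) -` {True} \<inter> space M)"
    by (simp add: comp_def cong: conj_cong)
  moreover have "(\<lambda>x. (X e x, Q {d \<in> D. X d x})) -` ({True} \<times> {True}) \<inter> space M =
      {\<omega> \<in> space M. X e \<omega> \<and> Q {d \<in> D. X d \<omega>}}"
    "X e -` {True} \<inter> space M = {\<omega> \<in> space M. X e \<omega>}"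
    "(\<lambda>\<omega>. Q {d \<in> D. X d \<omega>}) -` {True} \<inter> space M = {\<omega> \<in> space M. Q {d \<in> D. X d \<omega>}}"
    by auto
  ultimately show ?thesis by simp
qed

text \<open>Decompose a path from \<open>i\<close> to \<open>j\<close> at its last visit of \<open>i\<close>: the first edge is independent of
  the rest of the path, which avoids \<open>i\<close>.\<close>

lemma prob_joined_le:
  fixes X :: "'v set \<Rightarrow> 'a \<Rightarrow> bool" and z :: "'v \<Rightarrow> real"
  assumes V: "finite V" and ind: "indep_vars (\<lambda>_. count_space UNIV) X (edge_pairs V)"
    and p: "\<And>i j. i \<in> V \<Longrightarrow> j \<in> V \<Longrightarrow> i \<noteq> j \<Longrightarrow> prob {\<omega> \<in> space M. X {i, j} \<omega>} \<le> z i * z j * t"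
    and z: "\<And>i. i \<in> V \<Longrightarrow> 0 \<le> z i" and t: "0 \<le> t" and sub: "(\<Sum>i\<in>V. (z i)\<^sup>2) * t < 1"
    and W: "W \<subseteq> V" and ij: "i \<in> W" "j \<in> W" "i \<noteq> j"
  shows "prob {\<omega> \<in> space M. (i, j) \<in> (adj {e \<in> edge_pairs W. X e \<omega>})\<^sup>*}
    \<le> z i * z j * t / (1 - (\<Sum>i\<in>V. (z i)\<^sup>2) * t)"
proof -
  define s where "s = (\<Sum>i\<in>V. (z i)\<^sup>2) * t"
  have s: "s < 1" using sub by (simp add: s_def)
  have Xm: "X e \<in> measurable M (count_space UNIV)" if "e \<in> edge_pairs V" for e
    using ind that by (simp add: indep_vars_def)
  have ev: "{\<omega> \<in> space M. Q {e \<in> D. X e \<omega>}} \<in> events" if "D \<subseteq> edge_pairs V" for Q D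
    using that finite_subset[OF that finite_edge_pairs[OF V]] Xm by (intro sets_random_set) auto
  \<comment> \<open>The vertex set shrinks to \<open>W - {i}\<close> at each stage while s keeps
    referring to all of V; the constant 1 / (1 - s) is therefore the same throughout the
    induction.\<close>
  have "finite W" using W V finite_subset by blast
  then have "prob {\<omega> \<in> space M. (i, j) \<in> (adj {e \<in> edge_pairs W. X e \<omega>})\<^sup>*} \<le> z i * z j * t / (1 - s)"
    using W ij
  proof (induction W arbitrary: i rule: finite_psubset_induct)
    case (psubset W)
    define D where "D = edge_pairs (W - {i})"
    have WV: "edge_pairs W \<subseteq> edge_pairs V" "D \<subseteq> edge_pairs V"
      using psubset.prems edge_pairs_mono[of W V] edge_pairs_mono[of "W - {i}" V] by (auto simp: D_def)
    define B where "B k = {\<omega> \<in> space M. X {i, k} \<omega> \<and> (k, j) \<in> (adj {e \<in> D. X e \<omega>})\<^sup>*}" for k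
    have D_eq: "D = {e \<in> edge_pairs W. i \<notin> e}" by (auto simp: D_def edge_pairs_def)
    have ik: "{i, k} \<in> edge_pairs V" if "k \<in> W - {i}" for k
      using psubset.prems that by (auto simp: edge_pairs_def)
    have B_ev: "B k \<in> events" if k: "k \<in> W - {i}" for k
    proof -
      have "{\<omega> \<in> space M. {i, k} \<in> {e \<in> edge_pairs V. X e \<omega>} \<and>
          (k, j) \<in> (adj {e \<in> D. e \<in> {e \<in> edge_pairs V. X e \<omega>}})\<^sup>*} \<in> events"
        by (rule ev[of "edge_pairs V" "\<lambda>S. {i, k} \<in> S \<and> (k, j) \<in> (adj {e \<in> D. e \<in> S})\<^sup>*"]) simp
      moreover have "{e \<in> D. e \<in> {e \<in> edge_pairs V. X e \<omega>}} = {e \<in> D. X e \<omega>}" for \<omega> using WV by auto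
      ultimately show ?thesis using ik[OF k] by (simp add: B_def)
    qed
    have "prob {\<omega> \<in> space M. (i, j) \<in> (adj {e \<in> edge_pairs W. X e \<omega>})\<^sup>*} \<le> prob (\<Union>k\<in>W - {i}. B k)"
    proof (rule finite_measure_mono)
      show "{\<omega> \<in> space M. (i, j) \<in> (adj {e \<in> edge_pairs W. X e \<omega>})\<^sup>*} \<subseteq> (\<Union>k\<in>W - {i}. B k)"
      proof
        fix \<omega> assume "\<omega> \<in> {\<omega> \<in> space M. (i, j) \<in> (adj {e \<in> edge_pairs W. X e \<omega>})\<^sup>*}"
        then have \<omega>: "\<omega> \<in> space M" "(i, j) \<in> (adj {e \<in> edge_pairs W. X e \<omega>})\<^sup>*" by auto
        obtain k where k: "k \<in> W - {i}" "{i, k} \<in> {e \<in> edge_pairs W. X e \<omega>}"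
          "(k, j) \<in> (adj {e \<in> {e \<in> edge_pairs W. X e \<omega>}. i \<notin> e})\<^sup>*"
          by (rule joined_first_step[OF _ \<omega>(2) psubset.prems(4)]) auto
        have "{e \<in> {e \<in> edge_pairs W. X e \<omega>}. i \<notin> e} = {e \<in> D. X e \<omega>}" by (auto simp: D_eq)
        then have "\<omega> \<in> B k" using k \<omega> by (simp add: B_def)
        then show "\<omega> \<in> (\<Union>k\<in>W - {i}. B k)" using k by blast
      qed
      show "(\<Union>k\<in>W - {i}. B k) \<in> events" using B_ev psubset.hyps by (intro sets.finite_UN) auto
    qed
    also have "\<dots> \<le> (\<Sum>k\<in>W - {i}. prob (B k))"
      using B_ev psubset.hyps by (intro finite_measure_subadditive_finite) auto
    \<comment> \<open>The term k = j is the direct edge, after which nothing remains to be joined;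
      the other terms come from the induction hypothesis. The sum is bounded through 1 + s / (1 -
      s), which is again 1 / (1 - s).\<close>
    also have "\<dots> \<le> (\<Sum>k\<in>W - {i}. z i * z j * t * ((if k = j then 1 else 0) + (z k)\<^sup>2 * t / (1 - s)))"
    proof (rule sum_mono)
      fix k assume k: "k \<in> W - {i}"
      have kV: "k \<in> V" "i \<in> V" "j \<in> V" using k psubset.prems by auto
      have "prob (B k) = prob {\<omega> \<in> space M. X {i, k} \<omega>} *
          prob {\<omega> \<in> space M. (k, j) \<in> (adj {e \<in> D. X e \<omega>})\<^sup>*}"
        unfolding B_def
        by (rule indep_event_random_set[OF ind ik[OF k], of D "\<lambda>S. (k, j) \<in> (adj S)\<^sup>*"])
          (use WV finite_subset[OF WV(2) finite_edge_pairs[OF V]] in \<open>auto simp: D_eq\<close>)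
      also have "\<dots> \<le> (z i * z k * t) * (if k = j then 1 else z k * z j * t / (1 - s))"
      proof (intro mult_mono)
        show "prob {\<omega> \<in> space M. X {i, k} \<omega>} \<le> z i * z k * t" using kV k by (intro p) auto
        show "prob {\<omega> \<in> space M. (k, j) \<in> (adj {e \<in> D. X e \<omega>})\<^sup>*}
          \<le> (if k = j then 1 else z k * z j * t / (1 - s))"
          using psubset.IH[of "W - {i}" k] psubset.prems k unfolding D_def by auto
      qed (use z kV t in auto)
      also have "\<dots> \<le> z i * z j * t * ((if k = j then 1 else 0) + (z k)\<^sup>2 * t / (1 - s))"
      proof (cases "k = j")
        case True
        have "0 \<le> z i * z j * t * ((z k)\<^sup>2 * t / (1 - s))" using z kV t s by simp
        then show ?thesis using True by (simp add: algebra_simps)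
      qed (simp add: power2_eq_square mult_ac)
      finally show "prob (B k) \<le> z i * z j * t * ((if k = j then 1 else 0) + (z k)\<^sup>2 * t / (1 - s))" .
    qed
    also have "\<dots> = z i * z j * t * (1 + (\<Sum>k\<in>W - {i}. (z k)\<^sup>2) * t / (1 - s))"
      using psubset.hyps psubset.prems
      by (simp add: sum_distrib_left[symmetric] sum.distrib sum_divide_distrib[symmetric]
          sum_distrib_right[symmetric])
    also have "\<dots> \<le> z i * z j * t * (1 + s / (1 - s))"
    proof (intro mult_left_mono add_left_mono divide_right_mono)
      have "(\<Sum>k\<in>W - {i}. (z k)\<^sup>2) \<le> (\<Sum>i\<in>V. (z i)\<^sup>2)" using psubset.prems V by (intro sum_mono2) auto
      then show "(\<Sum>k\<in>W - {i}. (z k)\<^sup>2) * t \<le> s" unfolding s_def using t by (rule mult_right_mono)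
      show "0 \<le> z i * z j * t"
        using psubset.prems t by (intro mult_nonneg_nonneg z) auto
    qed (use s in auto)
    also have "\<dots> = z i * z j * t / (1 - s)" using s by (simp add: field_simps)
    finally show ?case .
  qed
  then show ?thesis by (simp add: s_def)
qed

text \<open>The presence of an edge is independent of whether its ends are joined by the other
  edges. So it lies on a cycle with probability at most
  \<open>(z i * z j * t)\<^sup>2 / (1 - s)\<close>, and the sum of the numerators over all pairs
  factorises into the square of s.\<close>

lemma expectation_cycle_edges_le:
  fixes X :: "'v set \<Rightarrow> 'a \<Rightarrow> bool" and z :: "'v \<Rightarrow> real"
  assumes V: "finite V" and ind: "indep_vars (\<lambda>_. count_space UNIV) X (edge_pairs V)"
    and p: "\<And>i j. i \<in> V \<Longrightarrow> j \<in> V \<Longrightarrow> i \<noteq> j \<Longrightarrow> prob {\<omega> \<in> space M. X {i, j} \<omega>} \<le> z i * z j * t"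
    and z: "\<And>i. i \<in> V \<Longrightarrow> 0 \<le> z i" and t: "0 \<le> t" and sub: "(\<Sum>i\<in>V. (z i)\<^sup>2) * t < 1"
  defines "s \<equiv> (\<Sum>i\<in>V. (z i)\<^sup>2) * t"
  shows "(\<lambda>\<omega>. real (card (cycle_edges {e \<in> edge_pairs V. X e \<omega>}))) \<in> borel_measurable M"
    "expectation (\<lambda>\<omega>. real (card (cycle_edges {e \<in> edge_pairs V. X e \<omega>}))) \<le> s\<^sup>2 / (1 - s)"
proof -
  let ?E = "edge_pairs V" and ?G = "\<lambda>\<omega>. {e \<in> edge_pairs V. X e \<omega>}"
  have fin: "finite ?E" by (rule finite_edge_pairs[OF V])
  have Xm: "X e \<in> measurable M (count_space UNIV)" if "e \<in> ?E" for e
    using ind that by (simp add: indep_vars_def)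
  show "(\<lambda>\<omega>. real (card (cycle_edges (?G \<omega>)))) \<in> borel_measurable M"
    by (rule measurable_compose[OF measurable_random_set[OF fin Xm]]) auto
  have ev: "{\<omega> \<in> space M. Q (?G \<omega>)} \<in> events" for Q
    using Xm fin by (intro sets_random_set) auto
  have sum: "real (card (cycle_edges (?G \<omega>))) = (\<Sum>e\<in>?E. indicator {\<omega> \<in> space M. e \<in> cycle_edges (?G \<omega>)} \<omega>)"
    if "\<omega> \<in> space M" for \<omega>
  proof -
    have "cycle_edges (?G \<omega>) = {e \<in> ?E. e \<in> cycle_edges (?G \<omega>)}" by (auto simp: cycle_edges_def)
    then have "card (cycle_edges (?G \<omega>)) = (\<Sum>e\<in>?E. if e \<in> cycle_edges (?G \<omega>) then 1 else 0)"
      using fin by (subst sum.inter_filter[symmetric]) auto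
    then show ?thesis using that by (simp add: indicator_def of_bool_def of_nat_sum if_distrib cong: if_cong)
  qed
  have "expectation (\<lambda>\<omega>. real (card (cycle_edges (?G \<omega>)))) =
      expectation (\<lambda>\<omega>. \<Sum>e\<in>?E. indicator {\<omega> \<in> space M. e \<in> cycle_edges (?G \<omega>)} \<omega>)"
    by (rule Bochner_Integration.integral_cong) (use sum in auto)
  also have "\<dots> = (\<Sum>e\<in>?E. prob {\<omega> \<in> space M. e \<in> cycle_edges (?G \<omega>)})"
  proof -
    have ev': "{\<omega> \<in> space M. e \<in> cycle_edges (?G \<omega>)} \<in> events" for e
      by (rule ev[of "\<lambda>S. e \<in> cycle_edges S"])
    have "integrable M (indicator {\<omega> \<in> space M. e \<in> cycle_edges (?G \<omega>)} :: 'a \<Rightarrow> real)" for e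
      by (rule integrable_real_indicator[OF ev']) (simp add: emeasure_eq_measure)
    then show ?thesis using sets.sets_into_space[OF ev']
      by (subst Bochner_Integration.integral_sum) (auto simp: Int_absorb1 Int_commute)
  qed
  also have "\<dots> \<le> (\<Sum>e\<in>?E. (\<lambda>e. (\<Prod>i\<in>e. z i)\<^sup>2 * t\<^sup>2 / (1 - s)) e)"
  proof (rule sum_mono)
    fix e assume "e \<in> ?E"
    then obtain i j where e: "e = {i, j}" "i \<in> V" "j \<in> V" "i \<noteq> j" by (auto simp: edge_pairs_def)
    let ?Q = "\<lambda>\<omega>. (i, j) \<in> (adj {d \<in> ?E - {e}. X d \<omega>})\<^sup>*"
    have "prob {\<omega> \<in> space M. e \<in> cycle_edges (?G \<omega>)} = prob {\<omega> \<in> space M. X e \<omega> \<and> ?Q \<omega>}"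
    proof (rule arg_cong[where f = prob], rule Collect_cong, rule conj_cong[OF refl])
      fix \<omega>
      have "?G \<omega> - {e} = {d \<in> ?E - {e}. X d \<omega>}" by auto
      then show "e \<in> cycle_edges (?G \<omega>) \<longleftrightarrow> X e \<omega> \<and> ?Q \<omega>"
        using e \<open>e \<in> ?E\<close> unfolding cycle_edges_def
        by (auto simp: doubleton_eq_iff intro: sym_adj_rtrancl)
    qed
    also have "\<dots> = prob {\<omega> \<in> space M. X e \<omega>} * prob {\<omega> \<in> space M. ?Q \<omega>}"
      by (rule indep_event_random_set[OF ind \<open>e \<in> ?E\<close>, of "?E - {e}" "\<lambda>S. (i, j) \<in> (adj S)\<^sup>*"])
        (use fin in auto)
    also have "\<dots> \<le> (z i * z j * t) * (z i * z j * t / (1 - s))"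
    proof (intro mult_mono)
      show "prob {\<omega> \<in> space M. X e \<omega>} \<le> z i * z j * t" using p e by simp
      have "prob {\<omega> \<in> space M. ?Q \<omega>} \<le> prob {\<omega> \<in> space M. (i, j) \<in> (adj (?G \<omega>))\<^sup>*}"
      proof (rule finite_measure_mono)
        show "{\<omega> \<in> space M. ?Q \<omega>} \<subseteq> {\<omega> \<in> space M. (i, j) \<in> (adj (?G \<omega>))\<^sup>*}"
        proof (intro Collect_mono impI conjI; elim conjE)
          fix \<omega> assume "?Q \<omega>"
          then show "(i, j) \<in> (adj (?G \<omega>))\<^sup>*"
            using adj_rtrancl_mono[of "{d \<in> ?E - {e}. X d \<omega>}" "?G \<omega>"] by blast
        qed
      qed (rule ev)
      also have "\<dots> \<le> z i * z j * t / (1 - s)"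
        unfolding s_def by (rule prob_joined_le[OF V ind p z t sub]) (use e in auto)
      finally show "prob {\<omega> \<in> space M. ?Q \<omega>} \<le> z i * z j * t / (1 - s)" .
    qed (use z e t in auto)
    also have "\<dots> = (\<Prod>i\<in>e. z i)\<^sup>2 * t\<^sup>2 / (1 - s)" using e by (simp add: power2_eq_square)
    finally show "prob {\<omega> \<in> space M. e \<in> cycle_edges (?G \<omega>)} \<le> (\<lambda>e. (\<Prod>i\<in>e. z i)\<^sup>2 * t\<^sup>2 / (1 - s)) e" by simp
  qed
  \<comment> \<open>Ordered pairs cover every edge, and the diagonal only adds non-negative terms;
    over the full product set the sum factorises.\<close>
  also have "\<dots> \<le> (\<Sum>(i, j)\<in>V \<times> V. (z i)\<^sup>2 * (z j)\<^sup>2 * t\<^sup>2 / (1 - s))"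
  proof -
    have s1: "s < 1" using sub by (simp add: s_def)
    let ?P = "{(i, j) \<in> V \<times> V. i \<noteq> j}"
    have finP: "finite ?P" by (rule finite_subset[of _ "V \<times> V"]) (use V in auto)
    have "(\<Sum>e\<in>?E. (\<lambda>e. (\<Prod>i\<in>e. z i)\<^sup>2 * t\<^sup>2 / (1 - s)) e)
        \<le> (\<Sum>x\<in>?P. ((\<lambda>e. (\<Prod>i\<in>e. z i)\<^sup>2 * t\<^sup>2 / (1 - s)) \<circ> (\<lambda>(i, j). {i, j})) x)"
      unfolding edge_pairs_image using finP s1 by (intro sum_image_le) auto
    also have "\<dots> = (\<Sum>(i, j)\<in>?P. (z i)\<^sup>2 * (z j)\<^sup>2 * t\<^sup>2 / (1 - s))"
      by (rule sum.cong) (auto simp: power_mult_distrib)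
    also have "\<dots> \<le> (\<Sum>(i, j)\<in>V \<times> V. (z i)\<^sup>2 * (z j)\<^sup>2 * t\<^sup>2 / (1 - s))"
      using V s1 by (intro sum_mono2) auto
    finally show ?thesis .
  qed
  also have "\<dots> = s\<^sup>2 / (1 - s)"
  proof -
    have "(\<Sum>(i, j)\<in>V \<times> V. (z i)\<^sup>2 * (z j)\<^sup>2 * t\<^sup>2 / (1 - s)) =
        (\<Sum>i\<in>V. \<Sum>j\<in>V. (z i)\<^sup>2 * (z j)\<^sup>2) * t\<^sup>2 / (1 - s)"
      by (simp add: sum.cartesian_product sum_distrib_right sum_divide_distrib case_prod_unfold)
    moreover have "(\<Sum>i\<in>V. \<Sum>j\<in>V. (z i)\<^sup>2 * (z j)\<^sup>2) = (\<Sum>i\<in>V. (z i)\<^sup>2)\<^sup>2"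
      by (simp add: power2_eq_square[of "\<Sum>i\<in>V. (z i)\<^sup>2"] sum_product)
    ultimately show ?thesis by (simp only: s_def power_mult_distrib)
  qed
  finally show "expectation (\<lambda>\<omega>. real (card (cycle_edges (?G \<omega>)))) \<le> s\<^sup>2 / (1 - s)" .
qed

end

section \<open>Weak convergence from characteristic functions\<close>

text \<open>Real trigonometric polynomials in finitely many coordinates. The phase c provides the
  sines, so that a product of two generators is again a linear combination of generators.\<close>

inductive_set trig_span :: "((nat \<Rightarrow> real) \<Rightarrow> real) set" where
  cos: "(\<lambda>a. cos ((\<Sum>j<k. \<theta> j * a j) + c)) \<in> trig_span"
| add: "f \<in> trig_span \<Longrightarrow> g \<in> trig_span \<Longrightarrow> (\<lambda>a. f a + g a) \<in> trig_span"
| scale: "f \<in> trig_span \<Longrightarrow> (\<lambda>a. r * f a) \<in> trig_span"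

lemma trig_span_cos_mult_cos:
  fixes k m :: nat and \<theta> \<eta> :: "nat \<Rightarrow> real" and c d :: real
  shows "(\<lambda>a. cos ((\<Sum>j<k. \<theta> j * a j) + c) * cos ((\<Sum>j<m. \<eta> j * a j) + d)) \<in> trig_span"
proof -
  \<comment> \<open>The frequencies are padded with zeros to a common length, so that they can be
    added and subtracted.\<close>
  define K where "K = max k m"
  define \<theta>' where "\<theta>' j = (if j < k then \<theta> j else 0)" for j
  define \<eta>' where "\<eta>' j = (if j < m then \<eta> j else 0)" for j
  have extend: "(\<Sum>j<k. \<theta> j * a j) = (\<Sum>j<K. \<theta>' j * a j)" "(\<Sum>j<m. \<eta> j * a j) = (\<Sum>j<K. \<eta>' j * a j)" for a
    by (auto simp: \<theta>'_def \<eta>'_def K_def intro!: sum.mono_neutral_cong_left split: if_splits)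
  have "(\<lambda>a. cos ((\<Sum>j<k. \<theta> j * a j) + c) * cos ((\<Sum>j<m. \<eta> j * a j) + d)) =
    (\<lambda>a. (1 / 2) * (cos ((\<Sum>j<K. (\<theta>' j - \<eta>' j) * a j) + (c - d)) +
        cos ((\<Sum>j<K. (\<theta>' j + \<eta>' j) * a j) + (c + d))))"
    unfolding extend
    by (rule ext, subst cos_times_cos)
       (simp add: left_diff_distrib distrib_right sum_subtractf sum.distrib algebra_simps)
  also have "\<dots> \<in> trig_span" by (intro trig_span.intros)
  finally show ?thesis .
qed

lemma trig_span_mult:
  assumes "f \<in> trig_span" "g \<in> trig_span"
  shows "(\<lambda>a. f a * g a) \<in> trig_span"
  using assms(1)
proof induction
  case (cos \<theta> k c)
  from assms(2) show ?case
  proof induction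
    case (cos \<eta> m d)
    show ?case by (rule trig_span_cos_mult_cos)
  next
    case (add g h)
    then show ?case by (simp add: distrib_left trig_span.add)
  next
    case (scale g r)
    then show ?case using trig_span.scale[OF scale.IH, of r] by (simp add: mult.left_commute)
  qed
next
  case (add f h)
  then show ?case by (simp add: distrib_right trig_span.add)
next
  case (scale f r)
  then show ?case using trig_span.scale[OF scale.IH, of r] by (simp add: mult.assoc)
qed

lemma trig_span_bounded_measurable:
  assumes "f \<in> trig_span"
  shows "f \<in> borel_measurable borel" "\<exists>C. \<forall>a. \<bar>f a\<bar> \<le> C"
proof -
  have "f \<in> borel_measurable borel \<and> (\<exists>C. \<forall>a. \<bar>f a\<bar> \<le> C)"
    using assms
  proof induction
    case (cos \<theta> k c)
    have "(\<lambda>a. cos ((\<Sum>j<k. \<theta> j * a j) + c)) \<in> borel_measurable borel"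
      by (intro borel_measurable_continuous_onI continuous_intros continuous_on_product_coordinates)
    then show ?case by (auto intro!: exI[of _ 1])
  next
    case (add f g)
    then obtain C D where "\<forall>a. \<bar>f a\<bar> \<le> C" "\<forall>a. \<bar>g a\<bar> \<le> D" by auto
    then have "\<forall>a. \<bar>f a + g a\<bar> \<le> C + D" by (metis abs_triangle_ineq add_mono order_trans)
    then show ?case using add by auto
  next
    case (scale f r)
    then obtain C where "\<forall>a. \<bar>f a\<bar> \<le> C" by auto
    then have "\<forall>a. \<bar>r * f a\<bar> \<le> \<bar>r\<bar> * C" by (simp add: abs_mult mult_left_mono)
    then show ?case using scale by auto
  qed
  then show "f \<in> borel_measurable borel" "\<exists>C. \<forall>a. \<bar>f a\<bar> \<le> C" by auto
qed

text \<open>The functions of \<open>y\<close> that become trigonometric polynomials of \<open>a\<close> when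
  \<open>y j = sin (a j / R)\<close> is substituted form an algebra on the cube that separates points.\<close>

lemma uniform_trig_approx:
  fixes h :: "(nat \<Rightarrow> real) \<Rightarrow> real"
  assumes h: "continuous_on UNIV h" and e: "0 < e"
  obtains f where "f \<in> trig_span" "\<And>a. \<bar>h (\<lambda>j. sin (a j / R)) - f a\<bar> < e"
proof -
  define S where "S = (UNIV \<rightarrow> {-1..1} :: (nat \<Rightarrow> real) set)"
  define A where "A = {g. continuous_on S g \<and> (\<lambda>a. g (\<lambda>j. sin (a j / R))) \<in> trig_span}"
  have const: "(\<lambda>_. c) \<in> trig_span" for c
    using trig_span.scale[OF trig_span.cos[of undefined 0 0], of c] by simp
  have coord: "(\<lambda>a. sin (a j / R)) \<in> trig_span" for j
  proof -
    have "(\<lambda>a. cos ((\<Sum>i<Suc j. (if i = j then 1 / R else 0) * a i) + (- pi / 2))) \<in> trig_span"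
      by (rule trig_span.cos)
    moreover have "(\<Sum>i<Suc j. (if i = j then 1 / R else 0) * a i) = a j / R" for a
      by (simp add: if_distrib[of "\<lambda>x. x * _"] cong: if_cong)
    moreover have "cos (x + (- pi / 2)) = sin x" for x by (simp add: cos_diff)
    ultimately show ?thesis by (simp only:)
  qed
  \<comment> \<open>The cube has one factor for every natural number. It is compact by Tychonoff's
    theorem, so Stone-Weierstrass treats all coordinates at once.\<close>
  interpret function_ring_on A S
  proof
    have "compactin (product_topology (\<lambda>_. euclideanreal) UNIV) (PiE UNIV (\<lambda>_. {-1..1}))"
      by (subst compactin_PiE) auto
    then show "compact S" by (simp add: S_def PiE_UNIV_domain euclidean_product_topology compactin_euclidean_iff)
    show "(\<lambda>x. f x + g x) \<in> A" if "f \<in> A" "g \<in> A" for f g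
      using that by (auto simp: A_def intro: continuous_intros trig_span.add)
    show "(\<lambda>x. f x * g x) \<in> A" if "f \<in> A" "g \<in> A" for f g
      using that by (auto simp: A_def intro: continuous_intros trig_span_mult)
    show "(\<lambda>_. c) \<in> A" for c by (simp add: A_def const)
    show "\<exists>f\<in>A. f x \<noteq> f y" if "x \<noteq> y" for x y
    proof -
      obtain j where "x j \<noteq> y j" using \<open>x \<noteq> y\<close> by (auto simp: fun_eq_iff)
      moreover have "continuous_on S (\<lambda>v. v j)"
        by (rule continuous_on_subset[OF continuous_on_product_coordinates]) simp
      then have "(\<lambda>v. v j) \<in> A" by (simp add: A_def coord)
      ultimately show ?thesis by (intro bexI[of _ "\<lambda>v. v j"])
    qed
  qed (simp add: A_def)
  obtain g where g: "g \<in> A" "\<forall>x\<in>S. \<bar>h x - g x\<bar> < e"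
    using Stone_Weierstrass_basic[OF continuous_on_subset[OF h] e] by auto
  show ?thesis
  proof (rule that[of "\<lambda>a. g (\<lambda>j. sin (a j / R))"])
    show "(\<lambda>a. g (\<lambda>j. sin (a j / R))) \<in> trig_span" using g by (simp add: A_def)
    show "\<bar>h (\<lambda>j. sin (a j / R)) - g (\<lambda>j. sin (a j / R))\<bar> < e" for a
      using g by (simp add: S_def Pi_iff)
  qed
qed

text \<open>The error is stated as a square because second moments are what
  \<open>weak_convergence_trig\<close> has at its disposal.\<close>

lemma abs_diff_sin_le: "\<bar>y - sin y\<bar> \<le> y\<^sup>2" for y :: real
proof -
  have "\<bar>sin y - y\<bar> \<le> y\<^sup>2 / 2"
    using Maclaurin_sin_bound[of y 2] by (simp add: numeral_2_eq_2 sin_coeff_def)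
  then have "\<bar>y - sin y\<bar> \<le> y\<^sup>2 / 2" by (simp only: abs_minus_commute)
  then show ?thesis using abs_ge_zero[of "y - sin y"] by linarith
qed

lemma abs_diff_scaled_sin_le: "0 < R \<Longrightarrow> \<bar>a - R * sin (a / R)\<bar> \<le> a\<^sup>2 / R" for a R :: real
proof -
  assume R: "0 < R"
  have "\<bar>a - R * sin (a / R)\<bar> = R * \<bar>a / R - sin (a / R)\<bar>"
  proof -
    have "a - R * sin (a / R) = R * (a / R - sin (a / R))" using R by (simp add: right_diff_distrib)
    then show ?thesis using R by (simp only: abs_mult abs_of_pos)
  qed
  also have "\<dots> \<le> R * (a / R)\<^sup>2" using R abs_diff_sin_le by (intro mult_left_mono) auto
  also have "\<dots> = a\<^sup>2 / R" using R by (simp add: power2_eq_square)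
  finally show ?thesis .
qed

lemma coordinate_lipschitz_continuous:
  fixes g :: "(nat \<Rightarrow> real) \<Rightarrow> real"
  assumes "\<And>a b. \<bar>g a - g b\<bar> \<le> L * (\<Sum>j<m. \<bar>a j - b j\<bar>)"
  shows "continuous_on UNIV g"
  unfolding continuous_on_def
proof
  fix a :: "nat \<Rightarrow> real"
  have "((\<lambda>b. b j) \<longlongrightarrow> a j) (at a)" for j
    using continuous_on_product_coordinates[of j] unfolding continuous_on_def by blast
  then have "((\<lambda>b. L * (\<Sum>j<m. \<bar>b j - a j\<bar>)) \<longlongrightarrow> L * (\<Sum>j<m. \<bar>a j - a j\<bar>)) (at a)"
    by (intro tendsto_intros)
  then have "((\<lambda>b. L * (\<Sum>j<m. \<bar>b j - a j\<bar>)) \<longlongrightarrow> 0) (at a)" by simp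
  then have "((\<lambda>b. g b - g a) \<longlongrightarrow> 0) (at a)"
    by (rule Lim_null_comparison[rotated]) (use assms in simp)
  then show "(g \<longlongrightarrow> g a) (at a)" by (simp add: LIM_zero_iff)
qed

section \<open>From trigonometric polynomials to bounded Lipschitz functions\<close>

lemma trig_span_convergence:
  fixes V :: "nat \<Rightarrow> 'w \<Rightarrow> nat \<Rightarrow> real" and W :: "'v \<Rightarrow> nat \<Rightarrow> real"
  assumes P: "\<And>n. prob_space (P n)" and Q: "prob_space Q"
    and V: "\<forall>\<^sub>F n in sequentially. V n \<in> measurable (P n) borel" and W: "W \<in> measurable Q borel"
    and cos: "\<And>k \<theta> c. (\<lambda>n. \<integral>\<omega>. cos ((\<Sum>j<k. \<theta> j * V n \<omega> j) + c) \<partial>P n) \<longlonglongrightarrow>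
       (\<integral>\<omega>. cos ((\<Sum>j<k. \<theta> j * W \<omega> j) + c) \<partial>Q)"
    and f: "f \<in> trig_span"
  shows "(\<lambda>n. \<integral>\<omega>. f (V n \<omega>) \<partial>P n) \<longlonglongrightarrow> (\<integral>\<omega>. f (W \<omega>) \<partial>Q)"
proof -
  interpret Q: prob_space Q by (rule Q)
  have intV: "\<forall>\<^sub>F n in sequentially. integrable (P n) (\<lambda>\<omega>. f (V n \<omega>))" if f: "f \<in> trig_span" for f
    using V
  proof eventually_elim
    case (elim n)
    interpret prob_space "P n" by (rule P)
    obtain C where "\<forall>a. \<bar>f a\<bar> \<le> C" using trig_span_bounded_measurable[OF f] by auto
    then show ?case
      using measurable_compose[OF elim trig_span_bounded_measurable(1)[OF f]]
      by (intro integrable_const_bound[where B = C]) auto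
  qed
  have intW: "integrable Q (\<lambda>\<omega>. f (W \<omega>))" if f: "f \<in> trig_span" for f
  proof -
    obtain C where "\<forall>a. \<bar>f a\<bar> \<le> C" using trig_span_bounded_measurable[OF f] by auto
    then show ?thesis
      using measurable_compose[OF W trig_span_bounded_measurable(1)[OF f]]
      by (intro Q.integrable_const_bound[where B = C]) auto
  qed
  show ?thesis using f
  proof induction
    case (cos \<theta> k c)
    show ?case by (rule assms(5))
  next
    case (add f g)
    have "\<forall>\<^sub>F n in sequentially. (\<integral>\<omega>. f (V n \<omega>) \<partial>P n) + (\<integral>\<omega>. g (V n \<omega>) \<partial>P n) =
        (\<integral>\<omega>. f (V n \<omega>) + g (V n \<omega>) \<partial>P n)"
      using intV[OF add.hyps(1)] intV[OF add.hyps(2)] by eventually_elim simp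
    from Lim_transform_eventually[OF tendsto_add[OF add.IH] this]
    show ?case using intW add.hyps by simp
  next
    case (scale f r)
    show ?case using tendsto_mult_left[OF scale.IH, of r] by simp
  qed
qed

text \<open>No tightness argument is needed to pass from characteristic functions to weak convergence:
  replacing every coordinate \<open>a\<close> by \<open>R sin (a / R)\<close> costs at most \<open>a\<^sup>2 / R\<close>.\<close>

lemma weak_convergence_trig:
  fixes V :: "nat \<Rightarrow> 'w \<Rightarrow> nat \<Rightarrow> real" and W :: "'v \<Rightarrow> nat \<Rightarrow> real"
  assumes P: "\<And>n. prob_space (P n)" and Q: "prob_space Q"
    and V: "\<forall>\<^sub>F n in sequentially. V n \<in> measurable (P n) borel" and W: "W \<in> measurable Q borel"
    and cos: "\<And>k \<theta> c. (\<lambda>n. \<integral>\<omega>. cos ((\<Sum>j<k. \<theta> j * V n \<omega> j) + c) \<partial>P n) \<longlonglongrightarrow>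
       (\<integral>\<omega>. cos ((\<Sum>j<k. \<theta> j * W \<omega> j) + c) \<partial>Q)"
    and mom: "\<forall>\<^sub>F n in sequentially. \<forall>j<m. integrable (P n) (\<lambda>\<omega>. (V n \<omega> j)\<^sup>2) \<and>
       (\<integral>\<omega>. (V n \<omega> j)\<^sup>2 \<partial>P n) \<le> D"
    and C: "\<And>a. \<bar>g a\<bar> \<le> C" and L: "0 \<le> L" "\<And>a b. \<bar>g a - g b\<bar> \<le> L * (\<Sum>j<m. \<bar>a j - b j\<bar>)"
  shows "(\<lambda>n. \<integral>\<omega>. g (V n \<omega>) \<partial>P n) \<longlonglongrightarrow> (\<integral>\<omega>. g (W \<omega>) \<partial>Q)"
proof (rule LIMSEQ_I)
  interpret Q: prob_space Q by (rule Q)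
  fix e :: real assume e: "0 < e"
  define G where "G k a = g (\<lambda>j. real (Suc k) * sin (a j / real (Suc k)))" for k a
  have G_diff: "\<bar>g a - G k a\<bar> \<le> L * (\<Sum>j<m. (a j)\<^sup>2) / real (Suc k)" for k a
  proof -
    have "\<bar>g a - G k a\<bar> \<le> L * (\<Sum>j<m. \<bar>a j - real (Suc k) * sin (a j / real (Suc k))\<bar>)"
      unfolding G_def by (rule L(2))
    also have "\<dots> \<le> L * (\<Sum>j<m. (a j)\<^sup>2 / real (Suc k))"
      by (intro mult_left_mono L(1) sum_mono abs_diff_scaled_sin_le) simp
    finally show ?thesis by (simp add: sum_divide_distrib[symmetric])
  qed
  have gm: "g \<in> borel_measurable borel"
    by (intro borel_measurable_continuous_onI coordinate_lipschitz_continuous[OF L(2)])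
  have sc: "continuous_on UNIV (\<lambda>y. g (\<lambda>j. real (Suc k) * y j))" for k
  proof (rule coordinate_lipschitz_continuous)
    fix a b :: "nat \<Rightarrow> real"
    have "\<bar>g (\<lambda>j. real (Suc k) * a j) - g (\<lambda>j. real (Suc k) * b j)\<bar>
        \<le> L * (\<Sum>j<m. \<bar>real (Suc k) * a j - real (Suc k) * b j\<bar>)" by (rule L(2))
    also have "\<dots> = L * real (Suc k) * (\<Sum>j<m. \<bar>a j - b j\<bar>)"
      by (simp only: right_diff_distrib[symmetric] abs_mult abs_of_nat sum_distrib_left[symmetric] mult.assoc)
    finally show "\<bar>g (\<lambda>j. real (Suc k) * a j) - g (\<lambda>j. real (Suc k) * b j)\<bar>
        \<le> L * real (Suc k) * (\<Sum>j<m. \<bar>a j - b j\<bar>)" .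
  qed
  have Gm: "G k \<in> borel_measurable borel" for k
  proof -
    have "(\<lambda>(a :: nat \<Rightarrow> real) j. sin (a j / real (Suc k))) \<in> measurable borel borel"
      by (intro measurable_coordinatewise_then_product borel_measurable_continuous_onI
          continuous_intros continuous_on_product_coordinates) auto
    from measurable_compose[OF this borel_measurable_continuous_onI[OF sc[of k]]]
    show ?thesis unfolding G_def[abs_def] .
  qed
  have GC: "\<bar>G k a\<bar> \<le> C" for k a unfolding G_def by (rule C)
  \<comment> \<open>Under Q the cost of the substitution vanishes by dominated convergence. Under
    \<open>P n\<close> it must be uniform in n, which is what the moment bound achieves.
    Approximating \<open>G k\<close> by a trigonometric polynomial under both measures, and the
    convergence for that polynomial, complete the five errors of size e / 5.\<close>
  have "(\<lambda>k. \<integral>\<omega>. G k (W \<omega>) \<partial>Q) \<longlonglongrightarrow> (\<integral>\<omega>. g (W \<omega>) \<partial>Q)"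
  proof (rule integral_dominated_convergence[where w = "\<lambda>_. C"])
    have "(\<lambda>k. G k a) \<longlonglongrightarrow> g a" for a
    proof -
      have "(\<lambda>k. L * (\<Sum>j<m. (a j)\<^sup>2) / real (Suc k)) \<longlonglongrightarrow> 0"
        by (rule LIMSEQ_Suc) (rule lim_const_over_n)
      then have "(\<lambda>k. g a - G k a) \<longlonglongrightarrow> 0"
        by (rule Lim_null_comparison[rotated]) (use G_diff in simp)
      from tendsto_diff[OF tendsto_const[of "g a"] this] show ?thesis by simp
    qed
    then show "AE \<omega> in Q. (\<lambda>k. G k (W \<omega>)) \<longlonglongrightarrow> g (W \<omega>)" by simp
  qed (use measurable_compose[OF W Gm] measurable_compose[OF W gm] GC in auto)
  then have "\<forall>\<^sub>F k in sequentially. \<bar>(\<integral>\<omega>. G k (W \<omega>) \<partial>Q) - (\<integral>\<omega>. g (W \<omega>) \<partial>Q)\<bar> < e / 5"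
    using e by (auto dest!: tendstoD[where e = "e / 5"] simp: dist_real_def)
  moreover have "\<forall>\<^sub>F k in sequentially. L * (real m * D) / real (Suc k) < e / 5"
    by (rule order_tendstoD(2)[OF LIMSEQ_Suc[OF lim_const_over_n]]) (use e in simp)
  ultimately have "\<forall>\<^sub>F k in sequentially. \<bar>(\<integral>\<omega>. G k (W \<omega>) \<partial>Q) - (\<integral>\<omega>. g (W \<omega>) \<partial>Q)\<bar> < e / 5 \<and>
      L * (real m * D) / real (Suc k) < e / 5" by (rule eventually_conj)
  then obtain k where k1: "\<bar>(\<integral>\<omega>. G k (W \<omega>) \<partial>Q) - (\<integral>\<omega>. g (W \<omega>) \<partial>Q)\<bar> < e / 5"
    and k2: "L * (real m * D) / real (Suc k) < e / 5"
    using eventually_happens'[OF sequentially_bot] by blast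
  obtain f where f: "f \<in> trig_span"
    and fG: "\<And>a. \<bar>(\<lambda>y. g (\<lambda>j. real (Suc k) * y j)) (\<lambda>j. sin (a j / real (Suc k))) - f a\<bar> < e / 5"
    by (rule uniform_trig_approx[OF sc, of "e / 5" k "real (Suc k)"]) (use e in auto)
  have fG: "\<bar>G k a - f a\<bar> \<le> e / 5" for a using fG[of a] by (simp add: G_def)
  obtain Cf where Cf: "\<And>a. \<bar>f a\<bar> \<le> Cf" using trig_span_bounded_measurable(2)[OF f] by auto
  have fm: "f \<in> borel_measurable borel" by (rule trig_span_bounded_measurable(1)[OF f])
  have int_close: "\<bar>(\<integral>\<omega>. G k (X \<omega>) \<partial>N) - (\<integral>\<omega>. f (X \<omega>) \<partial>N)\<bar> \<le> e / 5"
    if N: "prob_space N" and X: "X \<in> measurable N borel" for N :: "'z measure" and X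
  proof -
    interpret N: prob_space N by (rule N)
    have i: "integrable N (\<lambda>\<omega>. G k (X \<omega>))" "integrable N (\<lambda>\<omega>. f (X \<omega>))"
      by (rule N.integrable_const_bound[where B = C], use measurable_compose[OF X Gm] GC in simp_all)
        (rule N.integrable_const_bound[where B = Cf], use measurable_compose[OF X fm] Cf in simp_all)
    have "\<bar>(\<integral>\<omega>. G k (X \<omega>) \<partial>N) - (\<integral>\<omega>. f (X \<omega>) \<partial>N)\<bar> = \<bar>\<integral>\<omega>. G k (X \<omega>) - f (X \<omega>) \<partial>N\<bar>" using i by simp
    also have "\<dots> \<le> (\<integral>\<omega>. \<bar>G k (X \<omega>) - f (X \<omega>)\<bar> \<partial>N)" by (rule integral_abs_bound)
    also have "\<dots> \<le> (\<integral>\<omega>. e / 5 \<partial>N)" using i fG by (intro integral_mono) auto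
    finally show ?thesis by (simp add: N.prob_space)
  qed
  have "\<forall>\<^sub>F n in sequentially. \<bar>(\<integral>\<omega>. f (V n \<omega>) \<partial>P n) - (\<integral>\<omega>. f (W \<omega>) \<partial>Q)\<bar> < e / 5"
    using tendstoD[OF trig_span_convergence[OF P Q V W cos f], of "e / 5"] e by (simp add: dist_real_def)
  with V mom have "\<forall>\<^sub>F n in sequentially. norm ((\<integral>\<omega>. g (V n \<omega>) \<partial>P n) - (\<integral>\<omega>. g (W \<omega>) \<partial>Q)) < e"
  proof eventually_elim
    case (elim n)
    interpret prob_space "P n" by (rule P)
    have i: "integrable (P n) (\<lambda>\<omega>. G k (V n \<omega>))" "integrable (P n) (\<lambda>\<omega>. g (V n \<omega>))"
      using measurable_compose[OF elim(1) Gm] measurable_compose[OF elim(1) gm] GC C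
      by (auto intro!: integrable_const_bound[where B = C])
    have "\<bar>(\<integral>\<omega>. g (V n \<omega>) \<partial>P n) - (\<integral>\<omega>. G k (V n \<omega>) \<partial>P n)\<bar> = \<bar>\<integral>\<omega>. g (V n \<omega>) - G k (V n \<omega>) \<partial>P n\<bar>"
      using i by simp
    also have "\<dots> \<le> (\<integral>\<omega>. \<bar>g (V n \<omega>) - G k (V n \<omega>)\<bar> \<partial>P n)" by (rule integral_abs_bound)
    also have "\<dots> \<le> (\<integral>\<omega>. L * (\<Sum>j<m. (V n \<omega> j)\<^sup>2) / real (Suc k) \<partial>P n)"
    proof (rule integral_mono)
      have "integrable (P n) (\<lambda>\<omega>. \<Sum>j<m. (V n \<omega> j)\<^sup>2)"
        using elim(2) by (intro Bochner_Integration.integrable_sum) auto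
      then show "integrable (P n) (\<lambda>\<omega>. L * (\<Sum>j<m. (V n \<omega> j)\<^sup>2) / real (Suc k))"
        by (intro integrable_divide integrable_mult_right) simp
    qed (use i G_diff in auto)
    also have "\<dots> = L * (\<Sum>j<m. \<integral>\<omega>. (V n \<omega> j)\<^sup>2 \<partial>P n) / real (Suc k)"
      using elim(2) by (simp add: Bochner_Integration.integral_sum)
    also have "\<dots> \<le> L * (\<Sum>j<m. D) / real (Suc k)"
      using elim(2) L(1) by (intro divide_right_mono mult_left_mono sum_mono) auto
    also have "\<dots> < e / 5" using k2 by simp
    finally have "\<bar>(\<integral>\<omega>. g (V n \<omega>) \<partial>P n) - (\<integral>\<omega>. G k (V n \<omega>) \<partial>P n)\<bar> < e / 5" .
    moreover have "\<bar>(\<integral>\<omega>. G k (V n \<omega>) \<partial>P n) - (\<integral>\<omega>. f (V n \<omega>) \<partial>P n)\<bar> \<le> e / 5"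
      by (rule int_close[OF P elim(1)])
    moreover have "\<bar>(\<integral>\<omega>. G k (W \<omega>) \<partial>Q) - (\<integral>\<omega>. f (W \<omega>) \<partial>Q)\<bar> \<le> e / 5"
      by (rule int_close[OF Q W])
    ultimately show ?case using elim(3) k1 unfolding real_norm_def by linarith
  qed
  then show "\<exists>no. \<forall>n\<ge>no. norm ((\<integral>\<omega>. g (V n \<omega>) \<partial>P n) - (\<integral>\<omega>. g (W \<omega>) \<partial>Q)) < e"
    by (simp add: eventually_sequentially)
qed

section \<open>Moments, characteristic functions and chaining\<close>

context prob_space
begin

lemma integrable_bounded:
  fixes f :: "'a \<Rightarrow> 'b::{banach, second_countable_topology}"
  assumes "f \<in> borel_measurable M" "\<And>\<omega>. \<omega> \<in> space M \<Longrightarrow> norm (f \<omega>) \<le> C"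
  shows "integrable M f"
  using assms by (intro integrable_const_bound[where B = C]) (auto intro: AE_I2)

lemma indep_bounded_moments:
  fixes X S :: "'a \<Rightarrow> real"
  assumes ind: "indep_var borel X borel S"
    and X: "\<And>\<omega>. \<omega> \<in> space M \<Longrightarrow> \<bar>X \<omega>\<bar> \<le> a" and S: "\<And>\<omega>. \<omega> \<in> space M \<Longrightarrow> \<bar>S \<omega>\<bar> \<le> b"
  shows "integrable M (\<lambda>\<omega>. X \<omega> ^ m * S \<omega> ^ k)"
    "expectation (\<lambda>\<omega>. X \<omega> ^ m * S \<omega> ^ k) = expectation (\<lambda>\<omega>. X \<omega> ^ m) * expectation (\<lambda>\<omega>. S \<omega> ^ k)"
proof -
  have rv [measurable]: "X \<in> borel_measurable M" "S \<in> borel_measurable M"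
    using indep_var_rv1[OF ind] indep_var_rv2[OF ind] by auto
  have iX: "integrable M (\<lambda>\<omega>. X \<omega> ^ m)"
    by (rule integrable_bounded[where C = "a ^ m"]) (use X in \<open>auto simp: power_abs intro!: power_mono\<close>)
  have iS: "integrable M (\<lambda>\<omega>. S \<omega> ^ k)"
    by (rule integrable_bounded[where C = "b ^ k"]) (use S in \<open>auto simp: power_abs intro!: power_mono\<close>)
  have "indep_var borel ((\<lambda>x. x ^ m) \<circ> X) borel ((\<lambda>x. x ^ k) \<circ> S)"
    by (rule indep_var_compose[OF ind]) auto
  then have ind': "indep_var borel (\<lambda>\<omega>. X \<omega> ^ m) borel (\<lambda>\<omega>. S \<omega> ^ k)" by (simp add: comp_def)
  show "integrable M (\<lambda>\<omega>. X \<omega> ^ m * S \<omega> ^ k)"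
    "expectation (\<lambda>\<omega>. X \<omega> ^ m * S \<omega> ^ k) = expectation (\<lambda>\<omega>. X \<omega> ^ m) * expectation (\<lambda>\<omega>. S \<omega> ^ k)"
    by (rule indep_var_integrable[OF ind' iX iS], rule indep_var_lebesgue_integral[OF ind' iX iS])
qed

text \<open>In the expansion of (X + S)^4 for an independent new summand X, the terms X^3 S and X
  S^3 vanish because both means are 0, and E X^4 is at most E X^2 since X is bounded by 1. The
  surviving 6 E X^2 E S^2 is the cross term in the square of the summed variances. For this purpose
  the induction carries the mean and the variance of S along.\<close>

lemma fourth_moment_sum_le:
  fixes X :: "'i \<Rightarrow> 'a \<Rightarrow> real"
  assumes I: "finite I" and ind: "indep_vars (\<lambda>_. borel) X I"
    and mean: "\<And>i. i \<in> I \<Longrightarrow> expectation (X i) = 0"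
    and bound: "\<And>i \<omega>. i \<in> I \<Longrightarrow> \<omega> \<in> space M \<Longrightarrow> \<bar>X i \<omega>\<bar> \<le> 1"
  shows "expectation (\<lambda>\<omega>. (\<Sum>i\<in>I. X i \<omega>) ^ 4) \<le>
    (\<Sum>i\<in>I. expectation (\<lambda>\<omega>. (X i \<omega>)\<^sup>2)) + 3 * (\<Sum>i\<in>I. expectation (\<lambda>\<omega>. (X i \<omega>)\<^sup>2))\<^sup>2"
proof -
  define x where "x i = expectation (\<lambda>\<omega>. (X i \<omega>)\<^sup>2)" for i
  have "expectation (\<lambda>\<omega>. \<Sum>i\<in>I. X i \<omega>) = 0 \<and> expectation (\<lambda>\<omega>. (\<Sum>i\<in>I. X i \<omega>)\<^sup>2) = (\<Sum>i\<in>I. x i) \<and>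
    expectation (\<lambda>\<omega>. (\<Sum>i\<in>I. X i \<omega>) ^ 4) \<le> (\<Sum>i\<in>I. x i) + 3 * (\<Sum>i\<in>I. x i)\<^sup>2"
    using assms
  proof (induction I rule: finite_induct)
    case empty
    then show ?case by simp
  next
    case (insert i I)
    define S where "S \<omega> = (\<Sum>i\<in>I. X i \<omega>)" for \<omega>
    have ind: "indep_vars (\<lambda>_. borel) X I" by (rule indep_vars_subset[OF insert.prems(1)]) auto
    have IH: "expectation S = 0" "expectation (\<lambda>\<omega>. (S \<omega>)\<^sup>2) = (\<Sum>i\<in>I. x i)"
      "expectation (\<lambda>\<omega>. S \<omega> ^ 4) \<le> (\<Sum>i\<in>I. x i) + 3 * (\<Sum>i\<in>I. x i)\<^sup>2"
      using insert.IH[OF ind insert.prems(2,3)] by (auto simp: S_def[abs_def])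
    have iv: "indep_var borel (X i) borel S"
      using indep_vars_sum[OF insert.hyps insert.prems(1)] by (simp add: S_def[abs_def])
    have Sb: "\<bar>S \<omega>\<bar> \<le> real (card I)" if "\<omega> \<in> space M" for \<omega>
    proof -
      have "\<bar>S \<omega>\<bar> \<le> (\<Sum>i\<in>I. \<bar>X i \<omega>\<bar>)" unfolding S_def by (rule sum_abs)
      also have "\<dots> \<le> (\<Sum>i\<in>I. 1)" using insert.prems(3) that by (intro sum_mono) auto
      finally show ?thesis by simp
    qed
    have Xb: "\<bar>X i \<omega>\<bar> \<le> 1" if "\<omega> \<in> space M" for \<omega> using insert.prems(3) that by auto
    note int = indep_bounded_moments(1)[OF iv Xb Sb]
    note mul = indep_bounded_moments(2)[OF iv Xb Sb]
    have Xi: "expectation (X i) = 0" by (rule insert.prems(2)) simp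
    have sum_eq: "(\<Sum>i\<in>insert i I. X i \<omega>) = X i \<omega> + S \<omega>" for \<omega>
      using insert.hyps by (simp add: S_def)
    have x0: "0 \<le> x i" for i by (simp add: x_def)
    have X4: "expectation (\<lambda>\<omega>. X i \<omega> ^ 4) \<le> x i"
      unfolding x_def
    proof (rule integral_mono)
      fix \<omega> assume "\<omega> \<in> space M"
      then have "(X i \<omega>)\<^sup>2 \<le> 1" using Xb by (simp add: abs_square_le_1)
      then have "(X i \<omega>)\<^sup>2 * (X i \<omega>)\<^sup>2 \<le> (X i \<omega>)\<^sup>2 * 1" by (intro mult_left_mono) auto
      then show "X i \<omega> ^ 4 \<le> (X i \<omega>)\<^sup>2" by (simp add: power_add[symmetric])
    qed (use int[of 4 0] int[of 2 0] in simp_all)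
    have "expectation (\<lambda>\<omega>. X i \<omega> + S \<omega>) = 0"
      using int[of 1 0] int[of 0 1] Xi IH(1) by simp
    moreover have "expectation (\<lambda>\<omega>. (X i \<omega> + S \<omega>)\<^sup>2) = x i + (\<Sum>i\<in>I. x i)"
    proof -
      have "expectation (\<lambda>\<omega>. (X i \<omega> + S \<omega>)\<^sup>2) =
          expectation (\<lambda>\<omega>. X i \<omega> ^ 2 * S \<omega> ^ 0 + 2 * (X i \<omega> ^ 1 * S \<omega> ^ 1) + X i \<omega> ^ 0 * S \<omega> ^ 2)"
        by (intro Bochner_Integration.integral_cong refl) (simp add: power2_sum)
      also have "\<dots> = expectation (\<lambda>\<omega>. X i \<omega> ^ 2 * S \<omega> ^ 0) + 2 * expectation (\<lambda>\<omega>. X i \<omega> ^ 1 * S \<omega> ^ 1)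
          + expectation (\<lambda>\<omega>. X i \<omega> ^ 0 * S \<omega> ^ 2)"
        using int by (simp only: Bochner_Integration.integral_add integral_mult_right_zero
            Bochner_Integration.integrable_add integrable_mult_right)
      finally show ?thesis using IH Xi mul[of 1 1] by (simp add: x_def)
    qed
    moreover have "expectation (\<lambda>\<omega>. (X i \<omega> + S \<omega>) ^ 4) \<le> (x i + (\<Sum>i\<in>I. x i)) + 3 * (x i + (\<Sum>i\<in>I. x i))\<^sup>2"
    proof -
      have "expectation (\<lambda>\<omega>. (X i \<omega> + S \<omega>) ^ 4) =
          expectation (\<lambda>\<omega>. X i \<omega> ^ 4 * S \<omega> ^ 0 + 4 * (X i \<omega> ^ 3 * S \<omega> ^ 1) + 6 * (X i \<omega> ^ 2 * S \<omega> ^ 2)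
            + 4 * (X i \<omega> ^ 1 * S \<omega> ^ 3) + X i \<omega> ^ 0 * S \<omega> ^ 4)"
        by (intro Bochner_Integration.integral_cong refl)
          (simp add: power4_eq_xxxx power3_eq_cube power2_eq_square algebra_simps)
      also have "\<dots> = expectation (\<lambda>\<omega>. X i \<omega> ^ 4 * S \<omega> ^ 0) + 4 * expectation (\<lambda>\<omega>. X i \<omega> ^ 3 * S \<omega> ^ 1)
          + 6 * expectation (\<lambda>\<omega>. X i \<omega> ^ 2 * S \<omega> ^ 2) + 4 * expectation (\<lambda>\<omega>. X i \<omega> ^ 1 * S \<omega> ^ 3)
          + expectation (\<lambda>\<omega>. X i \<omega> ^ 0 * S \<omega> ^ 4)"
        using int by (simp only: Bochner_Integration.integral_add integral_mult_right_zero
            Bochner_Integration.integrable_add integrable_mult_right)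
      also have "\<dots> = expectation (\<lambda>\<omega>. X i \<omega> ^ 4) + 6 * (x i * (\<Sum>i\<in>I. x i)) + expectation (\<lambda>\<omega>. S \<omega> ^ 4)"
        using mul[of 3 1] mul[of 2 2] mul[of 1 3] IH Xi by (simp add: x_def)
      also have "\<dots> \<le> x i + 6 * (x i * (\<Sum>i\<in>I. x i)) + ((\<Sum>i\<in>I. x i) + 3 * (\<Sum>i\<in>I. x i)\<^sup>2)"
        using X4 IH(3) by simp
      also have "\<dots> \<le> (x i + (\<Sum>i\<in>I. x i)) + 3 * (x i + (\<Sum>i\<in>I. x i))\<^sup>2"
        using zero_le_power2[of "x i"] by (simp add: power2_sum algebra_simps)
      finally show ?thesis .
    qed
    ultimately show ?case using insert.hyps by (simp only: sum_eq sum.insert) simp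
  qed
  then show ?thesis by (simp add: x_def)
qed

lemma fourth_moment_tail:
  assumes X: "X \<in> borel_measurable M" and int: "integrable M (\<lambda>\<omega>. X \<omega> ^ 4 :: real)" and a: "0 < a"
  shows "prob {\<omega> \<in> space M. a < \<bar>X \<omega>\<bar>} \<le> expectation (\<lambda>\<omega>. X \<omega> ^ 4) / a ^ 4"
proof -
  note X [measurable]
  have "a ^ 4 * prob {\<omega> \<in> space M. a < \<bar>X \<omega>\<bar>} = expectation (\<lambda>\<omega>. a ^ 4 * indicator {\<omega> \<in> space M. a < \<bar>X \<omega>\<bar>} \<omega>)"
    by (simp add: Int_absorb1)
  also have "\<dots> \<le> expectation (\<lambda>\<omega>. X \<omega> ^ 4)"
  proof (rule integral_mono[OF _ int])
    show "integrable M (\<lambda>\<omega>. a ^ 4 * indicator {\<omega> \<in> space M. a < \<bar>X \<omega>\<bar>} \<omega>)"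
      by (intro integrable_mult_right integrable_real_indicator) (auto simp: emeasure_eq_measure)
    fix \<omega> assume "\<omega> \<in> space M"
    have "a ^ 4 \<le> \<bar>X \<omega>\<bar> ^ 4" if "a < \<bar>X \<omega>\<bar>" using that a by (intro power_mono) auto
    then show "a ^ 4 * indicator {\<omega> \<in> space M. a < \<bar>X \<omega>\<bar>} \<omega> \<le> X \<omega> ^ 4"
      by (auto simp: indicator_def)
  qed
  finally show ?thesis using a by (simp add: pos_le_divide_eq mult.commute)
qed

end

text \<open>The product of 1 - x + x^2 / 2 and 1 + x + x^2 / 2 equals 1 + x^4 / 4, hence is at least
  1, and the second factor is at most exp x.\<close>

lemma exp_minus_le_quadratic:
  fixes x :: real
  assumes x: "0 \<le> x"
  shows "exp (- x) \<le> 1 - x + x\<^sup>2 / 2"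
proof -
  have "1 \<le> (1 - x + x\<^sup>2 / 2) * (1 + x + x\<^sup>2 / 2)"
  proof -
    have "(1 - x + x\<^sup>2 / 2) * (1 + x + x\<^sup>2 / 2) = 1 + (x\<^sup>2)\<^sup>2 / 4"
      by (simp add: field_simps power2_eq_square)
    then show ?thesis by simp
  qed
  also have "\<dots> \<le> (1 - x + x\<^sup>2 / 2) * exp x"
  proof (rule mult_left_mono)
    have "0 \<le> (1 - x)\<^sup>2 + 1" by simp
    then show "0 \<le> 1 - x + x\<^sup>2 / 2" by (simp add: power2_eq_square field_simps)
  qed (rule exp_lower_Taylor_quadratic[OF x])
  finally have "exp (- x) * 1 \<le> exp (- x) * ((1 - x + x\<^sup>2 / 2) * exp x)"
    by (rule mult_left_mono) simp
  also have "\<dots> = 1 - x + x\<^sup>2 / 2" by (simp add: exp_minus)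
  finally show ?thesis by simp
qed

text \<open>Both sides are products of factors in the unit disc, so their distance is at most the
  sum of the distances of the factors. Each pair of factors is compared with
  \<open>1 - \<epsilon>\<^sup>2 * s i / 2\<close>: the third-order error of the characteristic
  function accounts for \<open>\<bar>\<epsilon>\<bar> * C\<close>, the quadratic error of the
  exponential for \<open>\<epsilon>\<^sup>2 * C\<^sup>2\<close>.\<close>

lemma (in prob_space) char_sum_gaussian_approx:
  fixes W :: "'i \<Rightarrow> 'a \<Rightarrow> real"
  assumes I: "finite I" and ind: "indep_vars (\<lambda>_. borel) W I"
    and bound: "\<And>i \<omega>. i \<in> I \<Longrightarrow> \<omega> \<in> space M \<Longrightarrow> \<bar>W i \<omega>\<bar> \<le> C" and C: "0 \<le> C"
  defines "v \<equiv> \<Sum>i\<in>I. variance (W i)"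
  shows "cmod (expectation (\<lambda>\<omega>. iexp (\<epsilon> * (\<Sum>i\<in>I. W i \<omega> - expectation (W i)))) - exp (- (\<epsilon>\<^sup>2 * v / 2)))
    \<le> \<epsilon>\<^sup>2 * v * (\<bar>\<epsilon>\<bar> * C + \<epsilon>\<^sup>2 * C\<^sup>2)"
proof -
  define Y where "Y i \<omega> = W i \<omega> - expectation (W i)" for i \<omega>
  have Wm [measurable]: "W i \<in> borel_measurable M" if "i \<in> I" for i
    using ind that by (simp add: indep_vars_def)
  have Wi: "integrable M (W i)" if "i \<in> I" for i
    by (rule integrable_bounded[OF Wm[OF that]]) (use bound that in auto)
  have EW: "\<bar>expectation (W i)\<bar> \<le> C" if "i \<in> I" for i
  proof -
    have "\<bar>expectation (W i)\<bar> \<le> expectation (\<lambda>\<omega>. \<bar>W i \<omega>\<bar>)" by (rule integral_abs_bound)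
    also have "\<dots> \<le> expectation (\<lambda>_. C)" using Wi bound that by (intro integral_mono) auto
    finally show ?thesis by (simp add: prob_space)
  qed
  have Yb: "\<bar>Y i \<omega>\<bar> \<le> 2 * C" if "i \<in> I" "\<omega> \<in> space M" for i \<omega>
    using bound[OF that] EW[OF that(1)] unfolding Y_def by linarith
  have Ym [measurable]: "Y i \<in> borel_measurable M" if "i \<in> I" for i
    unfolding Y_def using that by measurable
  have Yi: "integrable M (Y i)" "integrable M (\<lambda>\<omega>. (Y i \<omega>)\<^sup>2)" "expectation (Y i) = 0" if i: "i \<in> I" for i
  proof -
    show "integrable M (Y i)" by (rule integrable_bounded[OF Ym[OF i]]) (use Yb i in auto)
    show "integrable M (\<lambda>\<omega>. (Y i \<omega>)\<^sup>2)"
    proof (rule integrable_bounded)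
      fix \<omega> assume "\<omega> \<in> space M"
      then have "\<bar>Y i \<omega>\<bar>\<^sup>2 \<le> (2 * C)\<^sup>2" using Yb[OF i] by (intro power_mono) auto
      then show "norm ((Y i \<omega>)\<^sup>2) \<le> (2 * C)\<^sup>2" by simp
    qed (use Ym[OF i] in measurable)
    show "expectation (Y i) = 0" using Wi[OF i] by (simp add: Y_def[abs_def] prob_space)
  qed
  define s where "s i = variance (W i)" for i
  have s_Y: "s i = expectation (\<lambda>\<omega>. (Y i \<omega>)\<^sup>2)" for i by (simp add: s_def Y_def)
  have s0: "0 \<le> s i" for i by (simp add: s_Y)
  have sC: "s i \<le> 4 * C\<^sup>2" if i: "i \<in> I" for i
  proof -
    have "s i \<le> expectation (\<lambda>_. 4 * C\<^sup>2)"
      unfolding s_Y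
    proof (rule integral_mono)
      fix \<omega> assume "\<omega> \<in> space M"
      then have "\<bar>Y i \<omega>\<bar>\<^sup>2 \<le> (2 * C)\<^sup>2" using Yb[OF i] by (intro power_mono) auto
      then show "(Y i \<omega>)\<^sup>2 \<le> 4 * C\<^sup>2" by (simp add: power_mult_distrib)
    qed (use Yi i in auto)
    then show ?thesis by (simp add: prob_space)
  qed
  have indY: "indep_vars (\<lambda>_. borel) (\<lambda>i \<omega>. iexp (\<epsilon> * Y i \<omega>)) I"
    unfolding Y_def by (rule indep_vars_compose2[OF ind, where Y = "\<lambda>i x. iexp (\<epsilon> * (x - expectation (W i)))"]) measurable
  have intY: "integrable M (\<lambda>\<omega>. iexp (\<epsilon> * Y i \<omega>))" if i: "i \<in> I" for i
    using Ym[OF i] by (intro integrable_bounded[where C = 1]) (auto simp: norm_exp_i_times)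
  let ?z = "\<lambda>i. expectation (\<lambda>\<omega>. iexp (\<epsilon> * Y i \<omega>))" and ?w = "\<lambda>i. complex_of_real (exp (- (\<epsilon>\<^sup>2 * s i / 2)))"
  have "expectation (\<lambda>\<omega>. iexp (\<epsilon> * (\<Sum>i\<in>I. W i \<omega> - expectation (W i)))) = expectation (\<lambda>\<omega>. \<Prod>i\<in>I. iexp (\<epsilon> * Y i \<omega>))"
    by (intro Bochner_Integration.integral_cong refl)
      (simp add: Y_def sum_distrib_left exp_sum[OF I] flip: of_real_mult)
  also have "\<dots> = (\<Prod>i\<in>I. ?z i)" by (rule indep_vars_lebesgue_integral[OF I indY intY])
  finally have 1: "expectation (\<lambda>\<omega>. iexp (\<epsilon> * (\<Sum>i\<in>I. W i \<omega> - expectation (W i)))) = (\<Prod>i\<in>I. ?z i)" .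
  have 2: "complex_of_real (exp (- (\<epsilon>\<^sup>2 * v / 2))) = (\<Prod>i\<in>I. ?w i)"
  proof -
    have "- (\<epsilon>\<^sup>2 * v / 2) = (\<Sum>i\<in>I. - (\<epsilon>\<^sup>2 * s i / 2))"
      by (simp add: v_def s_def sum_negf sum_distrib_left sum_divide_distrib)
    then show ?thesis by (simp add: exp_sum[OF I])
  qed
  have "cmod ((\<Prod>i\<in>I. ?z i) - (\<Prod>i\<in>I. ?w i)) \<le> (\<Sum>i\<in>I. cmod (?z i - ?w i))"
  proof (rule norm_prod_diff)
    show "cmod (?z i) \<le> 1" if i: "i \<in> I" for i
    proof -
      have "cmod (?z i) \<le> expectation (\<lambda>\<omega>. cmod (iexp (\<epsilon> * Y i \<omega>)))" by (rule integral_norm_bound)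
      then show ?thesis by (simp add: norm_exp_i_times prob_space)
    qed
    show "cmod (?w i) \<le> 1" for i using s0[of i] by simp
  qed
  also have "\<dots> \<le> (\<Sum>i\<in>I. \<epsilon>\<^sup>2 * s i * (\<bar>\<epsilon>\<bar> * C + \<epsilon>\<^sup>2 * C\<^sup>2))"
  proof (rule sum_mono)
    fix i assume i: "i \<in> I"
    have ch: "?z i = char (distr M borel (Y i)) \<epsilon>"
      using Ym[OF i] by (simp add: char_def integral_distr)
    have "cmod (char (distr M borel (Y i)) \<epsilon> - (1 - \<epsilon>\<^sup>2 * s i / 2)) \<le>
        (\<epsilon>\<^sup>2 / 6) * expectation (\<lambda>x. min (6 * (Y i x)\<^sup>2) (\<bar>\<epsilon>\<bar> * \<bar>Y i x\<bar> ^ 3))"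
      by (rule char_approx3') (use i Yi Ym in \<open>auto simp: s_Y\<close>)
    also have "\<dots> \<le> (\<epsilon>\<^sup>2 / 6) * expectation (\<lambda>x. \<bar>\<epsilon>\<bar> * (2 * C) * (Y i x)\<^sup>2)"
    proof (intro mult_left_mono integral_mono)
      have "integrable M (\<lambda>x. 6 * (Y i x)\<^sup>2)" using Yi(2)[OF i] by simp
      then show "integrable M (\<lambda>x. min (6 * (Y i x)\<^sup>2) (\<bar>\<epsilon>\<bar> * \<bar>Y i x\<bar> ^ 3))"
        by (rule Bochner_Integration.integrable_bound) (use Ym[OF i] in \<open>auto simp: min_def abs_mult\<close>)
      show "integrable M (\<lambda>x. \<bar>\<epsilon>\<bar> * (2 * C) * (Y i x)\<^sup>2)" using Yi(2)[OF i] by simp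
      fix \<omega> assume \<omega>: "\<omega> \<in> space M"
      have "\<bar>Y i \<omega>\<bar> * \<bar>Y i \<omega>\<bar>\<^sup>2 \<le> (2 * C) * \<bar>Y i \<omega>\<bar>\<^sup>2" using Yb[OF i \<omega>] by (intro mult_right_mono) auto
      then have "\<bar>Y i \<omega>\<bar> ^ 3 \<le> (2 * C) * (Y i \<omega>)\<^sup>2" by (simp add: power3_eq_cube power2_eq_square)
      then have "\<bar>\<epsilon>\<bar> * \<bar>Y i \<omega>\<bar> ^ 3 \<le> \<bar>\<epsilon>\<bar> * ((2 * C) * (Y i \<omega>)\<^sup>2)" by (rule mult_left_mono) simp
      then show "min (6 * (Y i \<omega>)\<^sup>2) (\<bar>\<epsilon>\<bar> * \<bar>Y i \<omega>\<bar> ^ 3) \<le> \<bar>\<epsilon>\<bar> * (2 * C) * (Y i \<omega>)\<^sup>2"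
        by (simp add: mult.assoc min.coboundedI2)
    qed simp
    also have "\<dots> = \<epsilon>\<^sup>2 * s i * (\<bar>\<epsilon>\<bar> * C) / 3" by (simp add: s_Y)
    also have "\<dots> \<le> \<epsilon>\<^sup>2 * s i * (\<bar>\<epsilon>\<bar> * C)" using s0[of i] C by simp
    finally have a: "cmod (?z i - complex_of_real (1 - \<epsilon>\<^sup>2 * s i / 2)) \<le> \<epsilon>\<^sup>2 * s i * (\<bar>\<epsilon>\<bar> * C)"
      unfolding ch by simp
    let ?x = "\<epsilon>\<^sup>2 * s i / 2"
    have "0 \<le> ?x" using s0[of i] by simp
    then have "\<bar>exp (- ?x) - (1 - ?x)\<bar> \<le> ?x\<^sup>2 / 2"
      using exp_minus_le_quadratic[of ?x] exp_ge_add_one_self[of "- ?x"] by (auto simp: abs_if)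
    then have "cmod (complex_of_real (exp (- ?x) - (1 - ?x))) \<le> ?x\<^sup>2 / 2" by (simp only: norm_of_real)
    also have "\<dots> = \<epsilon>\<^sup>2 * s i * (\<epsilon>\<^sup>2 * s i / 8)" by (simp add: power2_eq_square)
    \<comment> \<open>A centred summand is bounded by 2 * C, so its variance is at most 4 * C^2; the
      divisor 8 absorbs the factor 4.\<close>
    also have "\<dots> \<le> \<epsilon>\<^sup>2 * s i * (\<epsilon>\<^sup>2 * C\<^sup>2)"
    proof (rule mult_left_mono)
      have "\<epsilon>\<^sup>2 * s i \<le> \<epsilon>\<^sup>2 * (4 * C\<^sup>2)" using sC[OF i] by (intro mult_left_mono) auto
      then show "\<epsilon>\<^sup>2 * s i / 8 \<le> \<epsilon>\<^sup>2 * C\<^sup>2" using mult_nonneg_nonneg[OF zero_le_power2[of \<epsilon>] zero_le_power2[of C]] by linarith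
    qed (use s0[of i] in simp)
    finally have b: "cmod (complex_of_real (1 - ?x) - ?w i) \<le> \<epsilon>\<^sup>2 * s i * (\<epsilon>\<^sup>2 * C\<^sup>2)"
      by (simp add: norm_minus_commute)
    have "cmod (?z i - ?w i) \<le> cmod (?z i - complex_of_real (1 - ?x)) + cmod (complex_of_real (1 - ?x) - ?w i)"
      using dist_triangle[of "?z i" "?w i" "complex_of_real (1 - ?x)"] by (simp only: dist_norm)
    then show "cmod (?z i - ?w i) \<le> \<epsilon>\<^sup>2 * s i * (\<bar>\<epsilon>\<bar> * C + \<epsilon>\<^sup>2 * C\<^sup>2)"
      using a b by (simp add: distrib_left)
  qed
  also have "\<dots> = \<epsilon>\<^sup>2 * v * (\<bar>\<epsilon>\<bar> * C + \<epsilon>\<^sup>2 * C\<^sup>2)"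
    by (simp add: v_def s_def sum_distrib_left sum_distrib_right)
  finally show ?thesis unfolding 1 2 .
qed

lemma (in prob_space) expectation_cos_eq_char:
  assumes "X \<in> borel_measurable M"
  shows "expectation (\<lambda>\<omega>. cos (X \<omega> + c)) = Re (iexp c * expectation (\<lambda>\<omega>. iexp (X \<omega>)))"
proof -
  have i: "integrable M (\<lambda>\<omega>. iexp (X \<omega>))"
    using assms by (intro integrable_bounded[where C = 1]) (auto simp: norm_exp_i_times)
  have "cos (x + c) = Re (iexp c * iexp x)" for x
    by (simp add: exp_add[symmetric] distrib_left[symmetric] Re_exp add.commute)
  then have "expectation (\<lambda>\<omega>. cos (X \<omega> + c)) = expectation (\<lambda>\<omega>. Re (iexp c * iexp (X \<omega>)))" by simp
  also have "\<dots> = Re (expectation (\<lambda>\<omega>. iexp c * iexp (X \<omega>)))" using i by (intro integral_Re) simp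
  also have "\<dots> = Re (iexp c * expectation (\<lambda>\<omega>. iexp (X \<omega>)))" by simp
  finally show ?thesis .
qed

section \<open>Characteristic functions of Brownian increments\<close>

context brownian_motion
begin

lemma char_increment:
  assumes "0 \<le> s" "s \<le> t"
  shows "expectation (\<lambda>\<omega>. iexp (\<theta> * (B t \<omega> - B s \<omega>))) = exp (- (\<theta>\<^sup>2 * (t - s) / 2))"
\<comment> \<open>The normal law of increments is only postulated for s < t, where the variance is
  positive.\<close>
proof (cases "s = t")
  case True
  then show ?thesis by (simp add: prob_space)
next
  case False
  define \<sigma> where "\<sigma> = sqrt (t - s)"
  have \<sigma>: "0 < \<sigma>" "\<sigma>\<^sup>2 = t - s" using assms False by (auto simp: \<sigma>_def)
  let ?X = "\<lambda>\<omega>. (B t \<omega> - B s \<omega>) / \<sigma>"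
  have "distributed N lborel (\<lambda>\<omega>. B t \<omega> - B s \<omega>) (normal_density 0 \<sigma>)"
    unfolding \<sigma>_def using assms False by (intro normal_increments) auto
  then have D: "distributed N lborel ?X std_normal_density"
    using normal_standard_normal_convert[OF \<sigma>(1), of "\<lambda>\<omega>. B t \<omega> - B s \<omega>" 0] by simp
  then have d: "distr N lborel ?X = std_normal_distribution" by (simp add: distributed_def)
  have Xm: "?X \<in> measurable N lborel" using D by (simp add: distributed_def)
  have "expectation (\<lambda>\<omega>. iexp (\<theta> * (B t \<omega> - B s \<omega>))) = expectation (\<lambda>\<omega>. iexp ((\<theta> * \<sigma>) * ?X \<omega>))"
    using \<sigma> by simp
  also have "\<dots> = (\<integral>x. iexp ((\<theta> * \<sigma>) * x) \<partial>distr N lborel ?X)"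
    by (rule integral_distr[symmetric, OF Xm]) simp
  also have "\<dots> = char std_normal_distribution (\<theta> * \<sigma>)" by (simp add: d char_def)
  also have "\<dots> = exp (- (\<theta>\<^sup>2 * (t - s) / 2))"
    by (simp add: char_std_normal_distribution power_mult_distrib \<sigma>(2))
  finally show ?thesis .
qed

lemma char_increments:
  fixes u :: "nat \<Rightarrow> real"
  assumes u: "0 \<le> u 0" "mono u"
  shows "expectation (\<lambda>\<omega>. iexp (\<Sum>j<k. \<theta> j * (B (u (Suc j)) \<omega> - B (u j) \<omega>))) =
    exp (- (\<Sum>j<k. (\<theta> j)\<^sup>2 * (u (Suc j) - u j)) / 2)"
proof -
  have u0: "0 \<le> u j" for j using u monoD[OF u(2), of 0 j] by simp
  have ind: "indep_vars (\<lambda>_. borel) (\<lambda>j \<omega>. iexp (\<theta> j * (B (u (Suc j)) \<omega> - B (u j) \<omega>))) {..<k}"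
    by (rule indep_vars_compose2[OF indep_increments[OF u], where Y = "\<lambda>j x. iexp (\<theta> j * x)"]) measurable
  have int: "integrable N (\<lambda>\<omega>. iexp (\<theta> j * (B (u (Suc j)) \<omega> - B (u j) \<omega>)))" for j
    using measurable_B[OF u0] by (intro integrable_bounded[where C = 1]) (auto simp: norm_exp_i_times)
  have "expectation (\<lambda>\<omega>. iexp (\<Sum>j<k. \<theta> j * (B (u (Suc j)) \<omega> - B (u j) \<omega>))) =
      expectation (\<lambda>\<omega>. \<Prod>j<k. iexp (\<theta> j * (B (u (Suc j)) \<omega> - B (u j) \<omega>)))"
    by (simp add: sum_distrib_left exp_sum)
  also have "\<dots> = (\<Prod>j<k. expectation (\<lambda>\<omega>. iexp (\<theta> j * (B (u (Suc j)) \<omega> - B (u j) \<omega>))))"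
    by (rule indep_vars_lebesgue_integral[OF _ ind int]) simp
  also have "\<dots> = (\<Prod>j<k. complex_of_real (exp (- ((\<theta> j)\<^sup>2 * (u (Suc j) - u j) / 2))))"
    by (intro prod.cong refl char_increment u0) (use monoD[OF u(2)] in auto)
  also have "\<dots> = exp (- (\<Sum>j<k. (\<theta> j)\<^sup>2 * (u (Suc j) - u j)) / 2)"
    by (simp add: exp_sum[symmetric] sum_negf sum_divide_distrib flip: of_real_prod)
  finally show ?thesis .
qed

end

text \<open>Halving the index passes to the next coarser level. An even index is already a point of
  that level and an odd one is a single increment away from it, so each level between q and J costs
  at most one increment.\<close>

lemma dyadic_chaining:
  fixes A :: "real \<Rightarrow> real" and a :: "nat \<Rightarrow> real"
  assumes "q \<le> J"
    and "\<And>j i. q < j \<Longrightarrow> j \<le> J \<Longrightarrow> i < 2 ^ j \<Longrightarrow> \<bar>A (c * real (Suc i) / 2 ^ j) - A (c * real i / 2 ^ j)\<bar> \<le> a j"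
    and "i \<le> 2 ^ J"
  shows "\<bar>A (c * real i / 2 ^ J) - A (c * real (i div 2 ^ (J - q)) / 2 ^ q)\<bar> \<le> (\<Sum>j\<in>{q<..J}. a j)"
  using assms
proof (induction J arbitrary: i rule: dec_induct)
  case base
  then show ?case by simp
next
  case (step J)
  let ?h = "i div 2"
  have half: "c * real (2 * k) / 2 ^ Suc J = c * real k / 2 ^ J" for k by simp
  have "?h \<le> 2 ^ J" using step.prems(2) by simp
  then have IH: "\<bar>A (c * real ?h / 2 ^ J) - A (c * real (?h div 2 ^ (J - q)) / 2 ^ q)\<bar> \<le> (\<Sum>j\<in>{q<..J}. a j)"
    using step.prems(1) by (intro step.IH) auto
  \<comment> \<open>The bound on the increment with index 0 forces it to be non-negative.\<close>
  have a0: "0 \<le> a (Suc J)" using step.prems(1)[of "Suc J" 0] step.hyps by fastforce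
  have "\<bar>A (c * real i / 2 ^ Suc J) - A (c * real ?h / 2 ^ J)\<bar> \<le> a (Suc J)"
  proof (cases "even i")
    case True
    then show ?thesis using half[of ?h] a0 by simp
  next
    case False
    then have i: "i = Suc (2 * ?h)" by presburger
    have "2 * ?h < 2 ^ Suc J" using step.prems(2) i by linarith
    then have "\<bar>A (c * real (Suc (2 * ?h)) / 2 ^ Suc J) - A (c * real (2 * ?h) / 2 ^ Suc J)\<bar> \<le> a (Suc J)"
      using step.hyps by (intro step.prems(1)) auto
    then show ?thesis unfolding half using i by simp
  qed
  moreover have "?h div 2 ^ (J - q) = i div 2 ^ (Suc J - q)"
    using step.hyps by (simp add: Suc_diff_le div_mult2_eq)
  moreover have "{q<..Suc J} = insert (Suc J) {q<..J}" using step.hyps by auto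
  then have "(\<Sum>j\<in>{q<..Suc J}. a j) = a (Suc J) + (\<Sum>j\<in>{q<..J}. a j)" by simp
  ultimately show ?case using IH by (simp only:) linarith
qed

section \<open>The number of edges\<close>

lemma sum_ordered_pairs:
  fixes f :: "'v set \<Rightarrow> real"
  assumes V: "finite V"
  shows "(\<Sum>(i, j)\<in>{(i, j) \<in> V \<times> V. i \<noteq> j}. f {i, j}) = 2 * (\<Sum>e\<in>edge_pairs V. f e)"
proof -
  let ?P = "{(i, j) \<in> V \<times> V. i \<noteq> j}" and ?h = "\<lambda>(i, j). {i, j}"
  have finP: "finite ?P" by (rule finite_subset[of _ "V \<times> V"]) (use V in auto)
  have "(\<Sum>x\<in>?P. f (?h x)) = (\<Sum>e\<in>?h ` ?P. \<Sum>x\<in>{x \<in> ?P. ?h x = e}. f (?h x))"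
    by (rule sum.image_gen[OF finP])
  also have "\<dots> = (\<Sum>e\<in>?h ` ?P. 2 * f e)"
  proof (rule sum.cong[OF refl])
    fix e assume "e \<in> ?h ` ?P"
    then obtain i j where e: "e = {i, j}" "i \<in> V" "j \<in> V" "i \<noteq> j" by auto
    then have "{x \<in> ?P. ?h x = e} = {(i, j), (j, i)}" by (auto simp: doubleton_eq_iff)
    moreover have "(i, j) \<noteq> (j, i)" using e by auto
    ultimately show "(\<Sum>x\<in>{x \<in> ?P. ?h x = e}. f (?h x)) = 2 * f e"
      using e by (simp add: insert_commute)
  qed
  also have "\<dots> = 2 * (\<Sum>e\<in>edge_pairs V. f e)"
    by (simp add: edge_pairs_image sum_distrib_left)
  finally show ?thesis by (simp add: case_prod_unfold)
qed

text \<open>The square of the sum counts every edge twice and the diagonal once. It is used for the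
  masses, giving the total rate, and for their squares, giving the square rate.\<close>

lemma sum_edge_pairs_prod:
  fixes z :: "'v \<Rightarrow> real"
  assumes V: "finite V"
  shows "2 * (\<Sum>e\<in>edge_pairs V. \<Prod>i\<in>e. z i) = (\<Sum>i\<in>V. z i)\<^sup>2 - (\<Sum>i\<in>V. (z i)\<^sup>2)"
proof -
  let ?P = "{(i, j) \<in> V \<times> V. i \<noteq> j}" and ?D = "{(i, j) \<in> V \<times> V. i = j}"
  have "2 * (\<Sum>e\<in>edge_pairs V. \<Prod>i\<in>e. z i) = (\<Sum>(i, j)\<in>?P. z i * z j)"
    by (subst sum_ordered_pairs[OF V, symmetric]) (auto intro!: sum.cong)
  moreover have "(\<Sum>i\<in>V. z i)\<^sup>2 = (\<Sum>(i, j)\<in>V \<times> V. z i * z j)"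
    by (simp add: power2_eq_square sum_product sum.cartesian_product)
  moreover have "(\<Sum>(i, j)\<in>V \<times> V. z i * z j) = (\<Sum>(i, j)\<in>?P. z i * z j) + (\<Sum>(i, j)\<in>?D. z i * z j)"
    using V by (subst sum.union_disjoint[symmetric]) (auto intro!: sum.cong intro: finite_subset[of _ "V \<times> V"])
  moreover have "(\<Sum>(i, j)\<in>?D. z i * z j) = (\<Sum>i\<in>V. (z i)\<^sup>2)"
    by (rule sum.reindex_bij_witness[of _ "\<lambda>i. (i, i)" fst]) (auto simp: power2_eq_square)
  ultimately show ?thesis by simp
qed

section \<open>Arrival times of the edges\<close>

context mult_graph_process
begin

text \<open>The process only asserts that suitable edge times exist. One choice is fixed here so
  that definitions and lemmas can share it.\<close>

definition arrival :: "nat set \<Rightarrow> 'w \<Rightarrow> real" where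
  "arrival = (SOME T. indep_vars (\<lambda>_. borel) T (all_edges z) \<and>
      (\<forall>i\<in>vertices z. \<forall>j\<in>vertices z. i \<noteq> j \<longrightarrow>
        distributed M lborel (T {i, j}) (exponential_density (z i * z j))) \<and>
      (\<forall>\<omega>\<in>space M. \<forall>t\<ge>0. G t \<omega> = {e \<in> all_edges z. T e \<omega> \<le> t}))"

lemma arrival:
  "indep_vars (\<lambda>_. borel) arrival (all_edges z)"
  "i \<in> vertices z \<Longrightarrow> j \<in> vertices z \<Longrightarrow> i \<noteq> j \<Longrightarrow>
     distributed M lborel (arrival {i, j}) (exponential_density (z i * z j))"
  "\<omega> \<in> space M \<Longrightarrow> 0 \<le> t \<Longrightarrow> G t \<omega> = {e \<in> all_edges z. arrival e \<omega> \<le> t}"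
  using someI_ex[OF edge_times, folded arrival_def] by blast+

lemma all_edges_eq: "all_edges z = edge_pairs (vertices z)"
  by (simp add: all_edges_def edge_pairs_def)

text \<open>As a product over the two-element set, the rate needs no order of the end
  points.\<close>

definition rate :: "nat set \<Rightarrow> real" where "rate e = (\<Prod>i\<in>e. z i)"

lemma rate_pos: "e \<in> all_edges z \<Longrightarrow> 0 < rate e"
  by (auto simp: rate_def all_edges_def vertices_def)

lemma arrival_measurable [measurable]: "e \<in> all_edges z \<Longrightarrow> arrival e \<in> borel_measurable M"
  using arrival(1) by (simp add: indep_vars_def)

text \<open>This holds at every outcome and not just almost surely, because the graph at time 0 is
  empty everywhere. It keeps the jump times of every path away from 0.\<close>

lemma arrival_pos:
  assumes "e \<in> all_edges z" "\<omega> \<in> space M"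
  shows "0 < arrival e \<omega>"
  using arrival(3)[OF assms(2), of 0] starts_empty[OF assms(2)] assms by force

definition arrived :: "nat set \<Rightarrow> real \<Rightarrow> real" where "arrived e t = 1 - exp (- (rate e * t))"

lemma prob_arrival:
  assumes "e \<in> all_edges z" "0 \<le> t"
  shows "prob {\<omega> \<in> space M. arrival e \<omega> \<le> t} = arrived e t"
proof -
  obtain i j where e: "e = {i, j}" "i \<in> vertices z" "j \<in> vertices z" "i \<noteq> j"
    using assms by (auto simp: all_edges_def)
  have "0 < z i * z j" using e by (simp add: vertices_def)
  from exponential_distributedD_le[OF arrival(2)[OF e(2-4)] assms(2) this]
  show ?thesis using e by (simp add: arrived_def rate_def mult.commute)
qed

lemma arrived_mono: "e \<in> all_edges z \<Longrightarrow> s \<le> t \<Longrightarrow> arrived e s \<le> arrived e t"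
  using rate_pos[of e] by (simp add: arrived_def)

lemma arrived_increment_le:
  assumes e: "e \<in> all_edges z" and st: "0 \<le> s" "s \<le> t"
  shows "arrived e t - arrived e s \<le> rate e * (t - s)"
proof -
  let ?r = "rate e"
  have r: "0 < ?r" by (rule rate_pos[OF e])
  have "arrived e t - arrived e s = exp (- (?r * s)) * (1 - exp (- (?r * (t - s))))"
    by (simp add: arrived_def right_diff_distrib mult_exp_exp)
  also have "\<dots> \<le> 1 * (?r * (t - s))"
  proof (rule mult_mono)
    show "1 - exp (- (?r * (t - s))) \<le> ?r * (t - s)"
      using exp_ge_add_one_self[of "- (?r * (t - s))"] by simp
  qed (use r st in auto)
  finally show ?thesis by simp
qed

lemma prob_arrival_between:
  assumes e: "e \<in> all_edges z" and st: "0 \<le> s" "s \<le> t"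
  shows "expectation (\<lambda>\<omega>. indicator {s<..t} (arrival e \<omega>)) = arrived e t - arrived e s"
proof -
  note [measurable] = arrival_measurable[OF e]
  have "expectation (\<lambda>\<omega>. indicator {s<..t} (arrival e \<omega>) :: real)
      = expectation (indicator {\<omega> \<in> space M. s < arrival e \<omega> \<and> arrival e \<omega> \<le> t})"
    by (intro Bochner_Integration.integral_cong refl) (auto simp: indicator_def)
  also have "\<dots> = prob ({\<omega> \<in> space M. s < arrival e \<omega> \<and> arrival e \<omega> \<le> t})"
    by (simp add: Int_absorb1)
  also have "{\<omega> \<in> space M. s < arrival e \<omega> \<and> arrival e \<omega> \<le> t} =
      {\<omega> \<in> space M. arrival e \<omega> \<le> t} - {\<omega> \<in> space M. arrival e \<omega> \<le> s}" by auto
  also have "prob \<dots> = prob {\<omega> \<in> space M. arrival e \<omega> \<le> t} - prob {\<omega> \<in> space M. arrival e \<omega> \<le> s}"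
    using st by (intro finite_measure_Diff) auto
  finally show ?thesis using e st by (simp add: prob_arrival)
qed

definition edge_count :: "real \<Rightarrow> 'w \<Rightarrow> real" where "edge_count t \<omega> = real (card (G t \<omega>))"

definition mean_count :: "real \<Rightarrow> real" where "mean_count t = (\<Sum>e\<in>all_edges z. arrived e t)"

definition centered :: "real \<Rightarrow> 'w \<Rightarrow> real" where "centered t \<omega> = edge_count t \<omega> - mean_count t"

definition total_rate :: real where "total_rate = (\<Sum>e\<in>all_edges z. rate e)"

definition square_rate :: real where "square_rate = (\<Sum>e\<in>all_edges z. (rate e)\<^sup>2)"

end

section \<open>Mean and fourth moment of the edge count\<close>

locale finite_mult_graph_process = mult_graph_process M z G
  for M :: "'w measure" and z :: "nat \<Rightarrow> real" and G :: "real \<Rightarrow> 'w \<Rightarrow> nat set set" +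
  assumes finite_vertices: "finite (vertices z)"
begin

lemma finite_edges: "finite (all_edges z)"
  using finite_edge_pairs[OF finite_vertices] by (simp add: all_edges_eq)

lemma edge_count_eq:
  assumes "\<omega> \<in> space M" "0 \<le> t"
  shows "edge_count t \<omega> = (\<Sum>e\<in>all_edges z. indicator {..t} (arrival e \<omega>))"
proof -
  have "(\<Sum>e\<in>all_edges z. indicator {..t} (arrival e \<omega>)) = (\<Sum>e\<in>all_edges z. if arrival e \<omega> \<le> t then 1 else (0 :: real))"
    by (simp add: indicator_def of_bool_def)
  also have "\<dots> = real (card {e \<in> all_edges z. arrival e \<omega> \<le> t})"
    using finite_edges by (subst sum.inter_filter[symmetric]) auto
  finally show ?thesis by (simp add: edge_count_def arrival(3)[OF assms])
qed

lemma edge_count_mono: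
  assumes "\<omega> \<in> space M" "0 \<le> s" "s \<le> t"
  shows "edge_count s \<omega> \<le> edge_count t \<omega>"
  using assms by (auto simp: edge_count_eq indicator_def intro!: sum_mono)

lemma mean_count_mono: "s \<le> t \<Longrightarrow> mean_count s \<le> mean_count t"
  unfolding mean_count_def by (intro sum_mono arrived_mono)

lemma mean_count_increment_le:
  "0 \<le> s \<Longrightarrow> s \<le> t \<Longrightarrow> mean_count t - mean_count s \<le> total_rate * (t - s)"
  unfolding mean_count_def total_rate_def sum_subtractf[symmetric] sum_distrib_right
  by (intro sum_mono arrived_increment_le)

lemma mean_count_approx:
  assumes "0 \<le> t"
  shows "\<bar>mean_count t - total_rate * t\<bar> \<le> square_rate * t\<^sup>2"
proof -
  have "\<bar>arrived e t - rate e * t\<bar> \<le> (rate e)\<^sup>2 * t\<^sup>2" if e: "e \<in> all_edges z" for e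
  proof -
    have x: "0 \<le> rate e * t" using rate_pos[OF e] assms by simp
    have "0 \<le> (rate e * t)\<^sup>2" by simp
    then show ?thesis
      using exp_minus_le_quadratic[OF x] exp_ge_add_one_self[of "- (rate e * t)"]
      unfolding arrived_def power_mult_distrib[symmetric] by linarith
  qed
  then have "(\<Sum>e\<in>all_edges z. \<bar>arrived e t - rate e * t\<bar>) \<le> (\<Sum>e\<in>all_edges z. (rate e)\<^sup>2 * t\<^sup>2)"
    by (rule sum_mono)
  moreover have "\<bar>mean_count t - total_rate * t\<bar> \<le> (\<Sum>e\<in>all_edges z. \<bar>arrived e t - rate e * t\<bar>)"
    unfolding mean_count_def total_rate_def sum_distrib_right sum_subtractf[symmetric] by (rule sum_abs)
  ultimately show ?thesis by (simp add: square_rate_def sum_distrib_right)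
qed

lemma total_rate_eq: "total_rate = ((\<Sum>i\<in>vertices z. z i)\<^sup>2 - (\<Sum>i\<in>vertices z. (z i)\<^sup>2)) / 2"
  using sum_edge_pairs_prod[OF finite_vertices, of z] by (simp add: total_rate_def rate_def all_edges_eq)

text \<open>In scaled time the sum of the squared masses multiplied by t stays bounded. The error in
  \<open>mean_count_approx\<close> is then a bounded number of edges, however many vertices there
  are.\<close>

lemma square_rate_le: "square_rate \<le> (\<Sum>i\<in>vertices z. (z i)\<^sup>2)\<^sup>2"
proof -
  have "2 * square_rate = (\<Sum>i\<in>vertices z. (z i)\<^sup>2)\<^sup>2 - (\<Sum>i\<in>vertices z. ((z i)\<^sup>2)\<^sup>2)"
    using sum_edge_pairs_prod[OF finite_vertices, of "\<lambda>i. (z i)\<^sup>2"]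
    by (simp add: square_rate_def rate_def all_edges_eq prod_power_distrib)
  moreover have "0 \<le> (\<Sum>i\<in>vertices z. ((z i)\<^sup>2)\<^sup>2)" by (intro sum_nonneg) auto
  moreover have "0 \<le> (\<Sum>i\<in>vertices z. (z i)\<^sup>2)\<^sup>2" by simp
  ultimately show ?thesis by linarith
qed

lemma square_rate_nonneg: "0 \<le> square_rate"
  unfolding square_rate_def by (intro sum_nonneg) auto

lemma total_rate_nonneg: "0 \<le> total_rate"
  unfolding total_rate_def by (intro sum_nonneg less_imp_le rate_pos)

lemma centered_increment:
  assumes "\<omega> \<in> space M" "0 \<le> s" "s \<le> t"
  shows "centered t \<omega> - centered s \<omega> =
    (\<Sum>e\<in>all_edges z. indicator {s<..t} (arrival e \<omega>) - (arrived e t - arrived e s))"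
proof -
  have eq: "indicator {s<..t} x = indicator {..t} x - (indicator {..s} x :: real)" for x
    using assms by (auto simp: indicator_def)
  show ?thesis
    using assms by (simp add: centered_def edge_count_eq mean_count_def eq sum_subtractf)
qed

lemma edge_count_measurable: "0 \<le> t \<Longrightarrow> edge_count t \<in> borel_measurable M"
proof -
  assume t: "0 \<le> t"
  have "(\<lambda>\<omega>. \<Sum>e\<in>all_edges z. indicator {..t} (arrival e \<omega>) :: real) \<in> borel_measurable M" by measurable
  then show ?thesis by (subst measurable_cong[OF edge_count_eq[OF _ t]])
qed

lemma centered_measurable: "0 \<le> t \<Longrightarrow> centered t \<in> borel_measurable M"
  unfolding centered_def using edge_count_measurable by measurable

lemma edge_count_bounds: "\<omega> \<in> space M \<Longrightarrow> 0 \<le> t \<Longrightarrow> 0 \<le> edge_count t \<omega> \<and> edge_count t \<omega> \<le> card (all_edges z)"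
  using finite_edges by (auto simp: edge_count_def arrival(3) intro!: card_mono)

lemma centered_bounded: "\<omega> \<in> space M \<Longrightarrow> 0 \<le> t \<Longrightarrow> \<bar>centered t \<omega>\<bar> \<le> card (all_edges z) + \<bar>mean_count t\<bar>"
  using edge_count_bounds[of \<omega> t] unfolding centered_def by linarith

lemma centered_increment_integrable:
  assumes "0 \<le> s" "0 \<le> t"
  shows "integrable M (\<lambda>\<omega>. (centered t \<omega> - centered s \<omega>) ^ k)"
proof (rule integrable_bounded)
  show "(\<lambda>\<omega>. (centered t \<omega> - centered s \<omega>) ^ k) \<in> borel_measurable M"
    using centered_measurable[OF assms(1)] centered_measurable[OF assms(2)] by measurable
  fix \<omega> assume \<omega>: "\<omega> \<in> space M"
  let ?C = "(real (card (all_edges z)) + \<bar>mean_count t\<bar>) + (real (card (all_edges z)) + \<bar>mean_count s\<bar>)"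
  have "\<bar>centered t \<omega> - centered s \<omega>\<bar> \<le> ?C"
    using centered_bounded[OF \<omega> assms(1)] centered_bounded[OF \<omega> assms(2)] by linarith
  then show "norm ((centered t \<omega> - centered s \<omega>) ^ k) \<le> ?C ^ k"
    by (simp add: power_abs power_mono)
qed

text \<open>An increment is a sum of centred indicators whose variances p - p^2 are at most p and
  add up to at most d. The term d is the Poissonian part, dominant on short intervals; the quadratic
  term is the Gaussian part.\<close>

lemma fourth_moment_increment:
  assumes st: "0 \<le> s" "s \<le> t"
  defines "d \<equiv> total_rate * (t - s)"
  shows "expectation (\<lambda>\<omega>. (centered t \<omega> - centered s \<omega>) ^ 4) \<le> d + 3 * d\<^sup>2"
proof -
  define p where "p e = arrived e t - arrived e s" for e
  define X where "X e \<omega> = indicator {s<..t} (arrival e \<omega>) - p e" for e \<omega>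
  have p: "0 \<le> p e" "p e \<le> rate e * (t - s)" "p e \<le> 1" if e: "e \<in> all_edges z" for e
    using arrived_mono[OF e st(2)] arrived_increment_le[OF e st] rate_pos[OF e] st
    by (auto simp: p_def arrived_def algebra_simps intro!: add_increasing2)
  have X_bound: "\<bar>X e \<omega>\<bar> \<le> 1" if "e \<in> all_edges z" for e \<omega>
    using p[OF that] by (auto simp: X_def indicator_def)
  have int_ind: "integrable M (\<lambda>\<omega>. indicator {s<..t} (arrival e \<omega>) :: real)" if "e \<in> all_edges z" for e
    using arrival_measurable[OF that] by (intro integrable_bounded[where C = 1]) (auto simp: indicator_def)
  have X_mean: "expectation (X e) = 0" if e: "e \<in> all_edges z" for e
    using int_ind[OF e] prob_arrival_between[OF e st] by (simp add: X_def[abs_def] p_def prob_space)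
  have X_sq: "expectation (\<lambda>\<omega>. (X e \<omega>)\<^sup>2) \<le> rate e * (t - s)" if e: "e \<in> all_edges z" for e
  proof -
    have "expectation (\<lambda>\<omega>. (X e \<omega>)\<^sup>2) = expectation (\<lambda>\<omega>. indicator {s<..t} (arrival e \<omega>) * (1 - 2 * p e) + (p e)\<^sup>2)"
      by (intro Bochner_Integration.integral_cong refl)
        (auto simp: X_def indicator_def power2_eq_square algebra_simps)
    also have "\<dots> = p e * (1 - 2 * p e) + (p e)\<^sup>2"
      using int_ind[OF e] prob_arrival_between[OF e st] by (simp add: p_def prob_space)
    also have "\<dots> = p e - (p e)\<^sup>2" by (simp add: power2_eq_square algebra_simps)
    also have "\<dots> \<le> p e" by simp
    finally show ?thesis using p[OF e] by simp
  qed
  have ind: "indep_vars (\<lambda>_. borel) X (all_edges z)"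
    unfolding X_def
    by (rule indep_vars_compose2[OF arrival(1), where Y = "\<lambda>e x. indicator {s<..t} x - p e"]) measurable
  let ?v = "\<Sum>e\<in>all_edges z. expectation (\<lambda>\<omega>. (X e \<omega>)\<^sup>2)"
  have v: "0 \<le> ?v" "?v \<le> d"
    using sum_mono[OF X_sq] by (auto simp: d_def total_rate_def sum_distrib_right intro!: sum_nonneg)
  have "expectation (\<lambda>\<omega>. (centered t \<omega> - centered s \<omega>) ^ 4) = expectation (\<lambda>\<omega>. (\<Sum>e\<in>all_edges z. X e \<omega>) ^ 4)"
    by (intro Bochner_Integration.integral_cong refl) (simp add: centered_increment st X_def p_def)
  also have "\<dots> \<le> ?v + 3 * ?v\<^sup>2"
    by (rule fourth_moment_sum_le[OF finite_edges ind X_mean X_bound])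
  also have "\<dots> \<le> d + 3 * d\<^sup>2" using v by (intro add_mono mult_left_mono power_mono) auto
  finally show ?thesis .
qed

text \<open>Count and mean are both increasing in time. Inside a cell the centred count is therefore
  confined by its increment over the whole cell and by the mean number of edges of the cell.\<close>

lemma centered_between:
  assumes "\<omega> \<in> space M" "0 \<le> s" "s \<le> t" "t \<le> u"
  shows "\<bar>centered t \<omega> - centered s \<omega>\<bar> \<le> \<bar>centered u \<omega> - centered s \<omega>\<bar> + total_rate * (u - s)"
proof -
  have "edge_count s \<omega> \<le> edge_count t \<omega>" "edge_count t \<omega> \<le> edge_count u \<omega>"
    using assms by (auto intro: edge_count_mono)
  moreover have "mean_count s \<le> mean_count t" "mean_count t \<le> mean_count u"
    using assms by (auto intro: mean_count_mono)
  moreover have "mean_count u - mean_count s \<le> total_rate * (u - s)"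
    using assms by (intro mean_count_increment_le) auto
  ultimately show ?thesis unfolding centered_def by linarith
qed

text \<open>Dyadic chaining with fourth moments.  The finest level \<open>J\<close> satisfies \<open>2 ^ J \<le> k < 2 ^ Suc J\<close>:
  up to this level the fourth moment of an increment is dominated by its Gaussian part, and below it
  the mean number of edges per cell is bounded, so that monotonicity of the count suffices.  The level
  \<open>j\<close> increments are compared with \<open>A * (9 / 10) ^ j\<close>, and \<open>5000 / 6561\<close> is \<open>(10 / 9) ^ 4 / 2\<close>.\<close>

lemma modulus_bound:
  assumes c: "0 \<le> c" and k: "2 ^ q \<le> k" and D: "total_rate * c \<le> D * k" "0 \<le> D" and A: "0 < A"
  obtains S where "S \<in> events" "prob S \<le> 5 * (D + 3 * D\<^sup>2) / A ^ 4 * (5000 / 6561) ^ q"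
    "\<And>\<omega> t. \<omega> \<in> space M - S \<Longrightarrow> t \<in> {0..c} \<Longrightarrow>
       \<bar>centered t \<omega> - centered (grid_floor c (2 ^ q) t) \<omega>\<bar> \<le> 20 * A * sqrt k * (9 / 10) ^ q + 2 * D"
proof -
  have k0: "0 < k" using k by (rule less_le_trans[rotated]) simp
  have k1: "1 \<le> k" using k one_le_power[of "2 :: real" q] by linarith
  obtain J where J: "2 ^ J \<le> k" "k < 2 ^ Suc J"
  proof -
    have ex: "\<exists>n. k < 2 ^ n" using real_arch_pow[of 2 k] by simp
    define n where "n = (LEAST n. k < 2 ^ n)"
    have n: "k < 2 ^ n" unfolding n_def using ex by (rule LeastI_ex)
    have "n \<noteq> 0"
    proof
      assume "n = 0"
      then show False using n k1 by simp
    qed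
    then obtain J where nJ: "n = Suc J" using not0_implies_Suc by auto
    have "\<not> k < 2 ^ J" using not_less_Least[of J "\<lambda>n. k < 2 ^ n"] nJ unfolding n_def by simp
    then show ?thesis using that[of J] n nJ by simp
  qed
  have qJ: "q \<le> J"
  proof (rule ccontr)
    assume "\<not> q \<le> J"
    then have "(2 :: real) ^ Suc J \<le> 2 ^ q" by (intro power_increasing) auto
    then show False using J k by simp
  qed
  \<comment> \<open>Any ratio below 1 with fourth power above 1 / 2 would do. The first property
    makes the thresholds summable. By the second, the 2 ^ j cells of level j lose against a tail
    probability of order \<open>(1 / (4 * \<rho> ^ 4)) ^ j\<close>.\<close>
  define \<rho> where "\<rho> = (9 / 10 :: real)"
  define b where "b j = sqrt k * (A * \<rho> ^ j)" for j
  have b0: "0 < b j" for j using A k0 by (simp add: b_def \<rho>_def)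
  define S where "S j i = {\<omega> \<in> space M. b j < \<bar>centered (c * real (Suc i) / 2 ^ j) \<omega> - centered (c * real i / 2 ^ j) \<omega>\<bar>}" for j i
  \<comment> \<open>Chaining itself needs the levels above q only. Level q is included because the
    final step inside a cell uses level J, which may equal q.\<close>
  define U where "U = (\<Union>j\<in>{q..J}. \<Union>i\<in>{..<2 ^ j}. S j i)"
  have pt: "0 \<le> c * real i / 2 ^ j" for i j using c by simp
  have S_ev: "S j i \<in> events" for j i
    unfolding S_def using centered_measurable[OF pt[of i j]] centered_measurable[OF pt[of "Suc i" j]] by measurable
  have S_prob: "prob (S j i) \<le> (D + 3 * D\<^sup>2) / (A ^ 4) * (1 / (4 * \<rho> ^ 4)) ^ j" if j: "j \<le> J" for j i
  proof -
    let ?Y = "\<lambda>\<omega>. centered (c * real (Suc i) / 2 ^ j) \<omega> - centered (c * real i / 2 ^ j) \<omega>"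
    have le: "c * real i / 2 ^ j \<le> c * real (Suc i) / 2 ^ j"
      using c by (intro divide_right_mono mult_left_mono) auto
    define d where "d = total_rate * (c * real (Suc i) / 2 ^ j - c * real i / 2 ^ j)"
    have d_eq: "d = total_rate * c / 2 ^ j" by (simp add: d_def field_simps)
    have d0: "0 \<le> d" using total_rate_nonneg c by (simp add: d_eq)
    have d1: "d \<le> D * k / 2 ^ j" unfolding d_eq using D by (intro divide_right_mono) auto
    have kj: "2 ^ j \<le> k" using J(1) power_increasing[OF j, of "2 :: real"] by linarith
    have "prob (S j i) \<le> expectation (\<lambda>\<omega>. ?Y \<omega> ^ 4) / b j ^ 4"
      unfolding S_def
      using centered_measurable[OF pt[of i j]] centered_measurable[OF pt[of "Suc i" j]]
      by (intro fourth_moment_tail centered_increment_integrable pt b0) measurable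
    also have "\<dots> \<le> (d + 3 * d\<^sup>2) / b j ^ 4"
      using fourth_moment_increment[OF pt le] b0[of j] unfolding d_def[symmetric]
      by (intro divide_right_mono) auto
    also have "\<dots> \<le> ((D + 3 * D\<^sup>2) * (k / 2 ^ j)\<^sup>2) / b j ^ 4"
    proof (intro divide_right_mono)
      have "d \<le> D * (k / 2 ^ j) * 1" using d1 by simp
      \<comment> \<open>Up to level J the factor k / 2 ^ j is at least 1, so the Poissonian term is
        absorbed by the quadratic one.\<close>
      also have "\<dots> \<le> D * (k / 2 ^ j) * (k / 2 ^ j)" using kj D k0 by (intro mult_left_mono) auto
      finally have "d \<le> D * (k / 2 ^ j)\<^sup>2" by (simp add: power2_eq_square)
      moreover have "d\<^sup>2 \<le> (D * (k / 2 ^ j))\<^sup>2" using d0 d1 by (intro power_mono) auto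
      ultimately show "d + 3 * d\<^sup>2 \<le> (D + 3 * D\<^sup>2) * (k / 2 ^ j)\<^sup>2"
        unfolding distrib_right power_mult_distrib[of D] by linarith
    qed simp
    also have "\<dots> = (D + 3 * D\<^sup>2) / A ^ 4 * (1 / (4 * \<rho> ^ 4)) ^ j"
    proof -
      have "b j ^ 4 = k\<^sup>2 * (A ^ 4 * (\<rho> ^ 4) ^ j)"
      proof -
        have "sqrt k ^ 4 = (sqrt k ^ 2) ^ 2" by (simp add: power_mult[symmetric])
        then have "sqrt k ^ 4 = k\<^sup>2" using k0 by simp
        then show ?thesis by (simp add: b_def power_mult_distrib power_mult[symmetric] mult.commute)
      qed
      moreover have "((2 :: real) ^ j)\<^sup>2 = 4 ^ j" by (simp add: power_mult[symmetric] power_mult mult.commute power2_eq_square flip: power_mult_distrib)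
      moreover have "(x * (k\<^sup>2 / 4 ^ j)) / (k\<^sup>2 * (y * w)) = x / y * (1 / (4 ^ j * w))" for x y w :: real
        using k0 by simp
      ultimately show ?thesis
        by (simp only: power_divide power_mult_distrib power_one)
    qed
    finally show ?thesis .
  qed
  have U_ev: "U \<in> events" unfolding U_def using S_ev by (intro sets.finite_UN) auto
  define r where "r = (5000 / 6561 :: real)"
  have r: "2 * (1 / (4 * \<rho> ^ 4)) = r" by (simp add: r_def \<rho>_def power4_eq_xxxx)
  let ?K = "(D + 3 * D\<^sup>2) / A ^ 4"
  have K0: "0 \<le> ?K" using D A by simp
  have "prob U \<le> (\<Sum>j\<in>{q..J}. \<Sum>i<2 ^ j. prob (S j i))"
  proof -
    have "prob U \<le> (\<Sum>j\<in>{q..J}. prob (\<Union>i\<in>{..<2 ^ j}. S j i))"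
      unfolding U_def using S_ev by (intro finite_measure_subadditive_finite) auto
    also have "\<dots> \<le> (\<Sum>j\<in>{q..J}. \<Sum>i<2 ^ j. prob (S j i))"
      using S_ev by (intro sum_mono finite_measure_subadditive_finite) auto
    finally show ?thesis .
  qed
  also have "\<dots> \<le> (\<Sum>j\<in>{q..J}. \<Sum>i<(2 :: nat) ^ j. ?K * (1 / (4 * \<rho> ^ 4)) ^ j)"
    using S_prob by (intro sum_mono) auto
  also have "\<dots> = (\<Sum>j\<in>{q..J}. ?K * r ^ j)"
    by (simp add: r[symmetric] power_mult_distrib mult_ac del: times_divide_eq_right times_divide_eq_left)
  also have "\<dots> = ?K * (\<Sum>j\<in>{q..J}. r ^ j)" by (simp add: sum_distrib_left)
  also have "\<dots> \<le> ?K * (r ^ q / (1 - r))"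
  proof (intro mult_left_mono K0)
    have "(\<Sum>j\<in>{q..J}. r ^ j) = (r ^ q - r ^ Suc J) / (1 - r)"
      using qJ by (subst sum_gp) (auto simp: r_def)
    also have "\<dots> \<le> r ^ q / (1 - r)" by (intro divide_right_mono) (auto simp: r_def)
    finally show "(\<Sum>j\<in>{q..J}. r ^ j) \<le> r ^ q / (1 - r)" .
  qed
  \<comment> \<open>Here 1 / (1 - r) is 6561 / 1561, which is less than 5.\<close>
  also have "\<dots> \<le> ?K * (5 * r ^ q)"
    by (intro mult_left_mono K0) (simp add: r_def)
  finally have U_prob: "prob U \<le> 5 * (D + 3 * D\<^sup>2) / A ^ 4 * (5000 / 6561) ^ q"
    by (simp only: r_def times_divide_eq_left times_divide_eq_right mult_ac)
  have "\<bar>centered t \<omega> - centered (grid_floor c (2 ^ q) t) \<omega>\<bar> \<le> 20 * A * sqrt k * (9 / 10) ^ q + 2 * D"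
    if \<omega>: "\<omega> \<in> space M - U" and t: "t \<in> {0..c}" for \<omega> t
  proof -
    have good: "\<bar>centered (c * real (Suc i) / 2 ^ j) \<omega> - centered (c * real i / 2 ^ j) \<omega>\<bar> \<le> b j"
      if "q \<le> j" "j \<le> J" "i < 2 ^ j" for j i
    proof (rule ccontr)
      assume "\<not> ?thesis"
      then have "\<omega> \<in> S j i" using \<omega> by (simp add: S_def)
      moreover have "j \<in> {q..J}" "i \<in> {..<2 ^ j}" using that by simp_all
      ultimately have "\<omega> \<in> U" unfolding U_def by (intro UN_I)
      then show False using \<omega> by simp
    qed
    define i where "i = nat \<lfloor>t * 2 ^ J / c\<rfloor>"
    have i_le: "i \<le> 2 ^ J" using grid_index_le[OF c t, of "2 ^ J"] by (simp add: i_def)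
    define s where "s = c * real i / 2 ^ J"
    have s_eq: "s = grid_floor c (2 ^ J) t" using grid_floor_index[OF c t, of "2 ^ J"] by (simp add: s_def i_def)
    have s: "0 \<le> s" "s \<le> t" "t \<le> s + c / 2 ^ J"
      using grid_floor_bounds[OF c _ t, of "2 ^ J"] by (auto simp: s_eq)
    have "\<bar>centered s \<omega> - centered (grid_floor c (2 ^ q) t) \<omega>\<bar> \<le> (\<Sum>j\<in>{q<..J}. b j)"
      unfolding grid_floor_coarsen[OF c t qJ] s_def i_def[symmetric]
      by (rule dyadic_chaining[OF qJ _ i_le, of "\<lambda>t. centered t \<omega>"]) (use good in auto)
    moreover have "\<bar>centered t \<omega> - centered s \<omega>\<bar> \<le> b J + 2 * D"
    \<comment> \<open>The last index is reached at t = c only. There is no cell to its right, but t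
      is then itself the grid point.\<close>
    proof (cases "i = 2 ^ J")
      case True
      then have "s = t" using s t by (simp add: s_def)
      then show ?thesis using b0[of J] D by simp
    next
      case False
      let ?u = "c * real (Suc i) / 2 ^ J"
      have u: "?u = s + c / 2 ^ J" by (simp add: s_def field_simps)
      have "\<bar>centered t \<omega> - centered s \<omega>\<bar> \<le> \<bar>centered ?u \<omega> - centered s \<omega>\<bar> + total_rate * (?u - s)"
        by (rule centered_between) (use \<omega> s u in auto)
      moreover have "\<bar>centered ?u \<omega> - centered s \<omega>\<bar> \<le> b J"
        unfolding s_def by (rule good) (use qJ False i_le in auto)
      moreover have "total_rate * (?u - s) \<le> 2 * D"
      proof -
        have "total_rate * (?u - s) = total_rate * c / 2 ^ J" unfolding u by simp
        also have "\<dots> \<le> D * k / 2 ^ J" using D by (intro divide_right_mono) auto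
        also have "\<dots> \<le> D * 2 ^ Suc J / 2 ^ J" using J D by (intro divide_right_mono mult_left_mono) auto
        finally show ?thesis by simp
      qed
      ultimately show ?thesis by linarith
    qed
    \<comment> \<open>The geometric series contributes the factor 1 / (1 - 9 / 10) = 10 and the last
      cell at most 1 more; 20 is a generous round bound.\<close>
    moreover have "(\<Sum>j\<in>{q<..J}. b j) + b J \<le> 20 * A * sqrt k * \<rho> ^ q"
    proof -
      have "(\<Sum>j\<in>{q<..J}. b j) \<le> (\<Sum>j\<in>{q..J}. b j)"
        using b0 by (intro sum_mono2) (auto intro: less_imp_le)
      also have "\<dots> = sqrt k * A * ((\<rho> ^ q - \<rho> ^ Suc J) / (1 - \<rho>))"
        using qJ by (simp add: b_def sum_distrib_left[symmetric] mult.assoc[symmetric], subst sum_gp) (auto simp: \<rho>_def)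
      also have "\<dots> \<le> sqrt k * A * (\<rho> ^ q / (1 - \<rho>))"
        using A k0 by (intro mult_left_mono divide_right_mono) (auto simp: \<rho>_def)
      also have "\<dots> = 10 * (sqrt k * A * \<rho> ^ q)" by (simp add: \<rho>_def)
      finally have 1: "(\<Sum>j\<in>{q<..J}. b j) \<le> 10 * (sqrt k * A * \<rho> ^ q)" .
      have "\<rho> ^ J \<le> \<rho> ^ q" using qJ by (intro power_decreasing) (auto simp: \<rho>_def)
      then have "b J \<le> sqrt k * A * \<rho> ^ q" unfolding b_def mult.assoc[symmetric]
        using A k0 by (intro mult_left_mono) auto
      moreover have "0 \<le> sqrt k * A * \<rho> ^ q" using A k0 by (simp add: \<rho>_def)
      ultimately show ?thesis using 1 by (simp add: mult_ac)
    qed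
    ultimately show ?thesis unfolding \<rho>_def by linarith
  qed
  then show ?thesis using that U_ev U_prob by blast
qed

text \<open>Interchanging the sums turns a combination of increments into a sum over edges of the
  independent variables \<open>w (arrival e)\<close>, where w takes the value
  \<open>\<theta> j\<close> on the j-th time cell. The variance v falls short of the expected sum of
  squares by the squared means only, and these are controlled by \<open>square_rate\<close>.\<close>

lemma char_increments_approx:
  fixes u :: "nat \<Rightarrow> real" and \<theta> :: "nat \<Rightarrow> real" and k :: nat
  assumes u: "0 \<le> u 0" "mono u"
  defines "C \<equiv> \<Sum>j<k. \<bar>\<theta> j\<bar>"
  obtains v where "\<bar>v - (\<Sum>j<k. (\<theta> j)\<^sup>2 * (mean_count (u (Suc j)) - mean_count (u j)))\<bar> \<le> C\<^sup>2 * (u k)\<^sup>2 * square_rate"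
    "cmod (expectation (\<lambda>\<omega>. iexp (\<epsilon> * (\<Sum>j<k. \<theta> j * (centered (u (Suc j)) \<omega> - centered (u j) \<omega>)))) - exp (- (\<epsilon>\<^sup>2 * v / 2)))
      \<le> \<epsilon>\<^sup>2 * v * (\<bar>\<epsilon>\<bar> * C + \<epsilon>\<^sup>2 * C\<^sup>2)"
proof -
  let ?I = "\<lambda>j x. indicator {u j<..u (Suc j)} x :: real"
  define w where "w x = (\<Sum>j<k. \<theta> j * ?I j x)" for x
  define W where "W e \<omega> = w (arrival e \<omega>)" for e \<omega>
  have u0: "0 \<le> u j" and uS: "u j \<le> u (Suc j)" for j
    using u monoD[OF u(2), of 0 j] monoD[OF u(2), of j "Suc j"] by auto
  have C0: "0 \<le> C" unfolding C_def by (intro sum_nonneg) auto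
  have wC: "\<bar>w x\<bar> \<le> C" for x
  proof -
    have "\<bar>w x\<bar> \<le> (\<Sum>j<k. \<bar>\<theta> j * ?I j x\<bar>)" unfolding w_def by (rule sum_abs)
    also have "\<dots> \<le> C" unfolding C_def by (intro sum_mono) (auto simp: indicator_def)
    finally show ?thesis .
  qed
  \<comment> \<open>The time cells are disjoint, so squaring w produces no cross terms.\<close>
  have disj: "?I i x * ?I j x = (if i = j then ?I i x else 0)" for i j x
  proof -
    have "\<not> (x \<in> {u i<..u (Suc i)} \<and> x \<in> {u j<..u (Suc j)})" if "i < j" for i j
      using monoD[OF u(2), of "Suc i" j] that by auto
    from this[of i j] this[of j i] show ?thesis by (cases i j rule: linorder_cases) (auto simp: indicator_def)
  qed
  have w_sq: "(w x)\<^sup>2 = (\<Sum>j<k. (\<theta> j)\<^sup>2 * ?I j x)" for x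
  proof -
    have "(w x)\<^sup>2 = (\<Sum>i<k. \<Sum>j<k. (\<theta> i * \<theta> j) * (?I i x * ?I j x))"
      unfolding w_def power2_eq_square sum_product by (intro sum.cong refl) (simp only: mult_ac)
    also have "\<dots> = (\<Sum>i<k. \<Sum>j<k. if i = j then (\<theta> i)\<^sup>2 * ?I i x else 0)"
      unfolding disj by (intro sum.cong refl) (auto simp: power2_eq_square)
    finally show ?thesis by simp
  qed
  have int_I: "integrable M (\<lambda>\<omega>. ?I j (arrival e \<omega>))" if "e \<in> all_edges z" for e j
    using arrival_measurable[OF that] by (intro integrable_bounded[where C = 1]) (auto simp: indicator_def)
  have EI: "expectation (\<lambda>\<omega>. ?I j (arrival e \<omega>)) = arrived e (u (Suc j)) - arrived e (u j)" if "e \<in> all_edges z" for e j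
    by (rule prob_arrival_between[OF that u0 uS])
  have EW: "expectation (W e) = (\<Sum>j<k. \<theta> j * (arrived e (u (Suc j)) - arrived e (u j)))" if e: "e \<in> all_edges z" for e
  proof -
    have "expectation (W e) = (\<Sum>j<k. expectation (\<lambda>\<omega>. \<theta> j * ?I j (arrival e \<omega>)))"
      unfolding W_def w_def by (rule Bochner_Integration.integral_sum) (intro integrable_mult_right int_I e)
    then show ?thesis by (simp only: integral_mult_right_zero EI[OF e])
  qed
  have EW2: "expectation (\<lambda>\<omega>. (W e \<omega>)\<^sup>2) = (\<Sum>j<k. (\<theta> j)\<^sup>2 * (arrived e (u (Suc j)) - arrived e (u j)))" if e: "e \<in> all_edges z" for e
  proof -
    have "expectation (\<lambda>\<omega>. (W e \<omega>)\<^sup>2) = (\<Sum>j<k. expectation (\<lambda>\<omega>. (\<theta> j)\<^sup>2 * ?I j (arrival e \<omega>)))"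
      unfolding W_def w_sq by (rule Bochner_Integration.integral_sum) (intro integrable_mult_right int_I e)
    then show ?thesis by (simp only: integral_mult_right_zero EI[OF e])
  qed
  have wm: "w \<in> borel_measurable borel" unfolding w_def by measurable
  have Wm: "W e \<in> borel_measurable M" if "e \<in> all_edges z" for e
    unfolding W_def by (rule measurable_compose[OF arrival_measurable[OF that] wm])
  have var: "variance (W e) = expectation (\<lambda>\<omega>. (W e \<omega>)\<^sup>2) - (expectation (W e))\<^sup>2" if e: "e \<in> all_edges z" for e
  proof (rule variance_eq)
    show "integrable M (W e)" by (rule integrable_bounded[OF Wm[OF e], of C]) (simp add: W_def wC)
    show "integrable M (\<lambda>\<omega>. (W e \<omega>)\<^sup>2)"
    proof (rule integrable_bounded)
      fix \<omega> show "norm ((W e \<omega>)\<^sup>2) \<le> C\<^sup>2" using power_mono[OF wC, of "arrival e \<omega>" 2] by (simp add: W_def)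
    qed (use Wm[OF e] in measurable)
  qed
  have EW_le: "(expectation (W e))\<^sup>2 \<le> C\<^sup>2 * (u k)\<^sup>2 * (rate e)\<^sup>2" if e: "e \<in> all_edges z" for e
  proof -
    have "\<bar>expectation (W e)\<bar> \<le> (\<Sum>j<k. \<bar>\<theta> j * (arrived e (u (Suc j)) - arrived e (u j))\<bar>)"
      unfolding EW[OF e] by (rule sum_abs)
    also have "\<dots> \<le> (\<Sum>j<k. \<bar>\<theta> j\<bar> * (rate e * u k))"
    proof (rule sum_mono)
      fix j assume j: "j \<in> {..<k}"
      have "\<bar>arrived e (u (Suc j)) - arrived e (u j)\<bar> \<le> rate e * (u (Suc j) - u j)"
        using arrived_mono[OF e uS] arrived_increment_le[OF e u0 uS] by simp
      also have "\<dots> \<le> rate e * u k"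
        using rate_pos[OF e] u0[of j] monoD[OF u(2), of "Suc j" k] j by (intro mult_left_mono) auto
      finally show "\<bar>\<theta> j * (arrived e (u (Suc j)) - arrived e (u j))\<bar> \<le> \<bar>\<theta> j\<bar> * (rate e * u k)"
        by (simp add: abs_mult mult_left_mono)
    qed
    also have "\<dots> = C * (rate e * u k)" by (simp add: C_def sum_distrib_right)
    finally have "\<bar>expectation (W e)\<bar>\<^sup>2 \<le> (C * (rate e * u k))\<^sup>2" by (intro power_mono) auto
    then show ?thesis by (simp add: power_mult_distrib mult_ac)
  qed
  have ind: "indep_vars (\<lambda>_. borel) W (all_edges z)"
    unfolding W_def by (rule indep_vars_compose2[OF arrival(1), where Y = "\<lambda>_. w"]) (rule wm)
  define v where "v = (\<Sum>e\<in>all_edges z. variance (W e))"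
  show ?thesis
  proof (rule that[of v])
    have "v - (\<Sum>j<k. (\<theta> j)\<^sup>2 * (mean_count (u (Suc j)) - mean_count (u j))) = - (\<Sum>e\<in>all_edges z. (expectation (W e))\<^sup>2)"
    proof -
      have "(\<Sum>j<k. (\<theta> j)\<^sup>2 * (mean_count (u (Suc j)) - mean_count (u j))) = (\<Sum>e\<in>all_edges z. expectation (\<lambda>\<omega>. (W e \<omega>)\<^sup>2))"
        unfolding mean_count_def sum_subtractf[symmetric] sum_distrib_left
        by (subst sum.swap) (intro sum.cong refl EW2[symmetric])
      moreover have "v = (\<Sum>e\<in>all_edges z. expectation (\<lambda>\<omega>. (W e \<omega>)\<^sup>2)) - (\<Sum>e\<in>all_edges z. (expectation (W e))\<^sup>2)"
        unfolding v_def sum_subtractf[symmetric] by (intro sum.cong refl var)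
      ultimately show ?thesis by simp
    qed
    moreover have "0 \<le> (\<Sum>e\<in>all_edges z. (expectation (W e))\<^sup>2)" by (intro sum_nonneg) auto
    moreover have "(\<Sum>e\<in>all_edges z. (expectation (W e))\<^sup>2) \<le> C\<^sup>2 * (u k)\<^sup>2 * square_rate"
      unfolding square_rate_def sum_distrib_left by (intro sum_mono EW_le)
    ultimately show "\<bar>v - (\<Sum>j<k. (\<theta> j)\<^sup>2 * (mean_count (u (Suc j)) - mean_count (u j)))\<bar> \<le> C\<^sup>2 * (u k)\<^sup>2 * square_rate"
      by simp
    have eq: "(\<Sum>j<k. \<theta> j * (centered (u (Suc j)) \<omega> - centered (u j) \<omega>)) = (\<Sum>e\<in>all_edges z. W e \<omega> - expectation (W e))"
      if \<omega>: "\<omega> \<in> space M" for \<omega>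
    proof -
      have "(\<Sum>j<k. \<theta> j * (centered (u (Suc j)) \<omega> - centered (u j) \<omega>)) =
          (\<Sum>j<k. \<Sum>e\<in>all_edges z. \<theta> j * (?I j (arrival e \<omega>) - (arrived e (u (Suc j)) - arrived e (u j))))"
        using centered_increment[OF \<omega> u0 uS] by (simp only: sum_distrib_left)
      also have "\<dots> = (\<Sum>e\<in>all_edges z. \<Sum>j<k. \<theta> j * (?I j (arrival e \<omega>) - (arrived e (u (Suc j)) - arrived e (u j))))"
        by (rule sum.swap)
      also have "\<dots> = (\<Sum>e\<in>all_edges z. W e \<omega> - expectation (W e))"
        by (intro sum.cong refl) (simp add: EW W_def w_def sum_subtractf right_diff_distrib)
      finally show ?thesis .
    qed
    have "expectation (\<lambda>\<omega>. iexp (\<epsilon> * (\<Sum>j<k. \<theta> j * (centered (u (Suc j)) \<omega> - centered (u j) \<omega>)))) =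
        expectation (\<lambda>\<omega>. iexp (\<epsilon> * (\<Sum>e\<in>all_edges z. W e \<omega> - expectation (W e))))"
      by (intro Bochner_Integration.integral_cong refl) (simp only: eq)
    then show "cmod (expectation (\<lambda>\<omega>. iexp (\<epsilon> * (\<Sum>j<k. \<theta> j * (centered (u (Suc j)) \<omega> - centered (u j) \<omega>)))) - exp (- (\<epsilon>\<^sup>2 * v / 2)))
      \<le> \<epsilon>\<^sup>2 * v * (\<bar>\<epsilon>\<bar> * C + \<epsilon>\<^sup>2 * C\<^sup>2)"
      unfolding v_def
      using char_sum_gaussian_approx[OF finite_edges ind _ C0, of \<epsilon>] by (simp add: W_def wC)
  qed
qed

section \<open>From edges to components\<close>

definition cycle_count :: "real \<Rightarrow> 'w \<Rightarrow> real" where "cycle_count t \<omega> = real (card (cycle_edges (G t \<omega>)))"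

lemma components_bounds:
  assumes "\<omega> \<in> space M" "0 \<le> t"
  shows "0 \<le> K_proc z G t \<omega> + edge_count t \<omega> - card (vertices z)"
    "K_proc z G t \<omega> + edge_count t \<omega> - card (vertices z) \<le> cycle_count t \<omega>"
proof -
  have "G t \<omega> \<subseteq> all_edges z" using arrival(3)[OF assms] by auto
  then have "finite (G t \<omega>)" "G t \<omega> \<subseteq> edge_pairs (vertices z)"
    using finite_edges finite_subset by (auto simp: all_edges_eq)
  from num_components_bounds[OF finite_vertices this]
  show "0 \<le> K_proc z G t \<omega> + edge_count t \<omega> - card (vertices z)"
    "K_proc z G t \<omega> + edge_count t \<omega> - card (vertices z) \<le> cycle_count t \<omega>"
    unfolding K_proc_def edge_count_def cycle_count_def by linarith+
qed

text \<open>Monotonicity makes a tail bound at the end of a time interval uniform over the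
  interval.\<close>

lemma cycle_count_mono:
  assumes "\<omega> \<in> space M" "0 \<le> s" "s \<le> t"
  shows "cycle_count s \<omega> \<le> cycle_count t \<omega>"
proof -
  have "G s \<omega> \<subseteq> G t \<omega>" "finite (G t \<omega>)" using assms finite_edges by (auto simp: arrival(3))
  then show ?thesis unfolding cycle_count_def
    by (intro of_nat_mono card_mono cycle_edges_mono) (auto simp: cycle_edges_def)
qed

lemma cycle_count_tail:
  assumes t: "0 \<le> t" and sub: "(\<Sum>i\<in>vertices z. (z i)\<^sup>2) * t < 1" and a: "0 < a"
  defines "s \<equiv> (\<Sum>i\<in>vertices z. (z i)\<^sup>2) * t"
  shows "{\<omega> \<in> space M. a < cycle_count t \<omega>} \<in> events"
    "prob {\<omega> \<in> space M. a < cycle_count t \<omega>} \<le> s\<^sup>2 / (1 - s) / a"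
proof -
  let ?X = "\<lambda>e \<omega>. arrival e \<omega> \<le> t" and ?V = "vertices z"
  let ?Y = "\<lambda>\<omega>. real (card (cycle_edges {e \<in> edge_pairs ?V. ?X e \<omega>}))"
  have ind: "indep_vars (\<lambda>_. count_space UNIV) ?X (edge_pairs ?V)"
    by (rule indep_vars_compose2[OF arrival(1)[unfolded all_edges_eq], where Y = "\<lambda>_ x. x \<le> t"]) measurable
  have p: "prob {\<omega> \<in> space M. ?X {i, j} \<omega>} \<le> z i * z j * t" if "i \<in> ?V" "j \<in> ?V" "i \<noteq> j" for i j
  proof -
    have e: "{i, j} \<in> all_edges z" using that by (auto simp: all_edges_def)
    show ?thesis using arrived_increment_le[OF e order_refl t] prob_arrival[OF e t] that
      by (simp add: arrived_def rate_def)
  qed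
  have z0: "0 \<le> z i" if "i \<in> ?V" for i using that by (simp add: vertices_def)
  have Ym: "?Y \<in> borel_measurable M" and EY: "expectation ?Y \<le> s\<^sup>2 / (1 - s)"
    unfolding s_def by (rule expectation_cycle_edges_le[OF finite_vertices ind p z0 t sub]; assumption)+
  have Yc: "cycle_count t \<omega> = ?Y \<omega>" if "\<omega> \<in> space M" for \<omega>
    using arrival(3)[OF that t] by (simp add: cycle_count_def all_edges_eq)
  have eq: "{\<omega> \<in> space M. a < cycle_count t \<omega>} = {\<omega> \<in> space M. a < ?Y \<omega>}" using Yc by auto
  show ev: "{\<omega> \<in> space M. a < cycle_count t \<omega>} \<in> events" unfolding eq using Ym by measurable
  have int: "integrable M ?Y"
  proof (rule integrable_bounded[OF Ym])
    fix \<omega>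
    have "card (cycle_edges {e \<in> edge_pairs ?V. ?X e \<omega>}) \<le> card (edge_pairs ?V)"
      using finite_edge_pairs[OF finite_vertices] by (intro card_mono) (auto simp: cycle_edges_def)
    then show "norm (?Y \<omega>) \<le> card (edge_pairs ?V)" by simp
  qed
  have "a * prob {\<omega> \<in> space M. a < ?Y \<omega>} = expectation (\<lambda>\<omega>. a * indicator {\<omega> \<in> space M. a < ?Y \<omega>} \<omega>)"
    by (simp add: Int_absorb2)
  also have "\<dots> \<le> expectation ?Y"
  proof (rule integral_mono[OF _ int])
    show "integrable M (\<lambda>\<omega>. a * indicator {\<omega> \<in> space M. a < ?Y \<omega>} \<omega>)"
      using ev unfolding eq by (intro integrable_mult_right integrable_real_indicator) (auto simp: emeasure_eq_measure)
  qed (auto simp: indicator_def)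
  finally have "a * prob {\<omega> \<in> space M. a < ?Y \<omega>} \<le> s\<^sup>2 / (1 - s)" using EY by simp
  then show "prob {\<omega> \<in> space M. a < cycle_count t \<omega>} \<le> s\<^sup>2 / (1 - s) / a"
    unfolding eq pos_le_divide_eq[OF a] by (simp add: mult.commute)
qed

text \<open>Any function of the graph changes at arrival times only. Times after c are discarded,
  and none is at or before 0 by \<open>arrival_pos\<close>.\<close>

lemma count_step_on:
  assumes "\<omega> \<in> space M"
  shows "\<exists>F. step_on c F (\<lambda>t. f (G t \<omega>)) \<and> F \<subseteq> {0<..c}"
proof (intro exI conjI)
  let ?F = "(\<lambda>e. arrival e \<omega>) ` all_edges z \<inter> {0<..c}"
  show "step_on c ?F (\<lambda>t. f (G t \<omega>))"
    unfolding step_on_def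
  proof (intro conjI ballI impI)
    fix u v assume uv: "u \<in> {0..c}" "v \<in> {0..c}" and F: "\<forall>q\<in>?F. q \<le> u \<longleftrightarrow> q \<le> v"
    have "arrival e \<omega> \<le> u \<longleftrightarrow> arrival e \<omega> \<le> v" if "e \<in> all_edges z" for e
      using F uv that arrival_pos[OF that assms] by (cases "arrival e \<omega> \<le> c") auto
    then have "G u \<omega> = G v \<omega>" using uv assms by (auto simp: arrival(3))
    then show "f (G u \<omega>) = f (G v \<omega>)" by simp
  qed (use finite_edges in auto)
qed auto

lemma K_proc_measurable: "0 \<le> t \<Longrightarrow> (\<lambda>\<omega>. real (K_proc z G t \<omega>)) \<in> borel_measurable M"
proof -
  assume t: "0 \<le> t"
  have "(\<lambda>\<omega>. {e \<in> all_edges z. arrival e \<omega> \<le> t}) \<in> measurable M (count_space UNIV)"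
    by (rule measurable_random_set[OF finite_edges]) measurable
  from measurable_compose[OF this, of "\<lambda>E. real (num_components (vertices z) E)" borel]
  have "(\<lambda>\<omega>. real (num_components (vertices z) {e \<in> all_edges z. arrival e \<omega> \<le> t})) \<in> borel_measurable M"
    by simp
  then show ?thesis
    by (rule measurable_cong[THEN iffD1, rotated]) (simp add: K_proc_def arrival(3) t)
qed

end

section \<open>Sequences of multiplicative graph processes\<close>

lemma step_on_scale:
  assumes s: "0 < \<sigma>" and st: "step_on (c / \<sigma>) F f"
  shows "step_on c ((\<lambda>q. \<sigma> * q) ` F) (\<lambda>t. f (t / \<sigma>))"
  unfolding step_on_def
proof (intro conjI ballI impI)
  fix u v assume uv: "u \<in> {0..c}" "v \<in> {0..c}" and F: "\<forall>q\<in>(\<lambda>q. \<sigma> * q) ` F. q \<le> u \<longleftrightarrow> q \<le> v"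
  show "f (u / \<sigma>) = f (v / \<sigma>)"
  proof (rule step_onD[OF st])
    show "u / \<sigma> \<in> {0..c / \<sigma>}" "v / \<sigma> \<in> {0..c / \<sigma>}" using uv s by (auto intro: divide_right_mono)
    fix q assume "q \<in> F"
    then have "\<sigma> * q \<le> u \<longleftrightarrow> \<sigma> * q \<le> v" using F by blast
    then show "q \<le> u / \<sigma> \<longleftrightarrow> q \<le> v / \<sigma>" using s by (simp add: pos_le_divide_eq mult.commute)
  qed
qed (use st in \<open>simp add: step_on_def\<close>)

lemma grid_floor_scale: "\<sigma> \<noteq> 0 \<Longrightarrow> grid_floor (c / \<sigma>) m (t / \<sigma>) = grid_floor c m t / \<sigma>"
  by (simp add: grid_floor_def)

lemma grid_path_eq:
  assumes "0 \<le> c"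
  shows "grid_path c m (\<lambda>j. x (c * real j / real m)) = (\<lambda>t\<in>{0..c}. x (grid_floor c m t))"
  unfolding grid_path_def by (rule restrict_ext) (simp add: grid_floor_index[OF assms])

text \<open>Off the exceptional event S the Lipschitz bound applies, and on S the two values differ
  by at most 2 * C. This is how a random path is replaced by a close one inside an
  expectation.\<close>

lemma J1_lipschitz_expectation:
  assumes P: "prob_space P" and X: "X \<in> measurable P (borel_of (J1_topology c))"
    and Y: "Y \<in> measurable P (borel_of (J1_topology c))"
    and C: "\<And>x. x \<in> cadlag_space c \<Longrightarrow> \<bar>f x\<bar> \<le> C"
    and L: "0 \<le> L" "\<And>x y. x \<in> cadlag_space c \<Longrightarrow> y \<in> cadlag_space c \<Longrightarrow> \<bar>f x - f y\<bar> \<le> L * J1_dist c x y"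
    and S: "S \<in> sets P" and close: "\<And>\<omega>. \<omega> \<in> space P - S \<Longrightarrow> J1_dist c (X \<omega>) (Y \<omega>) \<le> r" and r: "0 \<le> r"
  shows "\<bar>(\<integral>\<omega>. f (X \<omega>) \<partial>P) - (\<integral>\<omega>. f (Y \<omega>) \<partial>P)\<bar> \<le> L * r + 2 * C * measure P S"
proof -
  interpret prob_space P by (rule P)
  have fm: "f \<in> borel_measurable (borel_of (J1_topology c))"
    unfolding J1_topology_def
    by (intro continuous_map_borel_measurable Metric_space.lipschitz_continuous_map[OF Metric_space_J1 L(2)])
  have XY: "X \<omega> \<in> cadlag_space c" "Y \<omega> \<in> cadlag_space c" if "\<omega> \<in> space P" for \<omega>
    using measurable_space[OF X that] measurable_space[OF Y that] by simp_all
  have i: "integrable P (\<lambda>\<omega>. f (X \<omega>))" "integrable P (\<lambda>\<omega>. f (Y \<omega>))"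
    using measurable_compose[OF X fm] measurable_compose[OF Y fm] C XY
    by (auto intro!: integrable_bounded[where C = C])
  have iS: "integrable P (\<lambda>\<omega>. L * r + 2 * C * indicator S \<omega>)"
    using S by (intro Bochner_Integration.integrable_add integrable_mult_right integrable_real_indicator integrable_const)
      (auto simp: emeasure_eq_measure)
  have "\<bar>(\<integral>\<omega>. f (X \<omega>) \<partial>P) - (\<integral>\<omega>. f (Y \<omega>) \<partial>P)\<bar> = \<bar>\<integral>\<omega>. f (X \<omega>) - f (Y \<omega>) \<partial>P\<bar>" using i by simp
  also have "\<dots> \<le> (\<integral>\<omega>. \<bar>f (X \<omega>) - f (Y \<omega>)\<bar> \<partial>P)" by (rule integral_abs_bound)
  also have "\<dots> \<le> (\<integral>\<omega>. L * r + 2 * C * indicator S \<omega> \<partial>P)"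
  proof (rule integral_mono)
    fix \<omega> assume \<omega>: "\<omega> \<in> space P"
    show "\<bar>f (X \<omega>) - f (Y \<omega>)\<bar> \<le> L * r + 2 * C * indicator S \<omega>"
    proof (cases "\<omega> \<in> S")
      case True
      have "0 \<le> L * r" using L r by simp
      then show ?thesis using True C[OF XY(1)[OF \<omega>]] C[OF XY(2)[OF \<omega>]] by simp
    next
      case False
      have "\<bar>f (X \<omega>) - f (Y \<omega>)\<bar> \<le> L * J1_dist c (X \<omega>) (Y \<omega>)" by (rule L(2)[OF XY[OF \<omega>]])
      also have "\<dots> \<le> L * r" using close \<omega> False L by (intro mult_left_mono) auto
      finally show ?thesis using False by simp
    qed
  qed (use i iS in auto)
  also have "\<dots> = L * r + 2 * C * measure P S"
    using S by (subst Bochner_Integration.integral_add)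
      (auto simp: prob_space emeasure_eq_measure intro!: integrable_real_indicator)
  finally show ?thesis .
qed

section \<open>Asymptotics of the edge count in scaled time\<close>

locale graph_sequence =
  fixes M :: "nat \<Rightarrow> 'w measure" and z :: "nat \<Rightarrow> nat \<Rightarrow> real" and G :: "nat \<Rightarrow> real \<Rightarrow> 'w \<Rightarrow> nat set set"
    and \<kappa>' \<sigma>' :: "nat \<Rightarrow> real" and \<alpha> :: real and \<kappa> \<sigma>1 \<sigma>2 :: "nat \<Rightarrow> real"
  assumes process: "\<And>n. finite_mult_graph_process (M n) (z n) (G n)"
    and \<kappa>: "\<And>n. \<kappa> n = real (card (vertices (z n)))"
    and \<sigma>1: "\<And>n. \<sigma>1 n = (\<Sum>i\<in>vertices (z n). z n i)"
    and \<sigma>2: "\<And>n. \<sigma>2 n = (\<Sum>i\<in>vertices (z n). (z n i)\<^sup>2)"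
    and kappa_infinity: "filterlim \<kappa> at_top sequentially"
    and kappa_lim: "(\<lambda>n. \<kappa> n / \<kappa>' n) \<longlonglongrightarrow> 1"
    and sigma2_lim: "(\<lambda>n. \<sigma>2 n / \<sigma>' n) \<longlonglongrightarrow> 1"
    and alpha: "0 \<le> \<alpha>"
    and alpha_lim: "(\<lambda>n. (\<sigma>1 n)\<^sup>2 / (\<kappa>' n * \<sigma>' n)) \<longlonglongrightarrow> \<alpha>"
begin

sublocale g: finite_mult_graph_process "M n" "z n" "G n" for n
  by (rule process)

lemma eventually_positive: "\<forall>\<^sub>F n in sequentially. 0 < \<kappa>' n \<and> 0 < \<sigma>' n"
proof -
  have "\<forall>\<^sub>F n in sequentially. 1 \<le> \<kappa> n" using kappa_infinity by (simp add: filterlim_at_top)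
  moreover have "\<forall>\<^sub>F n in sequentially. 1 / 2 < \<kappa> n / \<kappa>' n" by (rule order_tendstoD(1)[OF kappa_lim]) simp
  moreover have "\<forall>\<^sub>F n in sequentially. 1 / 2 < \<sigma>2 n / \<sigma>' n" by (rule order_tendstoD(1)[OF sigma2_lim]) simp
  ultimately show ?thesis
  proof eventually_elim
    case (elim n)
    have "0 < \<sigma>2 n"
    proof -
      have "vertices (z n) \<noteq> {}" using elim(1) by (auto simp: \<kappa>)
      then show ?thesis unfolding \<sigma>2 using g.finite_vertices by (intro sum_pos) (auto simp: vertices_def)
    qed
    moreover have "0 < \<kappa> n / \<kappa>' n" "0 < \<sigma>2 n / \<sigma>' n" using elim by linarith+
    ultimately show ?case using elim(1) by (auto simp: zero_less_divide_iff)
  qed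
qed

lemma kappa'_infinity: "filterlim \<kappa>' at_top sequentially"
proof (rule filterlim_at_top_mono)
  show "filterlim (\<lambda>n. (1 / 2) * \<kappa> n) at_top sequentially"
    by (rule filterlim_tendsto_pos_mult_at_top[OF tendsto_const _ kappa_infinity]) simp
  have "\<forall>\<^sub>F n in sequentially. \<kappa> n / \<kappa>' n < 2" by (rule order_tendstoD(2)[OF kappa_lim]) simp
  with eventually_positive show "\<forall>\<^sub>F n in sequentially. (1 / 2) * \<kappa> n \<le> \<kappa>' n"
    by eventually_elim (simp add: field_simps)
qed

lemma sqrt_kappa'_infinity: "filterlim (\<lambda>n. sqrt (\<kappa>' n)) at_top sequentially"
  using filterlim_compose[OF sqrt_at_top kappa'_infinity] .

text \<open>The total rate is at most half of the squared total mass, so there is ample room; the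
  summand 1 covers finite n and the case \<alpha> = 0. With c quantified inside, one eventuality
  serves all subintervals.\<close>

lemma total_rate_le:
  "\<forall>\<^sub>F n in sequentially. \<forall>c. 0 \<le> c \<and> c \<le> 1 \<longrightarrow> g.total_rate n * (c / \<sigma>' n) \<le> (\<alpha> + 1) * \<kappa>' n"
proof -
  have "\<forall>\<^sub>F n in sequentially. (\<sigma>1 n)\<^sup>2 / (\<kappa>' n * \<sigma>' n) < \<alpha> + 1"
    by (rule order_tendstoD(2)[OF alpha_lim]) simp
  with eventually_positive show ?thesis
  proof eventually_elim
    case (elim n)
    have "0 \<le> \<sigma>2 n" unfolding \<sigma>2 by (intro sum_nonneg) auto
    then have "g.total_rate n \<le> (\<sigma>1 n)\<^sup>2 / 2" using g.total_rate_eq[of n] by (simp add: \<sigma>1 \<sigma>2)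
    also have "\<dots> \<le> (\<sigma>1 n)\<^sup>2" by simp
    also have "\<dots> \<le> (\<alpha> + 1) * \<kappa>' n * \<sigma>' n" using elim by (simp add: field_simps)
    finally have T: "g.total_rate n / \<sigma>' n \<le> (\<alpha> + 1) * \<kappa>' n" using elim by (simp add: field_simps)
    have T0: "0 \<le> g.total_rate n / \<sigma>' n" using g.total_rate_nonneg[of n] elim by simp
    have "g.total_rate n * (c / \<sigma>' n) \<le> (\<alpha> + 1) * \<kappa>' n" if "0 \<le> c" "c \<le> 1" for c
      using mult_right_mono[OF that(2) T0] T by (simp add: mult.commute)
    then show ?case by blast
  qed
qed

text \<open>The term t comes from the diagonal \<open>\<sigma>2 n\<close> subtracted in the total
  rate, the quadratic term from the curvature of the exponential distribution function; both use
  that \<open>\<sigma>2 n / \<sigma>' n\<close> is eventually below 2. A bounded number of edges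
  vanishes even after division by \<open>sqrt (\<kappa>' n)\<close>.\<close>

lemma mean_count_diff:
  "\<forall>\<^sub>F n in sequentially. \<forall>t\<ge>0. \<bar>g.mean_count n (t / \<sigma>' n) - t * (\<sigma>1 n)\<^sup>2 / (2 * \<sigma>' n)\<bar> \<le> t + 4 * t\<^sup>2"
proof -
  have "\<forall>\<^sub>F n in sequentially. \<sigma>2 n / \<sigma>' n < 2" by (rule order_tendstoD(2)[OF sigma2_lim]) simp
  with eventually_positive show ?thesis
  proof eventually_elim
    case (elim n)
    have s0: "0 \<le> \<sigma>2 n / \<sigma>' n" unfolding \<sigma>2 using elim by (intro divide_nonneg_pos sum_nonneg) auto
    show ?case
    proof (intro allI impI)
      fix t :: real assume t: "0 \<le> t"
      have "\<bar>g.mean_count n (t / \<sigma>' n) - g.total_rate n * (t / \<sigma>' n)\<bar> \<le> g.square_rate n * (t / \<sigma>' n)\<^sup>2"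
        using elim t by (intro g.mean_count_approx) auto
      also have "\<dots> \<le> (\<sigma>2 n)\<^sup>2 * (t / \<sigma>' n)\<^sup>2"
        using g.square_rate_le[of n] by (intro mult_right_mono) (auto simp: \<sigma>2)
      also have "\<dots> = (\<sigma>2 n / \<sigma>' n)\<^sup>2 * t\<^sup>2" by (simp add: power_divide)
      also have "\<dots> \<le> 2\<^sup>2 * t\<^sup>2" using s0 elim by (intro mult_right_mono power_mono) auto
      finally have 1: "\<bar>g.mean_count n (t / \<sigma>' n) - g.total_rate n * (t / \<sigma>' n)\<bar> \<le> 4 * t\<^sup>2" by simp
      have "g.total_rate n * (t / \<sigma>' n) - t * (\<sigma>1 n)\<^sup>2 / (2 * \<sigma>' n) = - (t * (\<sigma>2 n / \<sigma>' n) / 2)"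
        unfolding g.total_rate_eq \<sigma>1[symmetric] \<sigma>2[symmetric] using elim by (simp add: field_simps)
      moreover have "0 \<le> t * (\<sigma>2 n / \<sigma>' n)" "t * (\<sigma>2 n / \<sigma>' n) \<le> t * 2"
        using t s0 elim by (auto intro!: mult_left_mono simp del: times_divide_eq_right)
      moreover have "\<bar>m - b\<bar> \<le> t + 4 * t\<^sup>2"
        if "a - b = - (x / 2)" "0 \<le> x" "x \<le> t * 2" "\<bar>m - a\<bar> \<le> 4 * t\<^sup>2" for a b m x
        using that by linarith
      ultimately show "\<bar>g.mean_count n (t / \<sigma>' n) - t * (\<sigma>1 n)\<^sup>2 / (2 * \<sigma>' n)\<bar> \<le> t + 4 * t\<^sup>2"
        using 1 by blast
    qed
  qed
qed

lemma tendsto_over_kappa': "(\<lambda>n. a / \<kappa>' n) \<longlonglongrightarrow> 0" "(\<lambda>n. a / sqrt (\<kappa>' n)) \<longlonglongrightarrow> 0"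
  "(\<lambda>n. a / sqrt (sqrt (\<kappa>' n))) \<longlonglongrightarrow> 0"
proof -
  show "(\<lambda>n. a / \<kappa>' n) \<longlonglongrightarrow> 0" "(\<lambda>n. a / sqrt (\<kappa>' n)) \<longlonglongrightarrow> 0"
    by (rule real_tendsto_divide_at_top[OF tendsto_const], rule kappa'_infinity sqrt_kappa'_infinity)+
  show "(\<lambda>n. a / sqrt (sqrt (\<kappa>' n))) \<longlonglongrightarrow> 0"
    by (rule real_tendsto_divide_at_top[OF tendsto_const filterlim_compose[OF sqrt_at_top sqrt_kappa'_infinity]])
qed

lemma mean_count_lim:
  assumes t: "0 \<le> t"
  shows "(\<lambda>n. g.mean_count n (t / \<sigma>' n) / \<kappa>' n) \<longlonglongrightarrow> \<alpha> * t / 2"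
proof -
  have "(\<lambda>n. g.mean_count n (t / \<sigma>' n) / \<kappa>' n - t / 2 * ((\<sigma>1 n)\<^sup>2 / (\<kappa>' n * \<sigma>' n))) \<longlonglongrightarrow> 0"
  proof (rule Lim_null_comparison[OF _ tendsto_over_kappa'(1)[of "t + 4 * t\<^sup>2"]])
    show "\<forall>\<^sub>F n in sequentially. norm (g.mean_count n (t / \<sigma>' n) / \<kappa>' n - t / 2 * ((\<sigma>1 n)\<^sup>2 / (\<kappa>' n * \<sigma>' n)))
      \<le> (t + 4 * t\<^sup>2) / \<kappa>' n"
      using eventually_positive mean_count_diff
    proof eventually_elim
      case (elim n)
      have "g.mean_count n (t / \<sigma>' n) / \<kappa>' n - t / 2 * ((\<sigma>1 n)\<^sup>2 / (\<kappa>' n * \<sigma>' n)) =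
          (g.mean_count n (t / \<sigma>' n) - t * (\<sigma>1 n)\<^sup>2 / (2 * \<sigma>' n)) / \<kappa>' n"
        using elim by (simp add: field_simps)
      then have "norm (g.mean_count n (t / \<sigma>' n) / \<kappa>' n - t / 2 * ((\<sigma>1 n)\<^sup>2 / (\<kappa>' n * \<sigma>' n))) =
          \<bar>g.mean_count n (t / \<sigma>' n) - t * (\<sigma>1 n)\<^sup>2 / (2 * \<sigma>' n)\<bar> / \<kappa>' n"
        using elim by (simp add: abs_divide)
      then show ?case using elim t by (simp add: divide_right_mono)
    qed
  qed
  from tendsto_add[OF this tendsto_mult_left[OF alpha_lim, of "t / 2"]] show ?thesis by (simp add: mult.commute)
qed

text \<open>This disposes of the squared means that separate the variance in
  \<open>char_increments_approx\<close> from the increments of the mean count.\<close>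

lemma square_rate_lim: "(\<lambda>n. (a / \<sigma>' n)\<^sup>2 * g.square_rate n / \<kappa>' n) \<longlonglongrightarrow> 0"
proof -
  have lim: "(\<lambda>n. (a\<^sup>2 * (\<sigma>2 n / \<sigma>' n)\<^sup>2) * (1 / \<kappa>' n)) \<longlonglongrightarrow> a\<^sup>2 * 1\<^sup>2 * 0"
    by (intro tendsto_intros sigma2_lim tendsto_over_kappa')
  show ?thesis
  proof (rule Lim_null_comparison[OF _ lim[simplified]])
    show "\<forall>\<^sub>F n in sequentially. norm ((a / \<sigma>' n)\<^sup>2 * g.square_rate n / \<kappa>' n) \<le> a\<^sup>2 * (\<sigma>2 n / \<sigma>' n)\<^sup>2 / \<kappa>' n"
      using eventually_positive
    proof eventually_elim
      case (elim n)
      have "(a / \<sigma>' n)\<^sup>2 * g.square_rate n \<le> (a / \<sigma>' n)\<^sup>2 * (\<sigma>2 n)\<^sup>2"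
        using g.square_rate_le[of n] by (intro mult_left_mono) (auto simp: \<sigma>2)
      also have "\<dots> = a\<^sup>2 * (\<sigma>2 n / \<sigma>' n)\<^sup>2" by (simp add: power_divide)
      finally show ?case using elim g.square_rate_nonneg[of n] by (simp add: divide_right_mono)
    qed
  qed
qed

lemma char_increments_lim:
  fixes \<theta> u :: "nat \<Rightarrow> real" and k :: nat
  assumes u: "0 \<le> u 0" "mono u"
  shows "(\<lambda>n. g.expectation n (\<lambda>\<omega>. iexp (\<Sum>j<k. \<theta> j * (- (g.centered n (u (Suc j) / \<sigma>' n) \<omega> - g.centered n (u j / \<sigma>' n) \<omega>) / sqrt (\<kappa>' n)))))
    \<longlonglongrightarrow> exp (- (\<Sum>j<k. (\<theta> j)\<^sup>2 * (\<alpha> * u (Suc j) / 2 - \<alpha> * u j / 2)) / 2)"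
proof -
  define C where "C = (\<Sum>j<k. \<bar>\<theta> j\<bar>)"
  \<comment> \<open>The sign is negative because, apart from cycles, each new edge lowers the number
    of components. The Gaussian limit sees the square only.\<close>
  define \<epsilon> where "\<epsilon> n = - (1 / sqrt (\<kappa>' n))" for n
  define E where "E n = g.expectation n (\<lambda>\<omega>. iexp (\<epsilon> n * (\<Sum>j<k. \<theta> j * (g.centered n (u (Suc j) / \<sigma>' n) \<omega> - g.centered n (u j / \<sigma>' n) \<omega>))))" for n
  define m where "m n = (\<Sum>j<k. (\<theta> j)\<^sup>2 * (g.mean_count n (u (Suc j) / \<sigma>' n) - g.mean_count n (u j / \<sigma>' n)))" for n
  have u0: "0 \<le> u j" for j using u monoD[OF u(2), of 0 j] by simp
  \<comment> \<open>The variance depends on n and is available for positive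
    \<open>\<sigma>' n\<close> only; the guarded existence statement allows a whole sequence v to be
    chosen.\<close>
  have "\<exists>v. 0 < \<sigma>' n \<longrightarrow> \<bar>v - m n\<bar> \<le> C\<^sup>2 * (u k / \<sigma>' n)\<^sup>2 * g.square_rate n \<and>
      cmod (E n - exp (- ((\<epsilon> n)\<^sup>2 * v / 2))) \<le> (\<epsilon> n)\<^sup>2 * v * (\<bar>\<epsilon> n\<bar> * C + (\<epsilon> n)\<^sup>2 * C\<^sup>2)" for n
  proof (cases "0 < \<sigma>' n")
    case True
    have mono: "mono (\<lambda>j. u j / \<sigma>' n)" using u(2) True by (auto simp: mono_def divide_right_mono)
    have nonneg: "0 \<le> u 0 / \<sigma>' n" using u True by simp
    obtain v where "\<bar>v - m n\<bar> \<le> C\<^sup>2 * (u k / \<sigma>' n)\<^sup>2 * g.square_rate n"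
      "cmod (E n - exp (- ((\<epsilon> n)\<^sup>2 * v / 2))) \<le> (\<epsilon> n)\<^sup>2 * v * (\<bar>\<epsilon> n\<bar> * C + (\<epsilon> n)\<^sup>2 * C\<^sup>2)"
      unfolding C_def m_def E_def
      by (rule g.char_increments_approx[where u = "\<lambda>j. u j / \<sigma>' n" and k = k and \<theta> = \<theta>
            and \<epsilon> = "\<epsilon> n", OF nonneg mono])
    then show ?thesis by blast
  qed simp
  then obtain v where v: "\<And>n. 0 < \<sigma>' n \<Longrightarrow> \<bar>v n - m n\<bar> \<le> C\<^sup>2 * (u k / \<sigma>' n)\<^sup>2 * g.square_rate n"
    and E: "\<And>n. 0 < \<sigma>' n \<Longrightarrow> cmod (E n - exp (- ((\<epsilon> n)\<^sup>2 * v n / 2))) \<le> (\<epsilon> n)\<^sup>2 * v n * (\<bar>\<epsilon> n\<bar> * C + (\<epsilon> n)\<^sup>2 * C\<^sup>2)"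
    by metis
  define V where "V = (\<Sum>j<k. (\<theta> j)\<^sup>2 * (\<alpha> * u (Suc j) / 2 - \<alpha> * u j / 2))"
  have "(\<lambda>n. \<Sum>j<k. (\<theta> j)\<^sup>2 * (g.mean_count n (u (Suc j) / \<sigma>' n) / \<kappa>' n - g.mean_count n (u j / \<sigma>' n) / \<kappa>' n)) \<longlonglongrightarrow> V"
    unfolding V_def by (intro tendsto_intros mean_count_lim u0)
  moreover have "(\<Sum>j<k. (\<theta> j)\<^sup>2 * (g.mean_count n (u (Suc j) / \<sigma>' n) / \<kappa>' n - g.mean_count n (u j / \<sigma>' n) / \<kappa>' n)) = m n / \<kappa>' n" for n
    unfolding m_def sum_divide_distrib by (intro sum.cong refl) (simp add: diff_divide_distrib right_diff_distrib)
  ultimately have m_lim: "(\<lambda>n. m n / \<kappa>' n) \<longlonglongrightarrow> V" by simp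
  have v_m: "(\<lambda>n. v n / \<kappa>' n - m n / \<kappa>' n) \<longlonglongrightarrow> 0"
  proof (rule Lim_null_comparison)
    show "(\<lambda>n. C\<^sup>2 * ((u k / \<sigma>' n)\<^sup>2 * g.square_rate n / \<kappa>' n)) \<longlonglongrightarrow> 0"
      using tendsto_mult_left[OF square_rate_lim[of "u k"], of "C\<^sup>2"] by simp
    show "\<forall>\<^sub>F n in sequentially. norm (v n / \<kappa>' n - m n / \<kappa>' n) \<le> C\<^sup>2 * ((u k / \<sigma>' n)\<^sup>2 * g.square_rate n / \<kappa>' n)"
      using eventually_positive
    proof eventually_elim
      case (elim n)
      have "norm (v n / \<kappa>' n - m n / \<kappa>' n) = \<bar>v n - m n\<bar> / \<kappa>' n"
        using elim by (simp add: diff_divide_distrib[symmetric] abs_divide)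
      also have "\<dots> \<le> (C\<^sup>2 * (u k / \<sigma>' n)\<^sup>2 * g.square_rate n) / \<kappa>' n"
        using v elim by (intro divide_right_mono) auto
      finally show ?case by (simp add: mult.assoc)
    qed
  qed
  have v_lim: "(\<lambda>n. v n / \<kappa>' n) \<longlonglongrightarrow> V" using tendsto_add[OF v_m m_lim] by simp
  have eps_sq: "\<forall>\<^sub>F n in sequentially. v n / \<kappa>' n = (\<epsilon> n)\<^sup>2 * v n"
    using eventually_positive by eventually_elim (simp add: \<epsilon>_def power_divide)
  have ev_lim: "(\<lambda>n. (\<epsilon> n)\<^sup>2 * v n) \<longlonglongrightarrow> V" by (rule Lim_transform_eventually[OF v_lim eps_sq])
  have eps_lim: "\<epsilon> \<longlonglongrightarrow> 0" unfolding \<epsilon>_def using tendsto_minus[OF tendsto_over_kappa'(2)[of 1]] by simp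
  have "(\<lambda>n. E n - exp (- ((\<epsilon> n)\<^sup>2 * v n / 2))) \<longlonglongrightarrow> 0"
  proof (rule Lim_null_comparison)
    have "(\<lambda>n. (\<epsilon> n)\<^sup>2 * v n * (\<bar>\<epsilon> n\<bar> * C + (\<epsilon> n)\<^sup>2 * C\<^sup>2)) \<longlonglongrightarrow> V * (\<bar>0\<bar> * C + 0\<^sup>2 * C\<^sup>2)"
      by (intro tendsto_intros ev_lim eps_lim)
    then show "(\<lambda>n. (\<epsilon> n)\<^sup>2 * v n * (\<bar>\<epsilon> n\<bar> * C + (\<epsilon> n)\<^sup>2 * C\<^sup>2)) \<longlonglongrightarrow> 0" by simp
    show "\<forall>\<^sub>F n in sequentially. norm (E n - exp (- ((\<epsilon> n)\<^sup>2 * v n / 2))) \<le> (\<epsilon> n)\<^sup>2 * v n * (\<bar>\<epsilon> n\<bar> * C + (\<epsilon> n)\<^sup>2 * C\<^sup>2)"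
      using eventually_positive by eventually_elim (use E in auto)
  qed
  moreover have "(\<lambda>n. complex_of_real (exp (- ((\<epsilon> n)\<^sup>2 * v n / 2)))) \<longlonglongrightarrow> complex_of_real (exp (- (V / 2)))"
    by (intro tendsto_intros ev_lim) simp
  ultimately have "(\<lambda>n. (E n - exp (- ((\<epsilon> n)\<^sup>2 * v n / 2))) + exp (- ((\<epsilon> n)\<^sup>2 * v n / 2))) \<longlonglongrightarrow> 0 + complex_of_real (exp (- (V / 2)))"
    by (rule tendsto_add)
  then have "E \<longlonglongrightarrow> complex_of_real (exp (- (V / 2)))" by simp
  moreover have "E = (\<lambda>n. g.expectation n (\<lambda>\<omega>. iexp (\<Sum>j<k. \<theta> j * (- (g.centered n (u (Suc j) / \<sigma>' n) \<omega> - g.centered n (u j / \<sigma>' n) \<omega>) / sqrt (\<kappa>' n)))))"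
    unfolding E_def[abs_def] \<epsilon>_def sum_distrib_left
    by (intro ext Bochner_Integration.integral_cong refl arg_cong[where f = iexp] sum.cong)
      (simp add: right_diff_distrib diff_divide_distrib)
  ultimately have "(\<lambda>n. g.expectation n (\<lambda>\<omega>. iexp (\<Sum>j<k. \<theta> j * (- (g.centered n (u (Suc j) / \<sigma>' n) \<omega> - g.centered n (u j / \<sigma>' n) \<omega>) / sqrt (\<kappa>' n)))))
    \<longlonglongrightarrow> exp (- (V / 2))" by (simp only:)
  then show ?thesis unfolding V_def[symmetric] by (simp only: minus_divide_left)
qed

text \<open>The bound y <= 1 + y^2 for y >= 0 derives this from the fourth moment already at hand.
  Once \<open>\<kappa>' n\<close> is at least 1, its square absorbs the linear term.\<close>

lemma second_moment_increment:
  "\<forall>\<^sub>F n in sequentially. \<forall>s t. 0 \<le> s \<and> s \<le> t \<and> t \<le> 1 \<longrightarrow>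
     integrable (M n) (\<lambda>\<omega>. (- (g.centered n (t / \<sigma>' n) \<omega> - g.centered n (s / \<sigma>' n) \<omega>) / sqrt (\<kappa>' n))\<^sup>2) \<and>
     g.expectation n (\<lambda>\<omega>. (- (g.centered n (t / \<sigma>' n) \<omega> - g.centered n (s / \<sigma>' n) \<omega>) / sqrt (\<kappa>' n))\<^sup>2)
       \<le> 1 + ((\<alpha> + 1) + 3 * (\<alpha> + 1)\<^sup>2)"
proof -
  have "\<forall>\<^sub>F n in sequentially. 1 \<le> \<kappa>' n" using kappa'_infinity by (simp add: filterlim_at_top)
  with eventually_positive total_rate_le show ?thesis
  proof eventually_elim
    case (elim n)
    show ?case
    proof (intro allI impI, elim conjE)
      fix s t :: real assume st: "0 \<le> s" "s \<le> t" "t \<le> 1"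
      define Y where "Y \<omega> = g.centered n (t / \<sigma>' n) \<omega> - g.centered n (s / \<sigma>' n) \<omega>" for \<omega>
      let ?k = "\<kappa>' n" and ?D = "\<alpha> + 1"
      have nn: "0 \<le> s / \<sigma>' n" "0 \<le> t / \<sigma>' n" "s / \<sigma>' n \<le> t / \<sigma>' n"
        using st elim by (auto intro: divide_right_mono)
      have int: "integrable (M n) (\<lambda>\<omega>. Y \<omega> ^ p)" for p
        unfolding Y_def by (rule g.centered_increment_integrable[OF nn(1,2)])
      have sq: "(- Y \<omega> / sqrt ?k)\<^sup>2 = Y \<omega> ^ 2 / ?k" for \<omega> using elim by (simp add: power_divide)
      define d where "d = g.total_rate n * (t / \<sigma>' n - s / \<sigma>' n)"
      have "d = g.total_rate n * ((t - s) / \<sigma>' n)" by (simp add: d_def diff_divide_distrib)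
      then have d: "d \<le> ?D * ?k" using elim(2) st by simp
      have d0: "0 \<le> d" unfolding d_def using g.total_rate_nonneg[of n] nn by simp
      have "g.expectation n (\<lambda>\<omega>. Y \<omega> ^ 4) \<le> d + 3 * d\<^sup>2"
        unfolding Y_def d_def by (rule g.fourth_moment_increment[OF nn(1,3)])
      also have "\<dots> \<le> ?D * ?k + 3 * (?D * ?k)\<^sup>2" using d d0 by (intro add_mono mult_left_mono power_mono) auto
      also have "\<dots> \<le> (?D + 3 * ?D\<^sup>2) * ?k\<^sup>2"
      proof -
        have "?k * 1 \<le> ?k * ?k" using elim by (intro mult_left_mono) auto
        then have "?D * ?k \<le> ?D * ?k\<^sup>2" using alpha by (intro mult_left_mono) (auto simp: power2_eq_square)
        then show ?thesis
          unfolding distrib_right[of ?D "3 * ?D\<^sup>2"] power_mult_distrib[of ?D] mult.assoc by (rule add_right_mono)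
      qed
      finally have E4: "g.expectation n (\<lambda>\<omega>. Y \<omega> ^ 4) \<le> (?D + 3 * ?D\<^sup>2) * ?k\<^sup>2" .
      have "g.expectation n (\<lambda>\<omega>. Y \<omega> ^ 2 / ?k) \<le> g.expectation n (\<lambda>\<omega>. 1 + Y \<omega> ^ 4 / ?k\<^sup>2)"
      proof (rule integral_mono)
        fix \<omega>
        let ?y = "Y \<omega> ^ 2 / ?k"
        have "2 * ?y \<le> 1 + ?y\<^sup>2" using zero_le_power2[of "?y - 1"] by (simp add: power2_diff)
        moreover have "0 \<le> ?y" using elim by simp
        moreover have "?y\<^sup>2 = Y \<omega> ^ 4 / ?k\<^sup>2" by (simp add: power_divide power_mult[symmetric])
        ultimately show "?y \<le> 1 + Y \<omega> ^ 4 / ?k\<^sup>2" by linarith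
      qed (use int in auto)
      also have "\<dots> = 1 + g.expectation n (\<lambda>\<omega>. Y \<omega> ^ 4) / ?k\<^sup>2" using int by (simp add: g.prob_space)
      also have "\<dots> \<le> 1 + (?D + 3 * ?D\<^sup>2)" using E4 elim by (simp add: field_simps)
      finally show "integrable (M n) (\<lambda>\<omega>. (- (g.centered n (t / \<sigma>' n) \<omega> - g.centered n (s / \<sigma>' n) \<omega>) / sqrt (\<kappa>' n))\<^sup>2) \<and>
        g.expectation n (\<lambda>\<omega>. (- (g.centered n (t / \<sigma>' n) \<omega> - g.centered n (s / \<sigma>' n) \<omega>) / sqrt (\<kappa>' n))\<^sup>2)
          \<le> 1 + ((\<alpha> + 1) + 3 * (\<alpha> + 1)\<^sup>2)"
        unfolding Y_def[symmetric] sq using int[of 2] by simp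
    qed
  qed
qed

text \<open>The general form covers both scalings: y = 0 for the law of large numbers, and the
  affine limit for the fluctuations.\<close>

lemma component_process_measurable:
  assumes c: "0 \<le> c" and s: "0 < \<sigma>' n" and y: "continuous_on {0..c} y"
  shows "(\<lambda>\<omega>. \<lambda>t\<in>{0..c}. a * (b * real (K_proc (z n) (G n) (t / \<sigma>' n) \<omega>) - y t))
    \<in> measurable (M n) (borel_of (J1_topology c))"
proof (rule measurable_J1[OF c])
  fix t assume "t \<in> {0..c}"
  then have "0 \<le> t / \<sigma>' n" using s by simp
  from g.K_proc_measurable[OF this]
  show "(\<lambda>\<omega>. a * (b * real (K_proc (z n) (G n) (t / \<sigma>' n) \<omega>) - y t)) \<in> borel_measurable (M n)" by simp
next
  fix \<omega> assume \<omega>: "\<omega> \<in> space (M n)"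
  let ?f = "\<lambda>E. a * (b * real (num_components (vertices (z n)) E))"
  obtain F where F: "step_on (c / \<sigma>' n) F (\<lambda>t. ?f (G n t \<omega>))" "F \<subseteq> {0<..c / \<sigma>' n}"
    using g.count_step_on[OF \<omega>, where c = "c / \<sigma>' n" and f = ?f] by blast
  have F1: "step_on c ((\<lambda>q. \<sigma>' n * q) ` F) (\<lambda>t. ?f (G n (t / \<sigma>' n) \<omega>))" by (rule step_on_scale[OF s F(1)])
  have F2: "(\<lambda>q. \<sigma>' n * q) ` F \<subseteq> {0<..c}"
    using F(2) s by (auto simp: pos_le_divide_eq mult.commute)
  have F3: "continuous_on {0..c} (\<lambda>t. - (a * y t))" by (intro continuous_intros y)
  show "\<exists>y' s F. continuous_on {0..c} y' \<and> step_on c F s \<and> F \<subseteq> {0<..c} \<and>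
      (\<forall>t\<in>{0..c}. a * (b * real (K_proc (z n) (G n) (t / \<sigma>' n) \<omega>) - y t) = y' t + s t)"
    by (rule exI, rule exI, rule exI, intro conjI, rule F3, rule F1, rule F2)
      (simp add: K_proc_def right_diff_distrib)
qed

end

section \<open>Limits on a grid and uniform error bounds\<close>

context graph_sequence
begin

lemma centered_0: "\<omega> \<in> space (M n) \<Longrightarrow> g.centered n 0 \<omega> = 0"
  by (simp add: g.centered_def g.edge_count_def g.mean_count_def g.arrived_def g.starts_empty)

text \<open>Grid values are partial sums of increments, and the Skorokhod distance of two grid paths
  is at most the sum of the differences of their increments. Hence f of the grid path is a bounded
  Lipschitz function of finitely many increments, and \<open>weak_convergence_trig\<close> applies.
  The drift b may be any deterministic function.\<close>

lemma grid_increments_convergence: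
  fixes f :: "(real \<Rightarrow> real) \<Rightarrow> real"
  assumes B: "brownian_motion N B" and c: "0 \<le> c" "c \<le> 1" and m: "0 < m"
    and C: "\<And>x. x \<in> cadlag_space c \<Longrightarrow> \<bar>f x\<bar> \<le> C"
    and L: "0 \<le> L" "\<And>x y. x \<in> cadlag_space c \<Longrightarrow> y \<in> cadlag_space c \<Longrightarrow> \<bar>f x - f y\<bar> \<le> L * J1_dist c x y"
  shows "(\<lambda>n. g.expectation n (\<lambda>\<omega>. f (grid_path c m (\<lambda>j. b (c * real j / real m)
        - g.centered n (c * real j / real m / \<sigma>' n) \<omega> / sqrt (\<kappa>' n)))))
    \<longlonglongrightarrow> (\<integral>\<omega>. f (grid_path c m (\<lambda>j. b (c * real j / real m) + B (\<alpha> * (c * real j / real m / 2)) \<omega>)) \<partial>N)"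
proof -
  interpret brownian_motion N B by (rule B)
  define u where "u j = c * real j / real m" for j
  have u0: "0 \<le> u j" for j using c by (simp add: u_def)
  have mono_u: "mono u" unfolding mono_def u_def using c by (auto intro!: divide_right_mono mult_left_mono)
  define V where "V n \<omega> j = - (g.centered n (u (Suc j) / \<sigma>' n) \<omega> - g.centered n (u j / \<sigma>' n) \<omega>) / sqrt (\<kappa>' n)" for n \<omega> j
  define u' where "u' j = \<alpha> * (u j / 2)" for j
  have u': "0 \<le> u' j" "mono u'" for j
    using u0 mono_u alpha by (auto simp: u'_def mono_def intro!: mult_left_mono)
  define W where "W \<omega> j = B (u' (Suc j)) \<omega> - B (u' j) \<omega>" for \<omega> j
  define h where "h a = f (grid_path c m (\<lambda>j. b (u j) + (\<Sum>i<j. a i)))" for a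
  have h_lip: "\<bar>h a - h a'\<bar> \<le> L * (\<Sum>i<m. \<bar>a i - a' i\<bar>)" for a a'
  proof -
    have "J1_dist c (grid_path c m (\<lambda>j. b (u j) + (\<Sum>i<j. a i))) (grid_path c m (\<lambda>j. b (u j) + (\<Sum>i<j. a' i)))
        \<le> (\<Sum>i<m. \<bar>a i - a' i\<bar>)"
    proof (rule J1_dist_grid_path[OF c(1) m])
      fix j assume j: "j \<le> m"
      have "\<bar>(b (u j) + (\<Sum>i<j. a i)) - (b (u j) + (\<Sum>i<j. a' i))\<bar> = \<bar>\<Sum>i<j. a i - a' i\<bar>"
        by (simp add: sum_subtractf)
      also have "\<dots> \<le> (\<Sum>i<j. \<bar>a i - a' i\<bar>)" by (rule sum_abs)
      also have "\<dots> \<le> (\<Sum>i<m. \<bar>a i - a' i\<bar>)" using j by (intro sum_mono2) auto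
      finally show "\<bar>(b (u j) + (\<Sum>i<j. a i)) - (b (u j) + (\<Sum>i<j. a' i))\<bar> \<le> (\<Sum>i<m. \<bar>a i - a' i\<bar>)" .
    qed (simp add: sum_nonneg)
    then have "L * J1_dist c (grid_path c m (\<lambda>j. b (u j) + (\<Sum>i<j. a i))) (grid_path c m (\<lambda>j. b (u j) + (\<Sum>i<j. a' i)))
        \<le> L * (\<Sum>i<m. \<bar>a i - a' i\<bar>)" by (rule mult_left_mono) (rule L(1))
    then show ?thesis unfolding h_def using L(2)[OF grid_path_cadlag[OF c(1) m] grid_path_cadlag[OF c(1) m]]
      by (rule order_trans[rotated])
  qed
  have h_C: "\<bar>h a\<bar> \<le> C" for a unfolding h_def by (intro C grid_path_cadlag c m)
  have cm: "g.centered n (u j / \<sigma>' n) \<in> borel_measurable (M n)" if "0 < \<sigma>' n" for n j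
    using that u0 by (intro g.centered_measurable) auto
  have V_m: "V n \<in> measurable (M n) borel" if "0 < \<sigma>' n" for n
    unfolding V_def using cm[OF that]
    by (intro measurable_coordinatewise_then_product borel_measurable_divide borel_measurable_uminus
        borel_measurable_diff borel_measurable_const) auto
  have W_m: "W \<in> measurable N borel"
    unfolding W_def using measurable_B[OF u'(1)]
    by (intro measurable_coordinatewise_then_product borel_measurable_diff) auto
  have "(\<lambda>n. \<integral>\<omega>. h (V n \<omega>) \<partial>M n) \<longlonglongrightarrow> (\<integral>\<omega>. h (W \<omega>) \<partial>N)"
  proof (rule weak_convergence_trig[where P = M and Q = N and V = V and W = W and g = h and m = m and D = "1 + ((\<alpha> + 1) + 3 * (\<alpha> + 1)\<^sup>2)" and C = C and L = L])
    show "prob_space (M n)" for n by (rule g.prob_space_axioms)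
    show "prob_space N" by (rule prob_space_axioms)
    show "\<forall>\<^sub>F n in sequentially. V n \<in> measurable (M n) borel"
      using eventually_positive by eventually_elim (simp add: V_m)
    show "W \<in> measurable N borel" by (rule W_m)
    show "\<forall>\<^sub>F n in sequentially. \<forall>j<m. integrable (M n) (\<lambda>\<omega>. (V n \<omega> j)\<^sup>2) \<and>
       (\<integral>\<omega>. (V n \<omega> j)\<^sup>2 \<partial>M n) \<le> 1 + ((\<alpha> + 1) + 3 * (\<alpha> + 1)\<^sup>2)"
      using second_moment_increment
    proof eventually_elim
      case (elim n)
      have "u j \<le> u (Suc j) \<and> u (Suc j) \<le> 1" if "j < m" for j
      proof -
        have "c * (real (Suc j) / real m) \<le> 1 * 1" using that c by (intro mult_mono) auto
        then show ?thesis using monoD[OF mono_u, of j "Suc j"] by (simp add: u_def)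
      qed
      then show ?case unfolding V_def using elim u0 by blast
    qed
    show "\<bar>h a\<bar> \<le> C" for a by (rule h_C)
    show "\<bar>h a - h b\<bar> \<le> L * (\<Sum>j<m. \<bar>a j - b j\<bar>)" for a b by (rule h_lip)
    show "0 \<le> L" by (rule L(1))
  next
    fix k \<theta> d
    have Vs: "(\<lambda>\<omega>. \<Sum>j<k. \<theta> j * V n \<omega> j) \<in> borel_measurable (M n)" if "0 < \<sigma>' n" for n
      unfolding V_def using cm[OF that]
      by (intro borel_measurable_sum borel_measurable_times borel_measurable_divide borel_measurable_uminus
        borel_measurable_diff borel_measurable_const) auto
    have Ws: "(\<lambda>\<omega>. \<Sum>j<k. \<theta> j * W \<omega> j) \<in> borel_measurable N"
      unfolding W_def using measurable_B[OF u'(1)]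
      by (intro borel_measurable_sum borel_measurable_times borel_measurable_diff borel_measurable_const) auto
    have "expectation (\<lambda>\<omega>. iexp (\<Sum>j<k. \<theta> j * W \<omega> j)) = exp (- (\<Sum>j<k. (\<theta> j)\<^sup>2 * (\<alpha> * u (Suc j) / 2 - \<alpha> * u j / 2)) / 2)"
      unfolding W_def by (subst char_increments[OF u']) (simp add: u'_def)
    then have "(\<lambda>n. g.expectation n (\<lambda>\<omega>. iexp (\<Sum>j<k. \<theta> j * V n \<omega> j))) \<longlonglongrightarrow> expectation (\<lambda>\<omega>. iexp (\<Sum>j<k. \<theta> j * W \<omega> j))"
      using char_increments_lim[OF u0 mono_u, of \<theta> k] by (simp only: V_def)
    then have "(\<lambda>n. Re (iexp d * g.expectation n (\<lambda>\<omega>. iexp (\<Sum>j<k. \<theta> j * V n \<omega> j)))) \<longlonglongrightarrow>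
        Re (iexp d * expectation (\<lambda>\<omega>. iexp (\<Sum>j<k. \<theta> j * W \<omega> j)))"
      by (intro tendsto_Re tendsto_mult_left)
    then have lim: "(\<lambda>n. Re (iexp d * g.expectation n (\<lambda>\<omega>. iexp (\<Sum>j<k. \<theta> j * V n \<omega> j)))) \<longlonglongrightarrow>
        expectation (\<lambda>\<omega>. cos ((\<Sum>j<k. \<theta> j * W \<omega> j) + d))"
      by (simp only: expectation_cos_eq_char[OF Ws])
    have "\<forall>\<^sub>F n in sequentially. Re (iexp d * g.expectation n (\<lambda>\<omega>. iexp (\<Sum>j<k. \<theta> j * V n \<omega> j))) =
        (\<integral>\<omega>. cos ((\<Sum>j<k. \<theta> j * V n \<omega> j) + d) \<partial>M n)"
      using eventually_positive
    proof eventually_elim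
      case (elim n)
      then show ?case using g.expectation_cos_eq_char[OF Vs, of n d] by simp
    qed
    from Lim_transform_eventually[OF lim this]
    show "(\<lambda>n. \<integral>\<omega>. cos ((\<Sum>j<k. \<theta> j * V n \<omega> j) + d) \<partial>M n) \<longlonglongrightarrow> expectation (\<lambda>\<omega>. cos ((\<Sum>j<k. \<theta> j * W \<omega> j) + d))" .
  qed
  moreover have "(\<integral>\<omega>. h (V n \<omega>) \<partial>M n) = g.expectation n (\<lambda>\<omega>. f (grid_path c m (\<lambda>j. b (u j) - g.centered n (u j / \<sigma>' n) \<omega> / sqrt (\<kappa>' n))))" for n
  proof (rule Bochner_Integration.integral_cong[OF refl])
    fix \<omega> assume \<omega>: "\<omega> \<in> space (M n)"
    have "(\<Sum>i<j. V n \<omega> i) = - g.centered n (u j / \<sigma>' n) \<omega> / sqrt (\<kappa>' n)" for j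
    proof -
      have "(\<Sum>i<j. V n \<omega> i) = - (\<Sum>i<j. g.centered n (u (Suc i) / \<sigma>' n) \<omega> - g.centered n (u i / \<sigma>' n) \<omega>) / sqrt (\<kappa>' n)"
        unfolding V_def by (simp add: sum_negf[symmetric] sum_divide_distrib)
      also have "(\<Sum>i<j. g.centered n (u (Suc i) / \<sigma>' n) \<omega> - g.centered n (u i / \<sigma>' n) \<omega>) = g.centered n (u j / \<sigma>' n) \<omega> - g.centered n (u 0 / \<sigma>' n) \<omega>"
        by (rule sum_lessThan_telescope)
      finally show ?thesis using centered_0[OF \<omega>] by (simp add: u_def)
    qed
    then show "h (V n \<omega>) = f (grid_path c m (\<lambda>j. b (u j) - g.centered n (u j / \<sigma>' n) \<omega> / sqrt (\<kappa>' n)))"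
      by (simp add: h_def)
  qed
  moreover have "(\<integral>\<omega>. h (W \<omega>) \<partial>N) = (\<integral>\<omega>. f (grid_path c m (\<lambda>j. b (u j) + B (u' j) \<omega>)) \<partial>N)"
  proof (rule Bochner_Integration.integral_cong[OF refl])
    fix \<omega> assume \<omega>: "\<omega> \<in> space N"
    have "(\<Sum>i<j. W \<omega> i) = B (u' j) \<omega>" for j
      unfolding W_def sum_lessThan_telescope[of "\<lambda>i. B (u' i) \<omega>"] by (simp add: u'_def u_def start[OF \<omega>])
    then show "h (W \<omega>) = f (grid_path c m (\<lambda>j. b (u j) + B (u' j) \<omega>))" by (simp add: h_def)
  qed
  ultimately show ?thesis unfolding u'_def u_def by simp
qed

text \<open>Pathwise, the number of components is \<open>\<kappa> n\<close> minus the mean and the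
  centred edge count, up to an excess between 0 and the cycle count. The 5 bounds
  \<open>t + 4 * t\<^sup>2\<close> for t up to 1. The factor a will be 1 or
  \<open>sqrt (\<kappa>' n)\<close>.\<close>

lemma components_expansion:
  assumes n: "0 < \<kappa>' n" "0 < \<sigma>' n"
    and mean: "\<forall>t\<ge>0. \<bar>g.mean_count n (t / \<sigma>' n) - t * (\<sigma>1 n)\<^sup>2 / (2 * \<sigma>' n)\<bar> \<le> t + 4 * t\<^sup>2"
    and \<omega>: "\<omega> \<in> space (M n)" and t: "0 \<le> t" "t \<le> c" and c: "c \<le> 1" and a: "0 \<le> a"
  shows "\<bar>a * (1 / \<kappa>' n * real (K_proc (z n) (G n) (t / \<sigma>' n) \<omega>) - (1 - t * (\<alpha> / 2)))
      - (a * (\<kappa> n / \<kappa>' n - 1) - t / 2 * (a * ((\<sigma>1 n)\<^sup>2 / (\<kappa>' n * \<sigma>' n) - \<alpha>)) - a * g.centered n (t / \<sigma>' n) \<omega> / \<kappa>' n)\<bar>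
    \<le> a * (g.cycle_count n (c / \<sigma>' n) \<omega> + 5) / \<kappa>' n"
proof -
  let ?K = "real (K_proc (z n) (G n) (t / \<sigma>' n) \<omega>)" and ?s = "t * (\<sigma>1 n)\<^sup>2 / (2 * \<sigma>' n)"
  have t': "0 \<le> t / \<sigma>' n" "t / \<sigma>' n \<le> c / \<sigma>' n" using t n by (auto intro: divide_right_mono)
  have "t * t \<le> 1 * 1" using t c by (intro mult_mono) auto
  then have "\<bar>g.mean_count n (t / \<sigma>' n) - ?s\<bar> \<le> 5"
    using mean t c by (smt (verit) power2_eq_square)
  moreover have "0 \<le> ?K + g.edge_count n (t / \<sigma>' n) \<omega> - \<kappa> n"
    "?K + g.edge_count n (t / \<sigma>' n) \<omega> - \<kappa> n \<le> g.cycle_count n (t / \<sigma>' n) \<omega>"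
    unfolding \<kappa> by (rule g.components_bounds[OF \<omega> t'(1)])+
  moreover have "g.cycle_count n (t / \<sigma>' n) \<omega> \<le> g.cycle_count n (c / \<sigma>' n) \<omega>"
    by (rule g.cycle_count_mono[OF \<omega> t'])
  ultimately have "\<bar>?K - (\<kappa> n - ?s - g.centered n (t / \<sigma>' n) \<omega>)\<bar> \<le> g.cycle_count n (c / \<sigma>' n) \<omega> + 5"
    unfolding g.centered_def by linarith
  then have "a / \<kappa>' n * \<bar>?K - (\<kappa> n - ?s - g.centered n (t / \<sigma>' n) \<omega>)\<bar> \<le> a / \<kappa>' n * (g.cycle_count n (c / \<sigma>' n) \<omega> + 5)"
    using a n by (intro mult_left_mono) auto
  moreover have "a * (1 / \<kappa>' n * ?K - (1 - t * (\<alpha> / 2)))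
      - (a * (\<kappa> n / \<kappa>' n - 1) - t / 2 * (a * ((\<sigma>1 n)\<^sup>2 / (\<kappa>' n * \<sigma>' n) - \<alpha>)) - a * g.centered n (t / \<sigma>' n) \<omega> / \<kappa>' n)
      = a / \<kappa>' n * (?K - (\<kappa> n - ?s - g.centered n (t / \<sigma>' n) \<omega>))"
    using n by (simp add: field_simps)
  ultimately show ?thesis using a n by (simp add: abs_mult)
qed

lemma cycle_count_tail_uniform:
  assumes c: "0 \<le> c" "c < 1"
  obtains Q where "0 \<le> Q" "\<forall>\<^sub>F n in sequentially. \<forall>a>0.
    {\<omega> \<in> space (M n). a < g.cycle_count n (c / \<sigma>' n) \<omega>} \<in> g.events n \<and>
    g.prob n {\<omega> \<in> space (M n). a < g.cycle_count n (c / \<sigma>' n) \<omega>} \<le> Q / a"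
proof -
  \<comment> \<open>The parameter s of the cycle bound tends to c, so it eventually lies below the
    midpoint d of c and 1. Here c < 1 enters, and Q is 1 / (1 - d).\<close>
  define d where "d = (1 + c) / 2"
  have d: "c < d" "d < 1" using c by (auto simp: d_def)
  have "(\<lambda>n. c * (\<sigma>2 n / \<sigma>' n)) \<longlonglongrightarrow> c * 1" by (intro tendsto_intros sigma2_lim)
  then have "\<forall>\<^sub>F n in sequentially. c * (\<sigma>2 n / \<sigma>' n) < d" using d by (intro order_tendstoD(2)) auto
  with eventually_positive have "\<forall>\<^sub>F n in sequentially. \<forall>a>0.
    {\<omega> \<in> space (M n). a < g.cycle_count n (c / \<sigma>' n) \<omega>} \<in> g.events n \<and>
    g.prob n {\<omega> \<in> space (M n). a < g.cycle_count n (c / \<sigma>' n) \<omega>} \<le> 1 / (1 - d) / a"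
  proof eventually_elim
    case (elim n)
    define s where "s = (\<Sum>i\<in>vertices (z n). (z n i)\<^sup>2) * (c / \<sigma>' n)"
    have s: "0 \<le> s" "s < d" using elim c by (auto simp: s_def \<sigma>2 mult.commute intro!: divide_nonneg_pos mult_nonneg_nonneg sum_nonneg)
    have nn: "0 \<le> c / \<sigma>' n" using c elim by simp
    have s1: "(\<Sum>i\<in>vertices (z n). (z n i)\<^sup>2) * (c / \<sigma>' n) < 1" using s d by (simp add: s_def)
    have "s\<^sup>2 / (1 - s) \<le> 1 / (1 - d)"
      using s d by (intro frac_le) (auto simp: abs_square_le_1)
    then have "s\<^sup>2 / (1 - s) / a \<le> 1 / (1 - d) / a" if "0 < a" for a using that by (intro divide_right_mono) auto
    then show ?case using g.cycle_count_tail[OF nn s1] unfolding s_def by (meson order_trans)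
  qed
  then show ?thesis using that[of "1 / (1 - d)"] d by simp
qed

lemma modulus_bound_scaled:
  assumes n: "0 < \<sigma>' n" "2 ^ q \<le> \<kappa>' n" and c: "0 \<le> c" "c \<le> 1" and A: "0 < A"
    and rate: "\<forall>c. 0 \<le> c \<and> c \<le> 1 \<longrightarrow> g.total_rate n * (c / \<sigma>' n) \<le> (\<alpha> + 1) * \<kappa>' n"
  obtains S where "S \<in> g.events n"
    "g.prob n S \<le> 5 * ((\<alpha> + 1) + 3 * (\<alpha> + 1)\<^sup>2) / A ^ 4 * (5000 / 6561) ^ q"
    "\<And>\<omega> t. \<omega> \<in> space (M n) - S \<Longrightarrow> t \<in> {0..c} \<Longrightarrow>
       \<bar>g.centered n (t / \<sigma>' n) \<omega> - g.centered n (grid_floor c (2 ^ q) t / \<sigma>' n) \<omega>\<bar>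
         \<le> 20 * A * sqrt (\<kappa>' n) * (9 / 10) ^ q + 2 * (\<alpha> + 1)"
proof -
  have nn: "0 \<le> c / \<sigma>' n" using n c by simp
  have r: "g.total_rate n * (c / \<sigma>' n) \<le> (\<alpha> + 1) * \<kappa>' n" "0 \<le> \<alpha> + 1" using rate c alpha by auto
  obtain S where S: "S \<in> g.events n"
    "g.prob n S \<le> 5 * ((\<alpha> + 1) + 3 * (\<alpha> + 1)\<^sup>2) / A ^ 4 * (5000 / 6561) ^ q"
    "\<And>\<omega> t. \<omega> \<in> space (M n) - S \<Longrightarrow> t \<in> {0..c / \<sigma>' n} \<Longrightarrow>
       \<bar>g.centered n t \<omega> - g.centered n (grid_floor (c / \<sigma>' n) (2 ^ q) t) \<omega>\<bar>
         \<le> 20 * A * sqrt (\<kappa>' n) * (9 / 10) ^ q + 2 * (\<alpha> + 1)"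
    using g.modulus_bound[OF nn n(2) r A] by metis
  show ?thesis
  proof (rule that[OF S(1,2)])
    fix \<omega> t assume "\<omega> \<in> space (M n) - S" "t \<in> {0..c}"
    moreover from this have "t / \<sigma>' n \<in> {0..c / \<sigma>' n}" using n by (auto intro: divide_right_mono)
    ultimately show "\<bar>g.centered n (t / \<sigma>' n) \<omega> - g.centered n (grid_floor c (2 ^ q) t / \<sigma>' n) \<omega>\<bar>
         \<le> 20 * A * sqrt (\<kappa>' n) * (9 / 10) ^ q + 2 * (\<alpha> + 1)"
      using S(3)[of \<omega> "t / \<sigma>' n"] n by (simp add: grid_floor_scale)
  qed
qed

end

section \<open>Limit theorems for the number of components\<close>

lemma (in graph_sequence) lipschitz_law_of_large_numbers:
  assumes c: "0 \<le> c" "c < 1"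
    and C: "\<And>x. x \<in> cadlag_space c \<Longrightarrow> \<bar>f x\<bar> \<le> C"
    and L: "0 \<le> L" "\<And>x y. x \<in> cadlag_space c \<Longrightarrow> y \<in> cadlag_space c \<Longrightarrow> \<bar>f x - f y\<bar> \<le> L * J1_dist c x y"
  shows "(\<lambda>n. \<integral>\<omega>. f (\<lambda>t\<in>{0..c}. 1 / \<kappa>' n * real (K_proc (z n) (G n) (t / \<sigma>' n) \<omega>)) \<partial>M n)
    \<longlonglongrightarrow> f (\<lambda>t\<in>{0..c}. 1 - t * (\<alpha> / 2))"
proof -
  define D where "D = \<alpha> + 1"
  define X where "X n \<omega> = (\<lambda>t\<in>{0..c}. 1 * (1 / \<kappa>' n * real (K_proc (z n) (G n) (t / \<sigma>' n) \<omega>) - 0))" for n \<omega>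
  define y where "y = (\<lambda>t\<in>{0..c}. 1 - t * (\<alpha> / 2))"
  have y: "y \<in> cadlag_space c"
  proof -
    have "continuous_on {0..c} (\<lambda>t. 1 - t * (\<alpha> / 2))" by (intro continuous_intros)
    moreover have "step_on c {} (\<lambda>_. 0)" by (simp add: step_on_def)
    ultimately have "(\<lambda>t\<in>{0..c}. 1 - t * (\<alpha> / 2) + 0) \<in> cadlag_space c" by (rule cadlag_continuous_plus_step)
    then show ?thesis by (simp add: y_def)
  qed
  obtain Q where Q: "0 \<le> Q" and cyc: "\<forall>\<^sub>F n in sequentially. \<forall>a>0.
    {\<omega> \<in> space (M n). a < g.cycle_count n (c / \<sigma>' n) \<omega>} \<in> g.events n \<and>
    g.prob n {\<omega> \<in> space (M n). a < g.cycle_count n (c / \<sigma>' n) \<omega>} \<le> Q / a"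
    by (rule cycle_count_tail_uniform[OF c])
  \<comment> \<open>The error terms are, in this order: the cycles and the constant 5 of
    \<open>components_expansion\<close>, the two deterministic ratios, and the two parts of the
    modulus bound.\<close>
  define r where "r n = 1 / sqrt (\<kappa>' n) + 5 / \<kappa>' n + \<bar>\<kappa> n / \<kappa>' n - 1\<bar> + \<bar>(\<sigma>1 n)\<^sup>2 / (\<kappa>' n * \<sigma>' n) - \<alpha>\<bar>
    + 20 / sqrt (sqrt (\<kappa>' n)) + 2 * D / \<kappa>' n" for n
  define p where "p n = 5 * (D + 3 * D\<^sup>2) / \<kappa>' n + Q / sqrt (\<kappa>' n)" for n
  have r_lim: "r \<longlonglongrightarrow> 0"
  proof -
    have "r \<longlonglongrightarrow> 0 + 0 + \<bar>1 - 1\<bar> + \<bar>\<alpha> - \<alpha>\<bar> + 0 + 0"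
      unfolding r_def by (intro tendsto_intros tendsto_over_kappa' kappa_lim alpha_lim)
    then show ?thesis by simp
  qed
  have p_lim: "p \<longlonglongrightarrow> 0"
  proof -
    have "p \<longlonglongrightarrow> 0 + 0" unfolding p_def by (intro tendsto_add tendsto_over_kappa')
    then show ?thesis by simp
  qed
  have "\<forall>\<^sub>F n in sequentially. 1 \<le> \<kappa>' n" using kappa'_infinity by (simp add: filterlim_at_top)
  with eventually_positive total_rate_le mean_count_diff cyc
  have bound: "\<forall>\<^sub>F n in sequentially. norm ((\<integral>\<omega>. f (X n \<omega>) \<partial>M n) - f y) \<le> L * r n + 2 * C * p n"
  proof eventually_elim
    case (elim n)
    \<comment> \<open>With A the fourth root of \<open>\<kappa>' n\<close>, chaining fails with
      probability of order 1 / A^4, while its leading deviation divided by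
      \<open>\<kappa>' n\<close> is 20 / A. The threshold k for the cycles is also negligible
      against \<open>\<kappa>' n\<close> and is exceeded with probability at most Q / k.\<close>
    define k where "k = sqrt (\<kappa>' n)"
    define A where "A = sqrt k"
    have k: "0 < k" "\<kappa>' n = k * k" using elim(1) by (simp_all add: k_def)
    have A: "0 < A" "k = A * A" using k by (simp_all add: A_def)
    have A4: "A ^ 4 = \<kappa>' n" by (simp add: k(2) A(2) power4_eq_xxxx)
    have one: "2 ^ 0 \<le> \<kappa>' n" using elim by simp
    \<comment> \<open>On the interval from 0 to 1 with a single cell, every t up to c < 1 is rounded
      down to 0, where the centred count vanishes. The modulus bound thus becomes a maximal
      inequality; on the interval from 0 to c the end point would be rounded to itself.\<close>
    obtain S where S: "S \<in> g.events n" "g.prob n S \<le> 5 * (D + 3 * D\<^sup>2) / A ^ 4 * (5000 / 6561) ^ 0"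
      "\<And>\<omega> t. \<omega> \<in> space (M n) - S \<Longrightarrow> t \<in> {0..1} \<Longrightarrow>
       \<bar>g.centered n (t / \<sigma>' n) \<omega> - g.centered n (grid_floor 1 (2 ^ 0) t / \<sigma>' n) \<omega>\<bar>
         \<le> 20 * A * sqrt (\<kappa>' n) * (9 / 10) ^ 0 + 2 * D"
      unfolding D_def
      by (rule modulus_bound_scaled[OF conjunct2[OF elim(1)] one zero_le_one order_refl A(1) elim(2)]) (rule that[unfolded D_def])
    let ?S = "S \<union> {\<omega> \<in> space (M n). k < g.cycle_count n (c / \<sigma>' n) \<omega>}"
    have ev: "?S \<in> g.events n" using S(1) elim(4) k by auto
    have pr: "g.prob n ?S \<le> p n"
    proof -
      have "g.prob n ?S \<le> g.prob n S + g.prob n {\<omega> \<in> space (M n). k < g.cycle_count n (c / \<sigma>' n) \<omega>}"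
        using S(1) elim(4) k by (intro measure_Un_le) auto
      also have "\<dots> \<le> 5 * (D + 3 * D\<^sup>2) / \<kappa>' n + Q / k"
        using S(2) elim(4) k A4 by (intro add_mono) auto
      finally show ?thesis by (simp add: p_def k_def)
    qed
    have Xm: "X n \<in> measurable (M n) (borel_of (J1_topology c))"
      unfolding X_def by (rule component_process_measurable) (use c elim in auto)
    have Ym: "(\<lambda>_. y) \<in> measurable (M n) (borel_of (J1_topology c))" by (rule measurable_const) (simp add: y)
    have r0: "0 \<le> r n" using elim alpha by (auto simp: r_def D_def)
    have close: "J1_dist c (X n \<omega>) y \<le> r n" if \<omega>: "\<omega> \<in> space (M n) - ?S" for \<omega>
    proof (rule J1_dist_le_sup[OF _ y r0])
      show "X n \<omega> \<in> cadlag_space c" using measurable_space[OF Xm, of \<omega>] \<omega> by simp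
      fix t assume t: "t \<in> {0..c}"
      let ?Z = "g.centered n (t / \<sigma>' n) \<omega>"
      have "grid_floor 1 1 t = 0" using t c by (simp add: grid_floor_def floor_eq_iff)
      then have Z: "\<bar>?Z\<bar> \<le> 20 * A * k + 2 * D"
        using S(3)[of \<omega> t] \<omega> t c by (simp add: centered_0 k_def)
      have cy: "g.cycle_count n (c / \<sigma>' n) \<omega> \<le> k" using \<omega> by auto
      let ?a = "1 / \<kappa>' n * real (K_proc (z n) (G n) (t / \<sigma>' n) \<omega>)"
      let ?b = "\<kappa> n / \<kappa>' n - 1" and ?d = "(\<sigma>1 n)\<^sup>2 / (\<kappa>' n * \<sigma>' n) - \<alpha>"
      have "\<bar>1 * (?a - (1 - t * (\<alpha> / 2))) - (1 * ?b - t / 2 * (1 * ?d) - 1 * ?Z / \<kappa>' n)\<bar>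
          \<le> 1 * (g.cycle_count n (c / \<sigma>' n) \<omega> + 5) / \<kappa>' n"
        by (rule components_expansion) (use elim \<omega> t c in auto)
      also have "\<dots> \<le> (k + 5) / \<kappa>' n" using cy elim by (intro divide_right_mono) auto
      also have "\<dots> = 1 / k + 5 / \<kappa>' n" using k by (simp add: add_divide_distrib)
      finally have 1: "\<bar>(?a - (1 - t * (\<alpha> / 2))) - (?b - t / 2 * ?d - ?Z / \<kappa>' n)\<bar> \<le> 1 / k + 5 / \<kappa>' n" by simp
      have "\<bar>?Z / \<kappa>' n\<bar> = \<bar>?Z\<bar> / \<kappa>' n" using elim by (simp add: abs_divide)
      also have "\<dots> \<le> (20 * A * k + 2 * D) / \<kappa>' n" using Z elim by (intro divide_right_mono) auto
      also have "\<dots> = 20 / A + 2 * D / \<kappa>' n" using k A by (simp add: add_divide_distrib)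
      finally have 2: "\<bar>?Z / \<kappa>' n\<bar> \<le> 20 / A + 2 * D / \<kappa>' n" .
      have 3: "\<bar>t / 2 * ?d\<bar> \<le> \<bar>?d\<bar>"
        unfolding abs_mult using t c mult_right_mono[of "\<bar>t / 2\<bar>" 1 "\<bar>?d\<bar>"] by simp
      have "\<bar>X n \<omega> t - y t\<bar> = \<bar>?a - (1 - t * (\<alpha> / 2))\<bar>" using t by (simp add: X_def y_def)
      also have "\<dots> \<le> r n"
        using 1 2 3 unfolding r_def k_def[symmetric] A_def[symmetric] by linarith
      finally show "\<bar>X n \<omega> t - y t\<bar> \<le> r n" .
    qed
    have "\<bar>(\<integral>\<omega>. f (X n \<omega>) \<partial>M n) - (\<integral>\<omega>. f y \<partial>M n)\<bar> \<le> L * r n + 2 * C * g.prob n ?S"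
      by (rule J1_lipschitz_expectation[OF g.prob_space_axioms Xm Ym C L ev close r0])
    also have "\<dots> \<le> L * r n + 2 * C * p n"
      using pr C[OF y] by (intro add_left_mono mult_left_mono) auto
    finally show ?case by (simp add: g.prob_space)
  qed
  have "(\<lambda>n. L * r n + 2 * C * p n) \<longlonglongrightarrow> L * 0 + 2 * C * 0" by (intro tendsto_intros r_lim p_lim)
  then have "(\<lambda>n. L * r n + 2 * C * p n) \<longlonglongrightarrow> 0" by simp
  with bound have "(\<lambda>n. (\<integral>\<omega>. f (X n \<omega>) \<partial>M n) - f y) \<longlonglongrightarrow> 0" by (rule Lim_null_comparison)
  then show ?thesis by (simp add: X_def y_def LIM_zero_iff)
qed

text \<open>Both paths are compared with their versions read on a grid of mesh c / 2 ^ q. For fixed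
  q the grid versions converge as n grows, and the cost of discretising splits into terms that
  depend on q alone and terms that vanish in n.\<close>

lemma (in graph_sequence) lipschitz_functional_limit:
  assumes B: "brownian_motion N B" and c: "0 \<le> c" "c < 1"
    and beta1: "(\<lambda>n. sqrt (\<kappa>' n) * (\<kappa> n / \<kappa>' n - 1)) \<longlonglongrightarrow> \<beta>1"
    and beta2: "(\<lambda>n. sqrt (\<kappa>' n) * ((\<sigma>1 n)\<^sup>2 / (\<kappa>' n * \<sigma>' n) - \<alpha>)) \<longlonglongrightarrow> \<beta>2"
    and C: "\<And>x. x \<in> cadlag_space c \<Longrightarrow> \<bar>f x\<bar> \<le> C"
    and L: "0 \<le> L" "\<And>x y. x \<in> cadlag_space c \<Longrightarrow> y \<in> cadlag_space c \<Longrightarrow> \<bar>f x - f y\<bar> \<le> L * J1_dist c x y"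
  defines "Y \<equiv> \<lambda>\<omega>. \<lambda>t\<in>{0..c}. \<beta>1 - \<beta>2 * (t / 2) + B (\<alpha> * (t / 2)) \<omega>"
  shows "Y \<in> measurable N (borel_of (J1_topology c))"
    "(\<lambda>n. \<integral>\<omega>. f (\<lambda>t\<in>{0..c}. sqrt (\<kappa>' n) * (1 / \<kappa>' n * real (K_proc (z n) (G n) (t / \<sigma>' n) \<omega>) - (1 - t * (\<alpha> / 2)))) \<partial>M n)
    \<longlonglongrightarrow> (\<integral>\<omega>. f (Y \<omega>) \<partial>N)"
proof -
  interpret brownian_motion N B by (rule B)
  define b where "b t = \<beta>1 - \<beta>2 * (t / 2)" for t
  define D where "D = \<alpha> + 1"
  define X where "X n \<omega> = (\<lambda>t\<in>{0..c}. sqrt (\<kappa>' n) * (1 / \<kappa>' n * real (K_proc (z n) (G n) (t / \<sigma>' n) \<omega>) - (1 - t * (\<alpha> / 2))))" for n \<omega>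
  define x where "x n \<omega> t = b t - g.centered n (t / \<sigma>' n) \<omega> / sqrt (\<kappa>' n)" for n \<omega> t
  define XS where "XS q n \<omega> = (\<lambda>t\<in>{0..c}. x n \<omega> (grid_floor c (2 ^ q) t))" for q n \<omega>
  define y where "y \<omega> t = b t + B (\<alpha> * (t / 2)) \<omega>" for \<omega> t
  define YS where "YS q \<omega> = (\<lambda>t\<in>{0..c}. y \<omega> (grid_floor c (2 ^ q) t))" for q \<omega>
  have Y_eq: "Y \<omega> = (\<lambda>t\<in>{0..c}. y \<omega> t)" for \<omega> by (simp add: Y_def y_def b_def)
  have y_cont: "continuous_on {0..c} (y \<omega>)" if \<omega>: "\<omega> \<in> space N" for \<omega>
  proof -
    have "continuous_on {0..c} (\<lambda>t. B (\<alpha> * (t / 2)) \<omega>)"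
      by (rule continuous_on_compose2[OF continuous_paths[OF \<omega>]])
        (use alpha in \<open>auto intro!: continuous_intros\<close>)
    then show ?thesis unfolding y_def b_def by (intro continuous_intros) auto
  qed
  have step0: "step_on c {} (\<lambda>_. 0)" by (simp add: step_on_def)
  have y_m: "(\<lambda>\<omega>. y \<omega> t) \<in> borel_measurable N" if "0 \<le> t" for t
    unfolding y_def using measurable_B[of "\<alpha> * (t / 2)"] that alpha by simp
  show Ym: "Y \<in> measurable N (borel_of (J1_topology c))"
    unfolding Y_eq[abs_def]
  proof (rule measurable_J1[OF c(1)])
    fix \<omega> assume "\<omega> \<in> space N"
    then show "\<exists>y' s F. continuous_on {0..c} y' \<and> step_on c F s \<and> F \<subseteq> {0<..c} \<and> (\<forall>t\<in>{0..c}. y \<omega> t = y' t + s t)"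
      using y_cont step0 by (intro exI[of _ "y \<omega>"] exI[of _ "\<lambda>_. 0"] exI[of _ "{}"]) auto
  qed (use y_m in auto)
  have YC: "Y \<omega> \<in> cadlag_space c" if "\<omega> \<in> space N" for \<omega> using measurable_space[OF Ym that] by simp
  have fm: "f \<in> borel_measurable (borel_of (J1_topology c))"
    unfolding J1_topology_def
    by (intro continuous_map_borel_measurable Metric_space.lipschitz_continuous_map[OF Metric_space_J1 L(2)])
  have C0: "0 \<le> C"
  proof -
    obtain \<omega> where "\<omega> \<in> space N" using not_empty by blast
    then show ?thesis using C[OF YC] by (meson abs_ge_zero order_trans)
  qed
  have YS_grid: "YS q \<omega> = grid_path c (2 ^ q) (\<lambda>j. y \<omega> (c * real j / real (2 ^ q)))" for q \<omega>
    unfolding YS_def by (rule grid_path_eq[OF c(1), symmetric])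
  have XS_grid: "XS q n \<omega> = grid_path c (2 ^ q) (\<lambda>j. x n \<omega> (c * real j / real (2 ^ q)))" for q n \<omega>
    unfolding XS_def by (rule grid_path_eq[OF c(1), symmetric])
  have YSm: "YS q \<in> measurable N (borel_of (J1_topology c))" for q
  proof -
    have "(\<lambda>\<omega> j. y \<omega> (c * real j / real (2 ^ q))) \<in> measurable N borel"
      using c by (intro measurable_coordinatewise_then_product y_m) auto
    from measurable_compose[OF this measurable_grid_path[OF c(1), of "2 ^ q"]]
    show ?thesis unfolding YS_grid[abs_def] by simp
  qed
  have YS_C: "YS q \<omega> \<in> cadlag_space c" for q \<omega> unfolding YS_grid by (rule grid_path_cadlag[OF c(1)]) simp
  have YS_lim: "(\<lambda>q. \<integral>\<omega>. f (YS q \<omega>) \<partial>N) \<longlonglongrightarrow> (\<integral>\<omega>. f (Y \<omega>) \<partial>N)"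
  proof (rule integral_dominated_convergence[where w = "\<lambda>_. C"])
    have "(\<lambda>q. f (YS q \<omega>)) \<longlonglongrightarrow> f (Y \<omega>)" if \<omega>: "\<omega> \<in> space N" for \<omega>
    proof -
      have lim: "(\<lambda>m. J1_dist c (\<lambda>t\<in>{0..c}. y \<omega> (grid_floor c (Suc m) t)) (\<lambda>t\<in>{0..c}. y \<omega> t)) \<longlonglongrightarrow> 0"
        by (rule J1_dist_grid_tendsto[OF c(1) y_cont[OF \<omega>] step0]) auto
      \<comment> \<open>The grid limit is indexed by \<open>Suc m\<close>, hence the shift by 1 in
        the subsequence of dyadic meshes.\<close>
      have "strict_mono (\<lambda>q. 2 ^ q - 1 :: nat)"
        by (rule strict_monoI) (simp add: diff_less_mono)
      from LIMSEQ_subseq_LIMSEQ[OF lim this]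
      have "(\<lambda>q. J1_dist c (YS q \<omega>) (Y \<omega>)) \<longlonglongrightarrow> 0"
        by (simp add: comp_def YS_def Y_eq Suc_diff_1)
      from tendsto_mult_left[OF this, of L] have "(\<lambda>q. L * J1_dist c (YS q \<omega>) (Y \<omega>)) \<longlonglongrightarrow> 0" by simp
      then have "(\<lambda>q. f (YS q \<omega>) - f (Y \<omega>)) \<longlonglongrightarrow> 0"
        by (rule Lim_null_comparison[rotated]) (use L(2)[OF YS_C YC[OF \<omega>]] in simp)
      then show ?thesis by (simp add: LIM_zero_iff)
    qed
    then show "AE \<omega> in N. (\<lambda>q. f (YS q \<omega>)) \<longlonglongrightarrow> f (Y \<omega>)" by (intro AE_I2)
    show "AE \<omega> in N. norm (f (YS q \<omega>)) \<le> C" for q using C[OF YS_C] by simp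
  qed (use measurable_compose[OF Ym fm] measurable_compose[OF YSm fm] in auto)
  have XS_lim: "(\<lambda>n. \<integral>\<omega>. f (XS q n \<omega>) \<partial>M n) \<longlonglongrightarrow> (\<integral>\<omega>. f (YS q \<omega>) \<partial>N)" for q
    using grid_increments_convergence[OF B c(1) less_imp_le[OF c(2)], of "2 ^ q" f C L b] C L
    unfolding XS_grid YS_grid x_def y_def by simp
  obtain Q where Q: "0 \<le> Q" and cyc: "\<forall>\<^sub>F n in sequentially. \<forall>a>0.
    {\<omega> \<in> space (M n). a < g.cycle_count n (c / \<sigma>' n) \<omega>} \<in> g.events n \<and>
    g.prob n {\<omega> \<in> space (M n). a < g.cycle_count n (c / \<sigma>' n) \<omega>} \<le> Q / a"
    by (rule cycle_count_tail_uniform[OF c])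
  \<comment> \<open>The terms r1 and p1 depend on the mesh only: they come from the chaining bound
    with A = 1 and from the change of the drift over a cell. The terms r2 and p2 vanish as n
    grows.\<close>
  define r1 where "r1 q = 20 * (9 / 10) ^ q + \<bar>\<beta>2\<bar> * (1 / 2) ^ q" for q
  define r2 where "r2 n = 1 / sqrt (sqrt (\<kappa>' n)) + 5 / sqrt (\<kappa>' n) + 2 * D / sqrt (\<kappa>' n)
    + \<bar>sqrt (\<kappa>' n) * (\<kappa> n / \<kappa>' n - 1) - \<beta>1\<bar> + \<bar>sqrt (\<kappa>' n) * ((\<sigma>1 n)\<^sup>2 / (\<kappa>' n * \<sigma>' n) - \<alpha>) - \<beta>2\<bar>" for n
  define p1 where "p1 q = 5 * (D + 3 * D\<^sup>2) * (5000 / 6561) ^ q" for q :: nat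
  define p2 where "p2 n = Q / sqrt (sqrt (\<kappa>' n))" for n
  have r1_lim: "r1 \<longlonglongrightarrow> 0"
  proof -
    have "r1 \<longlonglongrightarrow> 20 * 0 + \<bar>\<beta>2\<bar> * 0" unfolding r1_def by (intro tendsto_intros LIMSEQ_realpow_zero) auto
    then show ?thesis by simp
  qed
  have p1_lim: "p1 \<longlonglongrightarrow> 0"
  proof -
    have "p1 \<longlonglongrightarrow> 5 * (D + 3 * D\<^sup>2) * 0" unfolding p1_def by (intro tendsto_intros LIMSEQ_realpow_zero) auto
    then show ?thesis by simp
  qed
  have r2_lim: "r2 \<longlonglongrightarrow> 0"
  proof -
    have "r2 \<longlonglongrightarrow> 0 + 0 + 0 + \<bar>\<beta>1 - \<beta>1\<bar> + \<bar>\<beta>2 - \<beta>2\<bar>"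
      unfolding r2_def by (intro tendsto_intros tendsto_over_kappa' beta1 beta2)
    then show ?thesis by simp
  qed
  have p2_lim: "p2 \<longlonglongrightarrow> 0" unfolding p2_def by (rule tendsto_over_kappa')
  have main: "\<forall>\<^sub>F n in sequentially. \<bar>(\<integral>\<omega>. f (X n \<omega>) \<partial>M n) - (\<integral>\<omega>. f (XS q n \<omega>) \<partial>M n)\<bar>
      \<le> L * (r1 q + r2 n) + 2 * C * (p1 q + p2 n)" for q
  proof -
    have "\<forall>\<^sub>F n in sequentially. 2 ^ q \<le> \<kappa>' n" using kappa'_infinity by (simp add: filterlim_at_top)
    with eventually_positive total_rate_le mean_count_diff cyc show ?thesis
    proof eventually_elim
      case (elim n)
      \<comment> \<open>The fourth root A of \<open>\<kappa>' n\<close> is now the threshold for the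
        cycle count: A / k = 1 / A tends to 0, and so does the tail bound Q / A. The chaining
        parameter is 1 instead, because the oscillation relative to k is made small by the choice of
        q.\<close>
      define k where "k = sqrt (\<kappa>' n)"
      define A where "A = sqrt k"
      have k: "0 < k" "\<kappa>' n = k * k" using elim(1) by (simp_all add: k_def)
      have A: "0 < A" "k = A * A" using k by (simp_all add: A_def)
      obtain S where S: "S \<in> g.events n" "g.prob n S \<le> 5 * (D + 3 * D\<^sup>2) / 1 ^ 4 * (5000 / 6561) ^ q"
        "\<And>\<omega> t. \<omega> \<in> space (M n) - S \<Longrightarrow> t \<in> {0..c} \<Longrightarrow>
         \<bar>g.centered n (t / \<sigma>' n) \<omega> - g.centered n (grid_floor c (2 ^ q) t / \<sigma>' n) \<omega>\<bar>
           \<le> 20 * 1 * sqrt (\<kappa>' n) * (9 / 10) ^ q + 2 * D"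
        unfolding D_def
        by (rule modulus_bound_scaled[OF conjunct2[OF elim(1)] elim(5) c(1) less_imp_le[OF c(2)] zero_less_one elim(2)])
          (rule that[unfolded D_def])
      let ?S = "S \<union> {\<omega> \<in> space (M n). A < g.cycle_count n (c / \<sigma>' n) \<omega>}"
      have ev: "?S \<in> g.events n" using S(1) elim(4) A by auto
      have pr: "g.prob n ?S \<le> p1 q + p2 n"
      proof -
        have "g.prob n ?S \<le> g.prob n S + g.prob n {\<omega> \<in> space (M n). A < g.cycle_count n (c / \<sigma>' n) \<omega>}"
          using S(1) elim(4) A by (intro measure_Un_le) auto
        also have "\<dots> \<le> p1 q + Q / A"
          using S(2) elim(4) A by (intro add_mono) (auto simp: p1_def)
        finally show ?thesis by (simp add: p2_def k_def A_def)
      qed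
      have Xm: "X n \<in> measurable (M n) (borel_of (J1_topology c))"
        unfolding X_def by (rule component_process_measurable) (use c elim in \<open>auto intro!: continuous_intros\<close>)
      have XSm: "XS q n \<in> measurable (M n) (borel_of (J1_topology c))"
      proof -
        have "(\<lambda>\<omega> j. x n \<omega> (c * real j / real (2 ^ q))) \<in> measurable (M n) borel"
        proof (rule measurable_coordinatewise_then_product)
          fix j
          have "0 \<le> c * real j / real (2 ^ q) / \<sigma>' n" using c elim by simp
          from g.centered_measurable[OF this]
          show "(\<lambda>\<omega>. x n \<omega> (c * real j / real (2 ^ q))) \<in> borel_measurable (M n)" unfolding x_def by simp
        qed
        from measurable_compose[OF this measurable_grid_path[OF c(1), of "2 ^ q"]]
        show ?thesis unfolding XS_grid[abs_def] by simp
      qed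
      have r0: "0 \<le> r1 q + r2 n" using k alpha by (auto simp: r1_def r2_def D_def)
      have close: "J1_dist c (X n \<omega>) (XS q n \<omega>) \<le> r1 q + r2 n" if \<omega>: "\<omega> \<in> space (M n) - ?S" for \<omega>
      proof (rule J1_dist_le_sup[OF _ _ r0])
        show "X n \<omega> \<in> cadlag_space c" using measurable_space[OF Xm, of \<omega>] \<omega> by simp
        show "XS q n \<omega> \<in> cadlag_space c" using measurable_space[OF XSm, of \<omega>] \<omega> by simp
        fix t assume t: "t \<in> {0..c}"
        let ?h = "grid_floor c (2 ^ q) t"
        let ?Z = "g.centered n (t / \<sigma>' n) \<omega>" and ?W = "g.centered n (?h / \<sigma>' n) \<omega>"
        have Z: "\<bar>?Z - ?W\<bar> \<le> 20 * k * (9 / 10) ^ q + 2 * D"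
          using S(3)[of \<omega> t] \<omega> t by (simp add: k_def)
        have cy: "g.cycle_count n (c / \<sigma>' n) \<omega> \<le> A" using \<omega> by auto
        let ?b1 = "k * (\<kappa> n / \<kappa>' n - 1)" and ?b2 = "k * ((\<sigma>1 n)\<^sup>2 / (\<kappa>' n * \<sigma>' n) - \<alpha>)"
        have "\<bar>X n \<omega> t - (?b1 - t / 2 * ?b2 - k * ?Z / \<kappa>' n)\<bar> \<le> k * (g.cycle_count n (c / \<sigma>' n) \<omega> + 5) / \<kappa>' n"
          unfolding k_def X_def using t
          by (simp only: restrict_apply if_True) (rule components_expansion, use elim \<omega> t c in auto)
        also have "\<dots> \<le> k * (A + 5) / \<kappa>' n" using cy elim k by (intro divide_right_mono mult_left_mono) auto
        also have "\<dots> = (A + 5) / k" using k by simp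
        also have "\<dots> = 1 / A + 5 / k" using A by (simp add: add_divide_distrib)
        finally have 1: "\<bar>X n \<omega> t - (?b1 - t / 2 * ?b2 - k * ?Z / \<kappa>' n)\<bar> \<le> 1 / A + 5 / k" .
        have kZ: "k * ?Z / \<kappa>' n = ?Z / k" using k by simp
        have "\<bar>?Z / k - ?W / k\<bar> = \<bar>?Z - ?W\<bar> / k" using k by (simp add: diff_divide_distrib[symmetric] abs_divide)
        also have "\<dots> \<le> (20 * k * (9 / 10) ^ q + 2 * D) / k" using Z k by (intro divide_right_mono) auto
        also have "\<dots> = 20 * (9 / 10) ^ q + 2 * D / k" using k by (simp add: add_divide_distrib)
        finally have 2: "\<bar>?Z / k - ?W / k\<bar> \<le> 20 * (9 / 10) ^ q + 2 * D / k" .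
        have 3: "\<bar>t / 2 * (?b2 - \<beta>2)\<bar> \<le> \<bar>?b2 - \<beta>2\<bar>"
          unfolding abs_mult using t c mult_right_mono[of "\<bar>t / 2\<bar>" 1 "\<bar>?b2 - \<beta>2\<bar>"] by simp
        have th: "\<bar>t - ?h\<bar> \<le> (1 / 2) ^ q"
        proof -
          have "\<bar>t - ?h\<bar> \<le> c / real (2 ^ q)" using grid_floor_bounds[OF c(1) _ t, of "2 ^ q"] by simp
          also have "\<dots> \<le> 1 / real (2 ^ q)" using c by (intro divide_right_mono) auto
          finally show ?thesis by (simp add: power_one_over)
        qed
        have "\<bar>\<beta>2 * ((t - ?h) / 2)\<bar> = \<bar>\<beta>2\<bar> * (\<bar>t - ?h\<bar> / 2)" by (simp add: abs_mult)
        also have "\<dots> \<le> \<bar>\<beta>2\<bar> * (1 / 2) ^ q" using th by (intro mult_left_mono) auto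
        finally have 4: "\<bar>\<beta>2 * ((t - ?h) / 2)\<bar> \<le> \<bar>\<beta>2\<bar> * (1 / 2) ^ q" .
        have XS_t: "XS q n \<omega> t = \<beta>1 - \<beta>2 * (?h / 2) - ?W / k" using t by (simp add: XS_def x_def b_def k_def)
        \<comment> \<open>The five parts are the cycle error, the two deterministic limits, the
          drift over a cell, and the oscillation of the centred count.\<close>
        have eq: "X n \<omega> t - XS q n \<omega> t = (X n \<omega> t - (?b1 - t / 2 * ?b2 - ?Z / k)) + (?b1 - \<beta>1)
            - t / 2 * (?b2 - \<beta>2) - \<beta>2 * ((t - ?h) / 2) - (?Z / k - ?W / k)"
          unfolding XS_t by (simp add: algebra_simps diff_divide_distrib)
        have tri: "\<bar>v1 + v2 - v3 - v4 - v5\<bar> \<le> w1 + \<bar>v2\<bar> + w3 + w4 + w5"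
          if "\<bar>v1\<bar> \<le> w1" "\<bar>v3\<bar> \<le> w3" "\<bar>v4\<bar> \<le> w4" "\<bar>v5\<bar> \<le> w5" for v1 v2 v3 v4 v5 w1 w3 w4 w5 :: real
          using that by linarith
        have "\<bar>X n \<omega> t - XS q n \<omega> t\<bar> \<le> (1 / A + 5 / k) + \<bar>?b1 - \<beta>1\<bar> + \<bar>?b2 - \<beta>2\<bar>
            + \<bar>\<beta>2\<bar> * (1 / 2) ^ q + (20 * (9 / 10) ^ q + 2 * D / k)"
          unfolding eq by (rule tri[OF 1[unfolded kZ] 3 4 2])
        also have "\<dots> = r1 q + r2 n"
          unfolding r1_def r2_def k_def[symmetric] A_def[symmetric] by (simp only: ac_simps)
        finally show "\<bar>X n \<omega> t - XS q n \<omega> t\<bar> \<le> r1 q + r2 n" .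
      qed
      have "\<bar>(\<integral>\<omega>. f (X n \<omega>) \<partial>M n) - (\<integral>\<omega>. f (XS q n \<omega>) \<partial>M n)\<bar> \<le> L * (r1 q + r2 n) + 2 * C * g.prob n ?S"
        by (rule J1_lipschitz_expectation[OF g.prob_space_axioms Xm XSm C L ev close r0])
      also have "\<dots> \<le> L * (r1 q + r2 n) + 2 * C * (p1 q + p2 n)"
        using pr C0 by (intro add_left_mono mult_left_mono) auto
      finally show ?case .
    qed
  qed
  have "(\<lambda>n. \<integral>\<omega>. f (X n \<omega>) \<partial>M n) \<longlonglongrightarrow> (\<integral>\<omega>. f (Y \<omega>) \<partial>N)"
  proof (rule LIMSEQ_I)
    fix e :: real assume e: "0 < e"
    \<comment> \<open>The mesh is fixed first, which makes all terms depending on q alone small.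
      Then n is taken large, as the grid limit is available for a fixed mesh only.\<close>
    have "(\<lambda>q. L * r1 q + 2 * C * p1 q + \<bar>(\<integral>\<omega>. f (YS q \<omega>) \<partial>N) - (\<integral>\<omega>. f (Y \<omega>) \<partial>N)\<bar>)
        \<longlonglongrightarrow> L * 0 + 2 * C * 0 + \<bar>(\<integral>\<omega>. f (Y \<omega>) \<partial>N) - (\<integral>\<omega>. f (Y \<omega>) \<partial>N)\<bar>"
      by (intro tendsto_intros r1_lim p1_lim YS_lim)
    then have "\<forall>\<^sub>F q in sequentially. L * r1 q + 2 * C * p1 q + \<bar>(\<integral>\<omega>. f (YS q \<omega>) \<partial>N) - (\<integral>\<omega>. f (Y \<omega>) \<partial>N)\<bar> < e / 2"
      using e by (intro order_tendstoD(2)) auto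
    then obtain q where q: "L * r1 q + 2 * C * p1 q + \<bar>(\<integral>\<omega>. f (YS q \<omega>) \<partial>N) - (\<integral>\<omega>. f (Y \<omega>) \<partial>N)\<bar> < e / 2"
      using eventually_happens'[OF sequentially_bot] by blast
    have "(\<lambda>n. L * r2 n + 2 * C * p2 n + \<bar>(\<integral>\<omega>. f (XS q n \<omega>) \<partial>M n) - (\<integral>\<omega>. f (YS q \<omega>) \<partial>N)\<bar>)
        \<longlonglongrightarrow> L * 0 + 2 * C * 0 + \<bar>(\<integral>\<omega>. f (YS q \<omega>) \<partial>N) - (\<integral>\<omega>. f (YS q \<omega>) \<partial>N)\<bar>"
      by (intro tendsto_intros r2_lim p2_lim XS_lim)
    then have "\<forall>\<^sub>F n in sequentially. L * r2 n + 2 * C * p2 n + \<bar>(\<integral>\<omega>. f (XS q n \<omega>) \<partial>M n) - (\<integral>\<omega>. f (YS q \<omega>) \<partial>N)\<bar> < e / 2"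
      using e by (intro order_tendstoD(2)) auto
    with main[of q] have "\<forall>\<^sub>F n in sequentially. norm ((\<integral>\<omega>. f (X n \<omega>) \<partial>M n) - (\<integral>\<omega>. f (Y \<omega>) \<partial>N)) < e"
    proof eventually_elim
      case (elim n)
      then show ?case using q unfolding distrib_left real_norm_def by linarith
    qed
    then show "\<exists>n0. \<forall>n\<ge>n0. norm ((\<integral>\<omega>. f (X n \<omega>) \<partial>M n) - (\<integral>\<omega>. f (Y \<omega>) \<partial>N)) < e"
      by (simp add: eventually_sequentially)
  qed
  then show "(\<lambda>n. \<integral>\<omega>. f (\<lambda>t\<in>{0..c}. sqrt (\<kappa>' n) * (1 / \<kappa>' n * real (K_proc (z n) (G n) (t / \<sigma>' n) \<omega>) - (1 - t * (\<alpha> / 2)))) \<partial>M n)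
    \<longlonglongrightarrow> (\<integral>\<omega>. f (Y \<omega>) \<partial>N)" by (simp only: X_def)
qed

section \<open>The hypotheses as finite sums, and the conclusion\<close>

lemma finite_kappa_vertices:
  assumes "kappa z < \<infinity>"
  shows "finite (vertices z)" "enn2real (kappa z) = real (card (vertices z))"
proof -
  \<comment> \<open>Read as the counting measure of the vertex set, the series is finite only if
    that set is finite.\<close>
  have k: "kappa z = emeasure (count_space UNIV) (vertices z)"
  proof -
    have "kappa z = (\<integral>\<^sup>+i. indicator (vertices z) i \<partial>count_space UNIV)"
      unfolding kappa_def nn_integral_count_space_nat
      by (intro arg_cong[where f = suminf] ext) (simp add: indicator_def vertices_def)
    then show ?thesis by simp
  qed
  show fin: "finite (vertices z)"
  proof (rule ccontr)
    assume "infinite (vertices z)"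
    then show False using assms k by simp
  qed
  show "enn2real (kappa z) = real (card (vertices z))" using fin k by simp
qed

text \<open>For positive k the zero entries contribute nothing; for k = 0 each would contribute 0 ^
  0 = 1.\<close>

lemma sigma_pow_vertices:
  assumes fin: "finite (vertices z)" and z: "\<And>i. 0 \<le> z i" and k: "0 < k"
  shows "enn2real (sigma_pow k z) = (\<Sum>i\<in>vertices z. z i ^ k)"
proof -
  have "sigma_pow k z = (\<Sum>i\<in>vertices z. ennreal (z i ^ k))"
    unfolding sigma_pow_def
  proof (rule suminf_finite[OF fin])
    fix i assume "i \<notin> vertices z"
    then have "z i = 0" using z[of i] by (auto simp: vertices_def)
    then show "ennreal (z i ^ k) = 0" using k by simp
  qed
  also have "\<dots> = ennreal (\<Sum>i\<in>vertices z. z i ^ k)" using z by (subst sum_ennreal) auto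
  finally show ?thesis using z by (simp add: sum_nonneg)
qed

theorem theorem2p3:
  fixes z :: "nat \<Rightarrow> nat \<Rightarrow> real"
    and M :: "nat \<Rightarrow> 'w measure"
    and G :: "nat \<Rightarrow> real \<Rightarrow> 'w \<Rightarrow> nat set set"
    and N :: "'v measure" and B :: "real \<Rightarrow> 'v \<Rightarrow> real"
    and \<kappa>' \<sigma>' :: "nat \<Rightarrow> real" and \<alpha> :: real
  defines "\<kappa> \<equiv> \<lambda>n. enn2real (kappa (z n))"
    and "\<sigma>1 \<equiv> \<lambda>n. enn2real (sigma_pow 1 (z n))"
    and "\<sigma>2 \<equiv> \<lambda>n. enn2real (sigma_pow 2 (z n))"
    and "K \<equiv> \<lambda>n t \<omega>. real (K_proc (z n) (G n) t \<omega>)"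
  assumes z: "\<And>n. z n \<in> l2_dec"
    and G: "\<And>n. mult_graph_process (M n) (z n) (G n)"
    and finite_kappa: "\<And>n. kappa (z n) < \<infinity>"
    and kappa_infinity: "filterlim \<kappa> at_top sequentially"
    and kappa_lim: "(\<lambda>n. \<kappa> n / \<kappa>' n) \<longlonglongrightarrow> 1"
    and sigma2_lim: "(\<lambda>n. \<sigma>2 n / \<sigma>' n) \<longlonglongrightarrow> 1"
    and alpha: "0 \<le> \<alpha>"
    and alpha_lim: "(\<lambda>n. (\<sigma>1 n)\<^sup>2 / (\<kappa>' n * \<sigma>' n)) \<longlonglongrightarrow> \<alpha>"
  shows "(\<forall>c. 0 \<le> c \<and> c < 1 \<longrightarrow>
      converges_in_distribution_const (J1_topology c) M
        (\<lambda>n \<omega>. \<lambda>t\<in>{0..c}. 1 / \<kappa>' n * K n (t / \<sigma>' n) \<omega>)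
        (\<lambda>t\<in>{0..c}. 1 - t * (\<alpha> / 2))) \<and>
    (\<forall>\<beta>1 \<beta>2. brownian_motion N B \<and> 0 \<le> \<beta>1 \<and> 0 \<le> \<beta>2 \<and>
      (\<lambda>n. sqrt (\<kappa>' n) * (\<kappa> n / \<kappa>' n - 1)) \<longlonglongrightarrow> \<beta>1 \<and>
      (\<lambda>n. sqrt (\<kappa>' n) * ((\<sigma>1 n)\<^sup>2 / (\<kappa>' n * \<sigma>' n) - \<alpha>)) \<longlonglongrightarrow> \<beta>2 \<longrightarrow>
      (\<forall>c. 0 \<le> c \<and> c < 1 \<longrightarrow>
        converges_in_distribution (J1_topology c) M
          (\<lambda>n \<omega>. \<lambda>t\<in>{0..c}.
             sqrt (\<kappa>' n) * (1 / \<kappa>' n * K n (t / \<sigma>' n) \<omega> - (1 - t * (\<alpha> / 2))))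
          N
          (\<lambda>\<omega>. \<lambda>t\<in>{0..c}. \<beta>1 - \<beta>2 * (t / 2) + B (\<alpha> * (t / 2)) \<omega>)))"
proof -
  have fin: "finite (vertices (z n))" for n by (rule finite_kappa_vertices(1)[OF finite_kappa])
  have nonneg: "0 \<le> z n i" for n i using z[of n] by (simp add: l2_dec_def)
  interpret graph_sequence M z G \<kappa>' \<sigma>' \<alpha> \<kappa> \<sigma>1 \<sigma>2
  proof (rule graph_sequence.intro)
    show "finite_mult_graph_process (M n) (z n) (G n)" for n
      using G fin by (simp add: finite_mult_graph_process_def finite_mult_graph_process_axioms_def)
    show "\<kappa> n = real (card (vertices (z n)))" for n
      unfolding \<kappa>_def by (rule finite_kappa_vertices(2)[OF finite_kappa])
    show "\<sigma>1 n = (\<Sum>i\<in>vertices (z n). z n i)" for n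
      unfolding \<sigma>1_def using sigma_pow_vertices[OF fin nonneg, of 1] by simp
    show "\<sigma>2 n = (\<Sum>i\<in>vertices (z n). (z n i)\<^sup>2)" for n
      unfolding \<sigma>2_def using sigma_pow_vertices[OF fin nonneg, of 2] by simp
  qed fact+
  have prob: "prob_space (M n)" for n by (rule g.prob_space_axioms)
  show ?thesis
  proof (intro conjI allI impI, goal_cases)
    case (1 c)
    let ?Q = "return (count_space UNIV) ()"
    have Q: "prob_space ?Q" by (rule prob_space_return) simp
    show ?case
      unfolding converges_in_distribution_const_def J1_topology_def K_def
    proof (rule Metric_space.weak_convergence_lipschitz[OF Metric_space_J1 prob Q], fold J1_topology_def)
      show "\<forall>\<^sub>F n in sequentially. (\<lambda>\<omega>. \<lambda>t\<in>{0..c}. 1 / \<kappa>' n * real (K_proc (z n) (G n) (t / \<sigma>' n) \<omega>))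
          \<in> measurable (M n) (borel_of (J1_topology c))"
        using eventually_positive
      proof eventually_elim
        case (elim n)
        from component_process_measurable[where a = 1 and b = "1 / \<kappa>' n" and y = "\<lambda>_. 0" and c = c and n = n] 1 elim
        show ?case by simp
      qed
      have "continuous_on {0..c} (\<lambda>t. 1 - t * (\<alpha> / 2))" by (intro continuous_intros)
      moreover have "step_on c {} (\<lambda>_. 0)" by (simp add: step_on_def)
      ultimately have "(\<lambda>t\<in>{0..c}. 1 - t * (\<alpha> / 2) + 0) \<in> cadlag_space c" by (rule cadlag_continuous_plus_step)
      then show "(\<lambda>_. \<lambda>t\<in>{0..c}. 1 - t * (\<alpha> / 2)) \<in> measurable ?Q (borel_of (J1_topology c))"
        by (intro measurable_const) simp
    next
      fix f :: "(real \<Rightarrow> real) \<Rightarrow> real" and L C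
      assume f: "\<forall>x\<in>cadlag_space c. \<bar>f x\<bar> \<le> C"
        "\<forall>x\<in>cadlag_space c. \<forall>y\<in>cadlag_space c. \<bar>f x - f y\<bar> \<le> L * J1_dist c x y" "0 \<le> L"
      have "(\<lambda>n. \<integral>\<omega>. f (\<lambda>t\<in>{0..c}. 1 / \<kappa>' n * real (K_proc (z n) (G n) (t / \<sigma>' n) \<omega>)) \<partial>M n)
          \<longlonglongrightarrow> f (\<lambda>t\<in>{0..c}. 1 - t * (\<alpha> / 2))"
        by (rule lipschitz_law_of_large_numbers) (use 1 f in auto)
      then show "(\<lambda>n. \<integral>\<omega>. f (\<lambda>t\<in>{0..c}. 1 / \<kappa>' n * real (K_proc (z n) (G n) (t / \<sigma>' n) \<omega>)) \<partial>M n)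
          \<longlonglongrightarrow> (\<integral>\<omega>. f (\<lambda>t\<in>{0..c}. 1 - t * (\<alpha> / 2)) \<partial>?Q)"
        using prob_space.prob_space[OF Q] by simp
    qed
  next
    case (2 \<beta>1 \<beta>2 c)
    then have B: "brownian_motion N B" and c: "0 \<le> c" "c < 1"
      and beta1: "(\<lambda>n. sqrt (\<kappa>' n) * (\<kappa> n / \<kappa>' n - 1)) \<longlonglongrightarrow> \<beta>1"
      and beta2: "(\<lambda>n. sqrt (\<kappa>' n) * ((\<sigma>1 n)\<^sup>2 / (\<kappa>' n * \<sigma>' n) - \<alpha>)) \<longlonglongrightarrow> \<beta>2" by auto
    interpret B: brownian_motion N B by (rule B)
    show ?case
      unfolding J1_topology_def K_def
    proof (rule Metric_space.weak_convergence_lipschitz[OF Metric_space_J1 prob B.prob_space_axioms], fold J1_topology_def)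
      show "\<forall>\<^sub>F n in sequentially. (\<lambda>\<omega>. \<lambda>t\<in>{0..c}. sqrt (\<kappa>' n) * (1 / \<kappa>' n * real (K_proc (z n) (G n) (t / \<sigma>' n) \<omega>) - (1 - t * (\<alpha> / 2))))
          \<in> measurable (M n) (borel_of (J1_topology c))"
        using eventually_positive
        by eventually_elim (rule component_process_measurable, use c in \<open>auto intro!: continuous_intros\<close>)
      \<comment> \<open>The measurability half does not involve the test function, so the zero
        functional with both bounds 0 takes its place.\<close>
      show "(\<lambda>\<omega>. \<lambda>t\<in>{0..c}. \<beta>1 - \<beta>2 * (t / 2) + B (\<alpha> * (t / 2)) \<omega>) \<in> measurable N (borel_of (J1_topology c))"
        by (rule lipschitz_functional_limit(1)[OF B c beta1 beta2, of "\<lambda>_. 0" 0 0]) auto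
    next
      fix f :: "(real \<Rightarrow> real) \<Rightarrow> real" and L C
      assume f: "\<forall>x\<in>cadlag_space c. \<bar>f x\<bar> \<le> C"
        "\<forall>x\<in>cadlag_space c. \<forall>y\<in>cadlag_space c. \<bar>f x - f y\<bar> \<le> L * J1_dist c x y" "0 \<le> L"
      show "(\<lambda>n. \<integral>\<omega>. f (\<lambda>t\<in>{0..c}. sqrt (\<kappa>' n) * (1 / \<kappa>' n * real (K_proc (z n) (G n) (t / \<sigma>' n) \<omega>) - (1 - t * (\<alpha> / 2)))) \<partial>M n)
          \<longlonglongrightarrow> (\<integral>\<omega>. f (\<lambda>t\<in>{0..c}. \<beta>1 - \<beta>2 * (t / 2) + B (\<alpha> * (t / 2)) \<omega>) \<partial>N)"
        by (rule lipschitz_functional_limit(2)[OF B c beta1 beta2, of f C L]) (use f in auto)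
    qed
  qed
qed

end
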